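(* Let $d\in\mathbb N$, $1\le p,q\le\infty$, $\sigma_{p,q}=\left(\frac1q-\frac1p\right)_+$, $\alpha>\sigma_{p,q}$, $\beta\in\mathbb R$, $\gamma\ge 0$, $\gamma-\beta<\alpha-\sigma_{p,q}$, and let $T\in\mathbb R$, $T<1$. Let $Q=(Q_j(\cdot,\varphi_j,\widetilde\varphi_j))_{j\in\mathbb Z_+}$ be a family of quasi-interpolation operators with $\widetilde\varphi_j\in\mathcal D'(\mathbb T)$ and $\varphi_j\in\mathcal T_j^1$ for each $j\in\mathbb Z_+$. Suppose that for some $N\ge 0$ and some $s>\max(\alpha+\beta,\alpha)$ there are constants $C_{\widetilde\varphi},C_\varphi,C_{\varphi,\widetilde\varphi,s}$ such that for all $j\in\mathbb Z_+$: $$|\widehat{\widetilde\varphi_j}(\ell)|\le C_{\widetilde\varphi}(1+|2^{-j}\ell|^N)\ \text{ for all }\ell\in\mathbb Z,\qquad |\widehat{\varphi_j}(\ell)|\le C_\varphi\ \text{ for all }\ell\in\mathbb Z,$$ $$|1-\widehat{\varphi_j}(\ell)\widehat{\widetilde\varphi_j}(\ell)|\le C_{\varphi,\widetilde\varphi,s}|2^{-j}\ell|^s\ \text{ for all }\ell\in D_j.$$ Assume also that at least one of the following holds: (i) $\min(\alpha+\beta,\alpha)>N+1/p'$; or (ii) $N=0$ and $\sup_{j\in\mathbb Z_+}\|\widetilde\varphi_j\|_{\widetilde A_{q',j}(\mathbb T)}<\infty$. Then there is a constant $C$, not depending on $f$ and $n$, such that for all $f\in A_p^{\alpha,\beta}(\mathbb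 T^d)$ and all $n\in\mathbb N$, $$\|f-P_{n,T}^Qf\|_{A_q^\gamma(\mathbb T^d)}\le C\,\Omega(n)\,\|f\|_{A_p^{\alpha,\beta}(\mathbb T^d)},$$ where $$\Omega(n)=\begin{cases}2^{-\left(\alpha+\beta-\gamma-\sigma_{p,q}-\left((\alpha-\sigma_{p,q})T-(\gamma-\beta)\right)\frac{d-1}{d-T}\right)n}\,n^{(d-1)(1-\frac1p)}, & T\ge\frac{\gamma-\beta}{\alpha-\sigma_{p,q}},\\[2mm] 2^{-(\alpha+\beta-\gamma-\sigma_{p,q})n}, & T<\frac{\gamma-\beta}{\alpha-\sigma_{p,q}}.\end{cases}$$
   Context: $\mathbb T^d=\mathbb R^d/2\pi\mathbb Z^d$, $\mathbb Z_+=\{0,1,2,\dots\}$, $\frac1p+\frac1{p'}=1$, $\widehat f(\mathbf k)=(2\pi)^{-d}\int_{\mathbb T^d}f(\mathbf x)e^{-\mathrm i(\mathbf k,\mathbf x)}d\mathbf x$. For $\mathbf k\in\mathbb Z_+^d$: $|\mathbf k|_1=\sum_ik_i$, $|\mathbf k|_\infty=\max_ik_i$. Spaces. For $0<q\le\infty$, $\alpha,\beta\in\mathbb R$, the hybrid Wiener space $A_q^{\alpha,\beta}(\mathbb T^d)$ is the set of $f\in L_1(\mathbb T^d)$ with finite $\|f\|_{A_q^{\alpha,\beta}(\mathbb T^d)}=\big(\sum_{\mathbf k\in\mathbb Z^d}\prod_{j=1}^d(1+|k_j|)^{q\alpha}(1+|\mathbf k|)^{q\beta}|\widehat f(\mathbf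 k)|^q\big)^{1/q}$ (supremum if $q=\infty$), $|\mathbf k|$ being the Euclidean norm. The isotropic Wiener space is $A_q^\gamma(\mathbb T^d)=A_q^{0,\gamma}(\mathbb T^d)$. Norms are considered up to equivalence. Sets and polynomials. $D_j=[-2^{j-1},2^{j-1})\cap\mathbb Z$; $\mathcal T_j^1=\mathrm{span}\{e^{\mathrm i kx}:k\in D_j\}$. $\mathcal D'(\mathbb T)$ is the space of periodic distributions on $\mathbb T$, with Fourier expansions $\widetilde\varphi=\sum_{k\in\mathbb Z}\widehat{\widetilde\varphi}(k)e^{\mathrm i kx}$. Amalgam-type norm: $\|\psi\|_{\widetilde A_{r,j}(\mathbb T)}=\sup_{\ell\in D_j}\big(\sum_{\mu\in\mathbb Z}|\widehat\psi(\ell+2^j\mu)|^r\big)^{1/r}$ for $1\le r<\infty$, and $\|\psi\|_{\widetilde A_{\infty,j}(\mathbb T)}=\sup_{k\in\mathbb Z}|\widehat\psi(k)|$ (defined through Fourier coefficients, possibly $+\infty$). Quasi-interpolation operators. For univariate $f$, $Q_j(f,\varphi_j,\widetilde\varphi_j)(x)=2^{-j}\sum_{k\in D_j}(f*\widetilde\varphi_j)(x_k^j)\,\varphi_j(x-x_k^j)$, $x_k^j=\pi k/2^{j-1}$, where $(f*\widetilde\varphi_j)(x)=\sum_{\nu\in\mathbb Z}\widehat f(\nu)\widehat{\widetilde\varphi_j}(\nu)e^{\mathrm i\nu x}$; equivalently $Q_j(f,\varphi_j,\widetilde\varphi_j)(x)=\sum_{\ell\in D_j}\widehat{\varphi_j}(\ell)\big(\sum_{\mu\in\mathbb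 Z}\widehat f(\ell+2^j\mu)\widehat{\widetilde\varphi_j}(\ell+2^j\mu)\big)e^{\mathrm i\ell x}$. For functions on $\mathbb T^d$, $Q_j^i$ is the operator $Q_j$ acting in the variable $x_i$, $Q_{-1}^i=0$, and $\eta_{\mathbf j}^Q=\prod_{i=1}^d(Q_{j_i}^i-Q_{j_i-1}^i)$ for $\mathbf j\in\mathbb Z_+^d$. Products are understood through Fourier coefficients: $\prod_iQ_{j_i}^if=\sum_{\boldsymbol\ell\in D_{j_1}\times\dots\times D_{j_d}}\prod_i\widehat{\varphi_{j_i}}(\ell_i)\big(\sum_{\boldsymbol\mu\in\mathbb Z^d}\widehat f(\ell_1+2^{j_1}\mu_1,\dots,\ell_d+2^{j_d}\mu_d)\prod_i\widehat{\widetilde\varphi_{j_i}}(\ell_i+2^{j_i}\mu_i)\big)e^{\mathrm i(\boldsymbol\ell,\mathbf x)}$. Sparse grid operator: $P_{n,T}^Q=\sum_{\mathbf j\in\Delta(n,T)}\eta_{\mathbf j}^Q$ with $\Delta(n,T)=\{\mathbf k\in\mathbb Z_+^d:|\mathbf k|_1-T|\mathbf k|_\infty\le(1-T)n\}$. *)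

theory Defs
  imports "HOL-Analysis.Analysis"
begin

text \<open>Exponents \<open>1 \<le> p \<le> \<infinity>\<close> are extended reals; \<open>1 / \<infinity> = 0\<close> holds in \<^typ>\<open>ereal\<close>.\<close>

definition conj_exp :: "ereal \<Rightarrow> ereal" where
  "conj_exp p = (if p = 1 then \<infinity> else if p = \<infinity> then 1 else p / (p - 1))"

definition sigma_pq :: "ereal \<Rightarrow> ereal \<Rightarrow> real" where
  "sigma_pq p q = max 0 (real_of_ereal (1 / q) - real_of_ereal (1 / p))"

text \<open>Intended for \<open>0 < r \<le> \<infinity>\<close> and nonnegative families.\<close>

definition lr_norm :: "ereal \<Rightarrow> ('k \<Rightarrow> real) \<Rightarrow> ennreal" where
  "lr_norm r a =
    (if r = \<infinity> then (SUP k. ennreal (a k))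
     else if (\<lambda>k. a k powr real_of_ereal r) summable_on UNIV
       then ennreal ((\<Sum>\<^sub>\<infinity>k. a k powr real_of_ereal r) powr (1 / real_of_ereal r))
     else \<infinity>)"

definition torus_cube :: "(real ^ 'd) set" where
  "torus_cube = cbox 0 (\<chi> i. 2 * pi)"

definition L1_torus :: "(real ^ 'd \<Rightarrow> complex) set" where
  "L1_torus = {f. (\<forall>x i. f (x + (2 * pi) *\<^sub>R axis i 1) = f x) \<and>
                  f absolutely_integrable_on torus_cube}"

definition real_vec :: "int ^ 'd \<Rightarrow> real ^ 'd" where
  "real_vec k = (\<chi> i. real_of_int (k $ i))"

definition fourier_coeff :: "(real ^ 'd \<Rightarrow> complex) \<Rightarrow> int ^ 'd \<Rightarrow> complex" where
  "fourier_coeff f k =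
     (LINT x:torus_cube|lebesgue. f x * cis (- (real_vec k \<bullet> x))) / (2 * pi) ^ CARD('d)"

definition hybrid_wiener_norm ::
    "ereal \<Rightarrow> real \<Rightarrow> real \<Rightarrow> (real ^ 'd \<Rightarrow> complex) \<Rightarrow> ennreal" where
  "hybrid_wiener_norm q \<alpha> \<beta> f =
     lr_norm q (\<lambda>k. (\<Prod>i\<in>UNIV. (1 + \<bar>real_of_int (k $ i)\<bar>) powr \<alpha>) *
                    (1 + norm (real_vec k)) powr \<beta> * cmod (fourier_coeff f k))"

definition hybrid_wiener_space ::
    "ereal \<Rightarrow> real \<Rightarrow> real \<Rightarrow> (real ^ 'd \<Rightarrow> complex) set" where
  "hybrid_wiener_space q \<alpha> \<beta> = {f \<in> L1_torus. hybrid_wiener_norm q \<alpha> \<beta> f < \<infinity>}"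

definition wiener_norm :: "ereal \<Rightarrow> real \<Rightarrow> (real ^ 'd \<Rightarrow> complex) \<Rightarrow> ennreal" where
  "wiener_norm q \<gamma> = hybrid_wiener_norm q 0 \<gamma>"

definition D :: "nat \<Rightarrow> int set" where
  "D j = {k. - (2 powi (int j - 1)) \<le> real_of_int k \<and> real_of_int k < 2 powi (int j - 1)}"

definition trig_poly :: "nat \<Rightarrow> (real \<Rightarrow> complex) set" where
  "trig_poly j = {\<psi>. \<exists>c :: int \<Rightarrow> complex. \<psi> = (\<lambda>x. \<Sum>k\<in>D j. c k * cis (real_of_int k * x))}"

definition fourier_coeff1 :: "(real \<Rightarrow> complex) \<Rightarrow> int \<Rightarrow> complex" where
  "fourier_coeff1 \<psi> k = (LINT x:{0..2 * pi}|lebesgue. \<psi> x * cis (- (real_of_int k * x))) / (2 * pi)"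

definition nth_vderiv :: "nat \<Rightarrow> (real \<Rightarrow> complex) \<Rightarrow> real \<Rightarrow> complex" where
  "nth_vderiv m = (\<lambda>g x. vector_derivative g (at x)) ^^ m"

definition test_functions :: "(real \<Rightarrow> complex) set" where
  "test_functions = {g. (\<forall>x. g (x + 2 * pi) = g x) \<and>
                        (\<forall>m x. nth_vderiv m g differentiable (at x))}"

text \<open>Continuity with respect to the Frechet topology of \<open>C\<^sup>\<infinity>(\<T>)\<close> is expressed by a
  bound by finitely many of its defining seminorms. Only the values on test functions matter.\<close>

definition periodic_distributions :: "((real \<Rightarrow> complex) \<Rightarrow> complex) set" where
  "periodic_distributions = {u.
     (\<forall>g\<in>test_functions. \<forall>h\<in>test_functions. \<forall>a b.
        u (\<lambda>x. a * g x + b * h x) = a * u g + b * u h) \<and>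
     (\<exists>C m. \<forall>g\<in>test_functions.
        cmod (u g) \<le> C * (\<Sum>i\<le>m. SUP x. cmod (nth_vderiv i g x)))}"

text \<open>An integrable function \<open>\<psi>\<close> is identified with the distribution
  \<open>g \<mapsto> \<integral> \<psi> g\<close> over one period, which explains the factor \<open>1 / (2\<pi>)\<close>.\<close>

definition dist_coeff :: "((real \<Rightarrow> complex) \<Rightarrow> complex) \<Rightarrow> int \<Rightarrow> complex" where
  "dist_coeff u k = u (\<lambda>x. cis (- (real_of_int k * x))) / (2 * pi)"

definition amalgam_norm :: "ereal \<Rightarrow> nat \<Rightarrow> ((real \<Rightarrow> complex) \<Rightarrow> complex) \<Rightarrow> ennreal" where
  "amalgam_norm r j u =
     (if r = \<infinity> then (SUP k. ennreal (cmod (dist_coeff u k)))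
      else (SUP l\<in>D j. lr_norm r (\<lambda>\<mu>. cmod (dist_coeff u (l + 2 ^ j * \<mu>)))))"

text \<open>\<open>quasi_prod \<phi> \<phi>t j\<close> is the product of the univariate operators
  \<open>Q\<close> of level \<open>j $ i\<close> acting in the \<open>i\<close>-th variable. A level may be \<open>-1\<close>, and then the
  operator is zero. The inner series over \<open>\<mu>\<close> is summed unconditionally, that is,
  absolutely.\<close>

definition quasi_prod ::
    "(nat \<Rightarrow> real \<Rightarrow> complex) \<Rightarrow> (nat \<Rightarrow> (real \<Rightarrow> complex) \<Rightarrow> complex) \<Rightarrow>
     int ^ 'd \<Rightarrow> (real ^ 'd \<Rightarrow> complex) \<Rightarrow> real ^ 'd \<Rightarrow> complex" where
  "quasi_prod \<phi> \<phi>t j f x =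
     (if \<exists>i. j $ i < 0 then 0
      else \<Sum>l\<in>{l. \<forall>i. l $ i \<in> D (nat (j $ i))}.
        (\<Prod>i\<in>UNIV. fourier_coeff1 (\<phi> (nat (j $ i))) (l $ i)) *
        (\<Sum>\<^sub>\<infinity>\<mu> :: int ^ 'd. fourier_coeff f (\<chi> i. l $ i + 2 ^ nat (j $ i) * \<mu> $ i) *
           (\<Prod>i\<in>UNIV. dist_coeff (\<phi>t (nat (j $ i))) (l $ i + 2 ^ nat (j $ i) * \<mu> $ i))) *
        cis (real_vec l \<bullet> x))"

text \<open>The product of the differences \<open>Q\<^sub>j - Q\<^sub>j\<^sub>-\<^sub>1\<close> over all variables, multiplied out; \<open>S\<close> is the
  set of variables in which the second term is chosen.\<close>

definition eta ::
    "(nat \<Rightarrow> real \<Rightarrow> complex) \<Rightarrow> (nat \<Rightarrow> (real \<Rightarrow> complex) \<Rightarrow> complex) \<Rightarrow>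
     nat ^ 'd \<Rightarrow> (real ^ 'd \<Rightarrow> complex) \<Rightarrow> real ^ 'd \<Rightarrow> complex" where
  "eta \<phi> \<phi>t j f x =
     (\<Sum>S\<in>Pow UNIV. (- 1) ^ card S *
        quasi_prod \<phi> \<phi>t (\<chi> i. int (j $ i) - (if i \<in> S then 1 else 0)) f x)"

definition Delta :: "nat \<Rightarrow> real \<Rightarrow> (nat ^ 'd) set" where
  "Delta n T = {k. real (\<Sum>i\<in>UNIV. k $ i) - T * real (Max (range (\<lambda>i. k $ i))) \<le> (1 - T) * real n}"

definition sparse_grid_op ::
    "(nat \<Rightarrow> real \<Rightarrow> complex) \<Rightarrow> (nat \<Rightarrow> (real \<Rightarrow> complex) \<Rightarrow> complex) \<Rightarrow>
     nat \<Rightarrow> real \<Rightarrow> (real ^ 'd \<Rightarrow> complex) \<Rightarrow> real ^ 'd \<Rightarrow> complex" where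
  "sparse_grid_op \<phi> \<phi>t n T f x = (\<Sum>j\<in>Delta n T. eta \<phi> \<phi>t j f x)"

definition Omega_rate ::
    "nat \<Rightarrow> ereal \<Rightarrow> ereal \<Rightarrow> real \<Rightarrow> real \<Rightarrow> real \<Rightarrow> real \<Rightarrow> nat \<Rightarrow> real" where
  "Omega_rate d p q \<alpha> \<beta> \<gamma> T n =
     (let \<sigma> = sigma_pq p q in
      if T \<ge> (\<gamma> - \<beta>) / (\<alpha> - \<sigma>) then
        2 powr (- (\<alpha> + \<beta> - \<gamma> - \<sigma>
                   - ((\<alpha> - \<sigma>) * T - (\<gamma> - \<beta>)) * ((real d - 1) / (real d - T))) * real n)
        * real n powr ((real d - 1) * (1 - real_of_ereal (1 / p)))
      else 2 powr (- (\<alpha> + \<beta> - \<gamma> - \<sigma>) * real n))"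

end

theory Submission
  imports Defs
begin

text \<open>On the Fourier side the difference operator of level \<open>j\<close> is a matrix whose \<open>(l, k)\<close> entry is a
  product of univariate entries. An off-diagonal univariate entry vanishes unless \<open>k\<close> is an alias of \<open>l\<close>,
  hence of size at least about \<open>2\<^sup>j\<close>, while a diagonal entry is of order \<open>(2\<^sup>-\<^sup>j\<bar>l\<bar>)\<^sup>s\<close>. Since the series over
  \<open>j\<close> of these matrices telescopes to the identity, the error is the sum of the differences over
  \<open>j\<close> outside the sparse grid.

  After division by the hybrid weight, the part of a row at distance \<open>m\<close> (in the dyadic scale) from level
  \<open>j\<close> still decays like \<open>2\<^sup>-\<^sup>\<epsilon>\<^sup>m\<close>. Hence the \<open>A\<^sub>q\<^sup>\<gamma>\<close> norm of the \<open>j\<close>-th difference is at most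
  \<open>2\<close> to the power \<open>-((\<alpha> - \<sigma>) \<bar>j\<bar>\<^sub>1 - (\<gamma> - \<beta>) \<bar>j\<bar>\<^sub>\<infinity>)\<close> times a localised norm \<open>M\<^sub>j\<close> of \<open>f\<close>, and the sequence
  \<open>M\<^sub>j\<close> is bounded in \<open>l\<^sub>p\<close> by the norm of \<open>f\<close>. Holder's inequality in \<open>j\<close> reduces the theorem to the
  \<open>l\<^sub>p\<^sub>'\<close> norm of the exponential factor outside the sparse grid.\<close>

section \<open>Bounds on sequence norms\<close>

text \<open>The passage from l_p to l_q may cost no more than
  \<open>2 powr (\<sigma> * vsum j)\<close>, and the two alternatives of the theorem force it to be
  made at different ends of the kernel. Under (i) the rows are controlled in the dual of l_p, so the
  estimate stays in l_p and the exponent drops on the output, which lives in a finite box of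
  frequencies. Under (ii) the rows are controlled only in the dual of l_q, so the exponent has to
  drop on the input; its frequencies are unbounded, and a little more than \<sigma> of the
  smoothness is spent on decay beyond the level.

  A second obstacle is the isotropic part of the weight, which does not factor over the coordinates.
  Comparing it with a single coordinate suffices, and this is why the minimum and the maximum of
  \<alpha> and \<alpha> + \<beta> govern every condition.

  The two regimes of the rate come from minimising a linear exponent outside the grid. If T is at
  least (\<gamma> - \<beta>) / (\<alpha> - \<sigma>), a minimum lies on the diagonal, whence the
  quotient (d - 1) / (d - T); otherwise the minimum lies on the coordinate axes.\<close>

text \<open>The parameter \<open>a\<close> is the reciprocal exponent \<open>1 / p\<close>: the norm of \<open>x\<close> in \<open>l\<^sub>p\<close> is at most \<open>M\<close>, with
  \<open>a = 0\<close> for the supremum norm. In this form Holder's inequality adds the parameters, and it covers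
  the embeddings on finite sets as well.\<close>

definition lp_le :: "real \<Rightarrow> ('k \<Rightarrow> real) \<Rightarrow> real \<Rightarrow> bool" where
  "lp_le a x M \<longleftrightarrow> 0 \<le> M \<and> (\<forall>k. 0 \<le> x k) \<and>
     (if a = 0 then \<forall>k. x k \<le> M
      else \<forall>F. finite F \<longrightarrow> (\<Sum>k\<in>F. x k powr (1 / a)) \<le> M powr (1 / a))"

lemma lp_le_nonneg: "lp_le a x M \<Longrightarrow> 0 \<le> x k"
  by (simp add: lp_le_def)

lemma lp_le_bound_nonneg: "lp_le a x M \<Longrightarrow> 0 \<le> M"
  by (simp add: lp_le_def)

lemma lp_le_sumD:
  "lp_le a x M \<Longrightarrow> a \<noteq> 0 \<Longrightarrow> finite F \<Longrightarrow> (\<Sum>k\<in>F. x k powr (1 / a)) \<le> M powr (1 / a)"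
  by (simp add: lp_le_def)

lemma lp_leI:
  assumes "0 \<le> M" "\<And>k. 0 \<le> x k" "a = 0 \<Longrightarrow> (\<And>k. x k \<le> M)"
    "\<And>F. a \<noteq> 0 \<Longrightarrow> finite F \<Longrightarrow> (\<Sum>k\<in>F. x k powr (1 / a)) \<le> M powr (1 / a)"
  shows "lp_le a x M"
  using assms by (simp add: lp_le_def)

lemma lp_le_0_iff: "lp_le 0 x M \<longleftrightarrow> 0 \<le> M \<and> (\<forall>k. 0 \<le> x k \<and> x k \<le> M)"
  by (auto simp: lp_le_def)

lemma lp_le_pointwise:
  assumes "lp_le a x M" "0 \<le> a"
  shows "x k \<le> M"
proof (cases "a = 0")
  case True
  then show ?thesis using assms by (simp add: lp_le_def)
next
  case False
  then have "x k powr (1 / a) \<le> M powr (1 / a)"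
    using lp_le_sumD[OF assms(1) False, of "{k}"] by simp
  then show ?thesis
    using False assms lp_le_nonneg[OF assms(1)] lp_le_bound_nonneg[OF assms(1)]
    by (meson divide_pos_pos less_eq_real_def not_le powr_less_mono2 zero_less_one)
qed

lemma lp_le_mono:
  assumes "lp_le a y M" "\<And>k. 0 \<le> x k" "\<And>k. x k \<le> y k" "M \<le> M'" "0 \<le> a"
  shows "lp_le a x M'"
proof (rule lp_leI)
  show "0 \<le> M'" using assms lp_le_bound_nonneg by fastforce
  show "x k \<le> M'" if "a = 0" for k
    using lp_le_pointwise[OF assms(1,5), of k] assms(3)[of k] assms(4) by simp
  show "(\<Sum>k\<in>F. x k powr (1 / a)) \<le> M' powr (1 / a)" if "a \<noteq> 0" "finite F" for F
  proof -
    have "(\<Sum>k\<in>F. x k powr (1 / a)) \<le> (\<Sum>k\<in>F. y k powr (1 / a))"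
      using assms by (intro sum_mono powr_mono2) auto
    also have "\<dots> \<le> M powr (1 / a)" using lp_le_sumD[OF assms(1) that] .
    also have "\<dots> \<le> M' powr (1 / a)"
      using assms lp_le_bound_nonneg[OF assms(1)] by (intro powr_mono2) auto
    finally show ?thesis .
  qed
qed (use assms in auto)

lemma lp_le_scale:
  assumes "lp_le a x M" "0 \<le> c"
  shows "lp_le a (\<lambda>k. c * x k) (c * M)"
proof (rule lp_leI)
  show "(\<Sum>k\<in>F. (c * x k) powr (1 / a)) \<le> (c * M) powr (1 / a)" if "a \<noteq> 0" "finite F" for F
    using lp_le_sumD[OF assms(1) that] assms lp_le_nonneg[OF assms(1)] lp_le_bound_nonneg[OF assms(1)]
    by (simp add: powr_mult mult_left_mono flip: sum_distrib_left)
qed (use assms lp_le_nonneg[OF assms(1)] lp_le_bound_nonneg[OF assms(1)] in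
      \<open>auto simp: lp_le_def intro: mult_left_mono\<close>)

lemma lp_le_unit:
  assumes "0 < a" "0 < M"
  shows "lp_le a x M \<longleftrightarrow> (\<forall>k. 0 \<le> x k) \<and> (\<forall>F. finite F \<longrightarrow> (\<Sum>k\<in>F. (x k / M) powr (1 / a)) \<le> 1)"
proof -
  have "(\<Sum>k\<in>F. (x k / M) powr (1 / a)) = (\<Sum>k\<in>F. x k powr (1 / a)) / M powr (1 / a)"
    if "\<forall>k. 0 \<le> x k" for F
    using assms that by (simp add: powr_divide sum_divide_distrib)
  moreover have "0 < M powr (1 / a)" using assms by simp
  ultimately show ?thesis
    using assms by (auto simp: lp_le_def pos_divide_le_eq)
qed

lemma lp_le_zero: "0 \<le> M \<Longrightarrow> lp_le a (\<lambda>k. 0) M"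
  by (simp add: lp_le_def)

text \<open>Weighted AM-GM for \<open>u powr (1 / a)\<close> and \<open>v powr (1 / b)\<close> with
  weights proportional to \<open>a\<close> and \<open>b\<close>. In this form no relation between
  \<open>a\<close> and \<open>b\<close> is required.\<close>

lemma Young_powr:
  fixes u v a b :: real
  assumes "0 < a" "0 < b" "0 \<le> u" "0 \<le> v"
  shows "(u * v) powr (1 / (a + b)) \<le> a / (a + b) * u powr (1 / a) + b / (a + b) * v powr (1 / b)"
proof (cases "u = 0 \<or> v = 0")
  case True
  then show ?thesis using assms by auto
next
  case False
  have "(u powr (1 / a)) powr (a / (a + b)) * (v powr (1 / b)) powr (b / (a + b))
      \<le> a / (a + b) * u powr (1 / a) + b / (a + b) * v powr (1 / b)"
    using assms False by (intro Youngs_inequality_0) (auto simp flip: add_divide_distrib)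
  then show ?thesis
    using assms False by (simp add: powr_powr powr_mult)
qed

text \<open>After division by \<open>M\<close> and \<open>K\<close> both power sums are at most 1,
  and the weights in Young's inequality add up to 1. Vanishing norms cannot be normalised and are
  split off. Taking an indicator or a decaying weight as one factor lowers the exponent of the
  other.\<close>

lemma lp_le_Holder:
  assumes x: "lp_le a x M" and y: "lp_le b y K" and "0 \<le> a" "0 \<le> b"
  shows "lp_le (a + b) (\<lambda>k. x k * y k) (M * K)"
proof -
  note nn = lp_le_nonneg[OF x] lp_le_nonneg[OF y] lp_le_bound_nonneg[OF x] lp_le_bound_nonneg[OF y]
  note pw = lp_le_pointwise[OF x \<open>0 \<le> a\<close>] lp_le_pointwise[OF y \<open>0 \<le> b\<close>]
  consider "a = 0" | "b = 0" | "M = 0 \<or> K = 0" | "0 < a" "0 < b" "0 < M" "0 < K"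
    using assms nn by fastforce
  then show ?thesis
  proof cases
    case 1
    then show ?thesis
      using lp_le_mono[OF lp_le_scale[OF y, of M], of "\<lambda>k. x k * y k" "M * K"] nn pw assms
      by (simp add: mult_right_mono)
  next
    case 2
    have "lp_le a (\<lambda>k. K * x k) (K * M)" using lp_le_scale[OF x] nn by simp
    then have "lp_le a (\<lambda>k. x k * y k) (M * K)"
      using nn pw assms by (elim lp_le_mono) (auto simp: mult.commute[of K] mult_left_mono)
    then show ?thesis using 2 by simp
  next
    case 3
    then have "x k * y k = 0" for k using pw[of k] nn(1,2)[of k] by auto
    then have "(\<lambda>k. x k * y k) = (\<lambda>k. 0)" by blast
    then show ?thesis using nn by (simp only: lp_le_zero mult_nonneg_nonneg)
  next
    case 4
    have "(\<Sum>k\<in>F. (x k * y k / (M * K)) powr (1 / (a + b))) \<le> 1" if F: "finite F" for F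
    proof -
      have "(\<Sum>k\<in>F. (x k * y k / (M * K)) powr (1 / (a + b)))
         = (\<Sum>k\<in>F. (x k / M * (y k / K)) powr (1 / (a + b)))" by simp
      also have "\<dots> \<le> (\<Sum>k\<in>F. a / (a + b) * (x k / M) powr (1 / a) + b / (a + b) * (y k / K) powr (1 / b))"
        using 4 nn by (intro sum_mono Young_powr) auto
      also have "\<dots> = a / (a + b) * (\<Sum>k\<in>F. (x k / M) powr (1 / a)) + b / (a + b) * (\<Sum>k\<in>F. (y k / K) powr (1 / b))"
        by (simp add: sum.distrib sum_distrib_left)
      also have "\<dots> \<le> a / (a + b) * 1 + b / (a + b) * 1"
        using 4 x y F by (intro add_mono mult_left_mono) (auto simp: lp_le_unit)
      also have "\<dots> = 1" using 4 by (simp flip: add_divide_distrib)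
      finally show ?thesis .
    qed
    then show ?thesis using 4 nn by (subst lp_le_unit) auto
  qed
qed

lemma powr_convex_combination:
  fixes u v t p :: real
  assumes "0 \<le> u" "0 \<le> v" "0 \<le> t" "t \<le> 1" "1 \<le> p"
  shows "((1 - t) * u + t * v) powr p \<le> (1 - t) * u powr p + t * v powr p"
proof -
  consider "u = 0" | "v = 0" | "0 < u" "0 < v" using assms by fastforce
  then show ?thesis
  proof cases
    case 1
    have "t powr p \<le> t" using assms powr_mono'[of 1 p t] by simp
    then show ?thesis using 1 assms by (simp add: powr_mult mult_right_mono)
  next
    case 2
    have "(1 - t) powr p \<le> 1 - t" using assms powr_mono'[of 1 p "1 - t"] by simp
    then show ?thesis using 2 assms by (simp add: powr_mult mult_right_mono)
  next
    case 3
    then show ?thesis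
      using convex_onD[OF powr_convex[OF assms(5)], of t u v] assms by simp
  qed
qed

text \<open>Minkowski's inequality by convexity: the normalised sum is the convex combination of
  \<open>x k / M\<close> and \<open>y k / K\<close> with weights \<open>M / (M + K)\<close> and
  \<open>K / (M + K)\<close>.\<close>

lemma lp_le_add:
  assumes x: "lp_le a x M" and y: "lp_le a y K" and a: "0 \<le> a" "a \<le> 1"
  shows "lp_le a (\<lambda>k. x k + y k) (M + K)"
proof -
  note nn = lp_le_nonneg[OF x] lp_le_nonneg[OF y] lp_le_bound_nonneg[OF x] lp_le_bound_nonneg[OF y]
  note pw = lp_le_pointwise[OF x \<open>0 \<le> a\<close>] lp_le_pointwise[OF y \<open>0 \<le> a\<close>]
  consider "a = 0" | "M = 0" | "K = 0" | "0 < a" "0 < M" "0 < K"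
    using assms nn by fastforce
  then show ?thesis
  proof cases
    case 1
    then show ?thesis using nn pw by (simp add: lp_le_0_iff add_mono)
  next
    case 2
    then have "x k = 0" for k using pw(1)[of k] nn(1)[of k] by simp
    then show ?thesis using y 2 by simp
  next
    case 3
    then have "y k = 0" for k using pw(2)[of k] nn(2)[of k] by simp
    then show ?thesis using x 3 by simp
  next
    case 4
    have "(\<Sum>k\<in>F. ((x k + y k) / (M + K)) powr (1 / a)) \<le> 1" if F: "finite F" for F
    proof -
      define t where "t = K / (M + K)"
      have t: "1 - t = M / (M + K)" "0 \<le> t" "t \<le> 1" using 4 by (auto simp: t_def field_simps)
      have "(x k + y k) / (M + K) = (1 - t) * (x k / M) + t * (y k / K)" for k
        using 4 by (simp only: t(1)) (simp add: t_def add_divide_distrib)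
      then have "(\<Sum>k\<in>F. ((x k + y k) / (M + K)) powr (1 / a))
         = (\<Sum>k\<in>F. ((1 - t) * (x k / M) + t * (y k / K)) powr (1 / a))" by simp
      also have "\<dots> \<le> (\<Sum>k\<in>F. (1 - t) * (x k / M) powr (1 / a) + t * (y k / K) powr (1 / a))"
        using 4 nn t a by (intro sum_mono powr_convex_combination) auto
      also have "\<dots> = (1 - t) * (\<Sum>k\<in>F. (x k / M) powr (1 / a)) + t * (\<Sum>k\<in>F. (y k / K) powr (1 / a))"
        by (simp add: sum.distrib sum_distrib_left)
      also have "\<dots> \<le> (1 - t) * 1 + t * 1"
        using 4 x y F t by (intro add_mono mult_left_mono) (auto simp: lp_le_unit)
      finally show ?thesis by simp
    qed
    then show ?thesis using 4 nn by (subst lp_le_unit) auto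
  qed
qed

lemma lp_le_sum:
  assumes "finite J" "\<And>j. j \<in> J \<Longrightarrow> lp_le a (x j) (M j)" "0 \<le> a" "a \<le> 1"
  shows "lp_le a (\<lambda>k. \<Sum>j\<in>J. x j k) (\<Sum>j\<in>J. M j)"
  using assms(1,2)
proof (induction J rule: finite_induct)
  case empty
  then show ?case by (simp add: lp_le_zero)
next
  case (insert j J)
  then show ?case using lp_le_add[of a "x j" "M j"] assms(3,4) by simp
qed

text \<open>Fatou's lemma in elementary form. Only finite partial sums are bounded, so the bound
  survives pointwise limits along any filter.\<close>

lemma lp_le_limit:
  assumes lim: "\<And>k. ((\<lambda>i. X i k) \<longlongrightarrow> x k) G" and "G \<noteq> bot"
    and X: "\<And>i. lp_le a (X i) M" and a: "0 \<le> a"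
  shows "lp_le a x M"
proof (rule lp_leI)
  show "0 \<le> M" using lp_le_bound_nonneg[OF X] .
  show x: "0 \<le> x k" for k
    using tendsto_lowerbound[OF lim _ \<open>G \<noteq> bot\<close>] lp_le_nonneg[OF X] by simp
  show "x k \<le> M" if "a = 0" for k
    using tendsto_upperbound[OF lim _ \<open>G \<noteq> bot\<close>] lp_le_pointwise[OF X a] by simp
  show "(\<Sum>k\<in>F. x k powr (1 / a)) \<le> M powr (1 / a)" if F: "a \<noteq> 0" "finite F" for F
  proof (rule tendsto_upperbound[OF _ _ \<open>G \<noteq> bot\<close>])
    show "((\<lambda>i. \<Sum>k\<in>F. X i k powr (1 / a)) \<longlongrightarrow> (\<Sum>k\<in>F. x k powr (1 / a))) G"
      using a F lp_le_nonneg[OF X]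
      by (intro tendsto_sum tendsto_powr2 lim) (auto intro!: eventuallyI)
    show "\<forall>\<^sub>F i in G. (\<Sum>k\<in>F. X i k powr (1 / a)) \<le> M powr (1 / a)"
      using lp_le_sumD[OF X F] by simp
  qed
qed

lemma lp_le_infsum:
  assumes X: "\<And>j. j \<in> J \<Longrightarrow> lp_le a (X j) (M j)" and a: "0 \<le> a" "a \<le> 1"
    and sm: "\<And>k. (\<lambda>j. X j k) summable_on J"
    and R: "\<And>F. finite F \<Longrightarrow> F \<subseteq> J \<Longrightarrow> (\<Sum>j\<in>F. M j) \<le> R"
  shows "lp_le a (\<lambda>k. infsum (\<lambda>j. X j k) J) R"
proof -
  have R0: "0 \<le> R" using R[of "{}"] by simp
  \<comment> \<open>The value 0 on inadmissible index sets makes the bound hold for every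
    \<open>F\<close>, while the limit only sees admissible ones.\<close>
  define Y where "Y F k = (if finite F \<and> F \<subseteq> J then \<Sum>j\<in>F. X j k else 0)" for F k
  have "lp_le a (Y F) R" for F
  proof (cases "finite F \<and> F \<subseteq> J")
    case True
    then have "lp_le a (\<lambda>k. \<Sum>j\<in>F. X j k) (\<Sum>j\<in>F. M j)"
      using X a by (intro lp_le_sum) auto
    then have "lp_le a (\<lambda>k. \<Sum>j\<in>F. X j k) R"
      using R True a by (elim lp_le_mono) (auto intro!: sum_nonneg lp_le_nonneg[OF X])
    moreover have "Y F = (\<lambda>k. \<Sum>j\<in>F. X j k)" using True by (auto simp: Y_def)
    ultimately show ?thesis by simp
  next
    case False
    then have "Y F k = 0" for k unfolding Y_def by (rule if_not_P)
    then have "Y F = (\<lambda>k. 0)" by blast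
    then show ?thesis using R0 lp_le_zero[of R] by simp
  qed
  moreover have "((\<lambda>F. Y F k) \<longlongrightarrow> infsum (\<lambda>j. X j k) J) (finite_subsets_at_top J)" for k
  proof (rule Lim_transform_eventually[OF infsum_tendsto[OF sm[of k]]])
    show "\<forall>\<^sub>F F in finite_subsets_at_top J. (\<Sum>j\<in>F. X j k) = Y F k"
      by (rule eventually_finite_subsets_at_top_weakI) (simp add: Y_def)
  qed
  ultimately show ?thesis
    using a by (auto intro: lp_le_limit[of Y _ "finite_subsets_at_top J" a R])
qed

text \<open>A smaller parameter is a larger exponent. Normalised entries are at most 1, so raising
  the exponent decreases their powers.\<close>

lemma lp_le_embed:
  assumes x: "lp_le b x M" and "0 \<le> a" "a \<le> b"
  shows "lp_le a x M"
proof -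
  note nn = lp_le_nonneg[OF x] lp_le_bound_nonneg[OF x]
  have pw: "x k \<le> M" for k using lp_le_pointwise[OF x] assms by simp
  consider "a = 0" | "M = 0" | "0 < a" "0 < M" using assms nn by fastforce
  then show ?thesis
  proof cases
    case 1
    then show ?thesis using nn pw by (simp add: lp_le_0_iff)
  next
    case 2
    then have "x k = 0" for k using pw[of k] nn(1)[of k] by simp
    then show ?thesis using 2 by (simp add: lp_le_def)
  next
    case 3
    have "(\<Sum>k\<in>F. (x k / M) powr (1 / a)) \<le> 1" if F: "finite F" for F
    proof -
      have "(\<Sum>k\<in>F. (x k / M) powr (1 / a)) \<le> (\<Sum>k\<in>F. (x k / M) powr (1 / b))"
        using 3 nn pw assms by (intro sum_mono powr_mono') (auto simp: field_simps)
      also have "\<dots> \<le> 1" using x 3 assms F by (simp add: lp_le_unit)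
      finally show ?thesis .
    qed
    then show ?thesis using 3 nn by (subst lp_le_unit) auto
  qed
qed

text \<open>Repeating each entry at most \<open>L\<close> times multiplies the power sum by
  \<open>L\<close>, hence the norm by \<open>L powr a\<close>. Filling up with 0 outside
  \<open>A\<close> admits substitutions that are controlled only on a subset.\<close>

lemma lp_le_reindex:
  assumes x: "lp_le a x M" and "0 \<le> a" "1 \<le> L"
    and fib: "\<And>F m. finite F \<Longrightarrow> F \<subseteq> A \<Longrightarrow> real (card {k\<in>F. \<tau> k = m}) \<le> L"
  shows "lp_le a (\<lambda>k. if k \<in> A then x (\<tau> k) else 0) (L powr a * M)"
proof -
  note nn = lp_le_nonneg[OF x] lp_le_bound_nonneg[OF x]
  note pw = lp_le_pointwise[OF x \<open>0 \<le> a\<close>]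
  show ?thesis
  proof (rule lp_leI)
    fix F :: "'b set" assume F: "a \<noteq> 0" "finite F"
    define F' where "F' = F \<inter> A"
    have F': "finite F'" "F' \<subseteq> A" using F by (auto simp: F'_def)
    have "(\<Sum>k\<in>F. (if k \<in> A then x (\<tau> k) else 0) powr (1 / a)) = (\<Sum>k\<in>F'. x (\<tau> k) powr (1 / a))"
      unfolding F'_def using F by (intro sum.mono_neutral_cong_right) auto
    also have "\<dots> = (\<Sum>m\<in>\<tau> ` F'. \<Sum>k | k \<in> F' \<and> \<tau> k = m. x (\<tau> k) powr (1 / a))"
      by (rule sum.image_gen[OF F'(1)])
    also have "\<dots> = (\<Sum>m\<in>\<tau> ` F'. real (card {k\<in>F'. \<tau> k = m}) * x m powr (1 / a))"
      by (intro sum.cong refl) simp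
    also have "\<dots> \<le> (\<Sum>m\<in>\<tau> ` F'. L * x m powr (1 / a))"
      by (intro sum_mono mult_right_mono fib F') auto
    also have "\<dots> \<le> L * M powr (1 / a)"
      using lp_le_sumD[OF x F(1), of "\<tau> ` F'"] F' assms by (simp add: mult_left_mono flip: sum_distrib_left)
    also have "\<dots> = (L powr a * M) powr (1 / a)"
      using assms nn F by (simp add: powr_mult powr_powr)
    finally show "(\<Sum>k\<in>F. (if k \<in> A then x (\<tau> k) else 0) powr (1 / a)) \<le> (L powr a * M) powr (1 / a)" .
  qed (use nn pw assms in auto)
qed

lemma lp_le_reindex_inj:
  assumes "lp_le a x M" "0 \<le> a" "inj_on \<tau> A"
  shows "lp_le a (\<lambda>k. if k \<in> A then x (\<tau> k) else 0) M"
proof -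
  have "real (card {k\<in>F. \<tau> k = m}) \<le> 1" if "finite F" "F \<subseteq> A" for F m
  proof -
    have "card {k\<in>F. \<tau> k = m} \<le> Suc 0"
      using that assms(3) by (subst card_le_Suc0_iff_eq) (auto dest: inj_onD)
    then show ?thesis by simp
  qed
  from lp_le_reindex[OF assms(1,2) _ this] show ?thesis by simp
qed

section \<open>Families indexed by vectors: factorisation over the coordinates\<close>

lemma bij_betw_vec_PiE:
  "bij_betw (\<lambda>v i. v $ i) {v :: 'a ^ 'd. \<forall>i. v $ i \<in> B i} (PiE UNIV B)"
  by (rule bij_betwI[where g = "\<lambda>g. \<chi> i. g i"]) (auto simp: vec_eq_iff)

lemma sum_vec_prod:
  fixes f :: "'d::finite \<Rightarrow> 'a \<Rightarrow> 'c::comm_semiring_1"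
  assumes "\<And>i. finite (B i)"
  shows "(\<Sum>v\<in>{v :: 'a ^ 'd. \<forall>i. v $ i \<in> B i}. \<Prod>i\<in>UNIV. f i (v $ i)) = (\<Prod>i\<in>UNIV. \<Sum>y\<in>B i. f i y)"
proof -
  have "(\<Sum>v\<in>{v :: 'a ^ 'd. \<forall>i. v $ i \<in> B i}. \<Prod>i\<in>UNIV. f i (v $ i)) = (\<Sum>g\<in>PiE UNIV B. \<Prod>i\<in>UNIV. f i (g i))"
    by (rule sum.reindex_bij_betw[OF bij_betw_vec_PiE, where g = "\<lambda>g. \<Prod>i\<in>UNIV. f i (g i)"])
  also have "\<dots> = (\<Prod>i\<in>UNIV. \<Sum>y\<in>B i. f i y)" using assms by (simp add: prod_sum_PiE)
  finally show ?thesis .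
qed

lemma finite_vec_box: 
  assumes "\<And>i. finite (B i)" shows "finite {v :: 'a ^ 'd::finite. \<forall>i. v $ i \<in> B i}"
  using bij_betw_finite[OF bij_betw_vec_PiE[of B]] assms by (simp add: finite_PiE)

text \<open>A finite set is enlarged to the box of its coordinate projections, over which the sum of
  products factors.\<close>

lemma lp_le_vec_prod:
  fixes f :: "'d::finite \<Rightarrow> 'a \<Rightarrow> real"
  assumes f: "\<And>i. lp_le a (f i) (R i)" and "0 \<le> a"
  shows "lp_le a (\<lambda>k :: 'a ^ 'd. \<Prod>i\<in>UNIV. f i (k $ i)) (\<Prod>i\<in>UNIV. R i)"
proof -
  note nn = lp_le_nonneg[OF f] lp_le_bound_nonneg[OF f]
  note pw = lp_le_pointwise[OF f \<open>0 \<le> a\<close>]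
  show ?thesis
  proof (rule lp_leI)
    fix F :: "('a ^ 'd) set" assume F: "a \<noteq> 0" "finite F"
    define B where "B i = (\<lambda>v. v $ i) ` F" for i
    have B: "finite (B i)" for i using F by (simp add: B_def)
    have "(\<Sum>k\<in>F. (\<Prod>i\<in>UNIV. f i (k $ i)) powr (1 / a)) \<le>
       (\<Sum>k\<in>{v. \<forall>i. v $ i \<in> B i}. (\<Prod>i\<in>UNIV. f i (k $ i)) powr (1 / a))"
      by (intro sum_mono2 finite_vec_box B) (auto simp: B_def)
    also have "\<dots> = (\<Sum>k\<in>{v. \<forall>i. v $ i \<in> B i}. \<Prod>i\<in>UNIV. f i (k $ i) powr (1 / a))"
      using nn by (simp add: prod_powr_distrib)
    also have "\<dots> = (\<Prod>i\<in>UNIV. \<Sum>y\<in>B i. f i y powr (1 / a))"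
      by (rule sum_vec_prod[OF B])
    also have "\<dots> \<le> (\<Prod>i\<in>UNIV. R i powr (1 / a))"
      by (intro prod_mono conjI sum_nonneg lp_le_sumD[OF f F(1)] B) auto
    also have "\<dots> = (\<Prod>i\<in>UNIV. R i) powr (1 / a)" using nn by (simp add: prod_powr_distrib)
    finally show "(\<Sum>k\<in>F. (\<Prod>i\<in>UNIV. f i (k $ i)) powr (1 / a)) \<le> (\<Prod>i\<in>UNIV. R i) powr (1 / a)" .
  qed (use nn pw in \<open>auto intro!: prod_nonneg prod_mono\<close>)
qed

section \<open>Summable families, indicators and kernel operators\<close>

lemma lp_le_1_iff: "lp_le 1 x M \<longleftrightarrow> (\<forall>k. 0 \<le> x k) \<and> x summable_on UNIV \<and> infsum x UNIV \<le> M"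
proof (intro iffI conjI)
  assume x: "lp_le 1 x M"
  note nn = lp_le_nonneg[OF x] lp_le_bound_nonneg[OF x]
  have F: "(\<Sum>k\<in>F. x k) \<le> M" if "finite F" for F
    using lp_le_sumD[OF x _ that] nn by simp
  show "\<forall>k. 0 \<le> x k" using nn by simp
  show "x summable_on UNIV"
    using nn F by (intro nonneg_bdd_above_summable_on) (auto intro!: bdd_aboveI)
  then show "infsum x UNIV \<le> M" using F by (intro infsum_le_finite_sums) auto
next
  assume x: "(\<forall>k. 0 \<le> x k) \<and> x summable_on UNIV \<and> infsum x UNIV \<le> M"
  then have "0 \<le> M" using infsum_nonneg[of UNIV x] by auto
  moreover have "(\<Sum>k\<in>F. x k) \<le> M" if "finite F" for F
    using x finite_sum_le_infsum[of x UNIV F] that by fastforce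
  ultimately show "lp_le 1 x M" using x by (simp add: lp_le_def)
qed

lemma lp_le_single:
  assumes "0 \<le> c" "0 \<le> a" shows "lp_le a (\<lambda>k. if k = m then c else 0) c"
proof (rule lp_leI)
  fix F :: "'a set" assume "a \<noteq> 0" "finite F"
  have "(\<Sum>k\<in>F. (if k = m then c else 0) powr (1 / a)) = (\<Sum>k\<in>F. if k = m then c powr (1 / a) else 0)"
    by (intro sum.cong) auto
  also have "\<dots> \<le> c powr (1 / a)" using \<open>finite F\<close> by (simp add: sum.delta)
  finally show "(\<Sum>k\<in>F. (if k = m then c else 0) powr (1 / a)) \<le> c powr (1 / a)" .
qed (use assms in auto)

lemma lp_le_indicator:
  assumes "finite A" "real (card A) \<le> L" "0 \<le> a" "1 \<le> L"
  shows "lp_le a (\<lambda>k. if k \<in> A then 1 else 0) (L powr a)"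
proof (rule lp_leI)
  fix F :: "'a set" assume F: "a \<noteq> 0" "finite F"
  have "(\<Sum>k\<in>F. (if k \<in> A then 1 else 0 :: real) powr (1 / a)) = (\<Sum>k\<in>F \<inter> A. 1)"
    using F by (intro sum.mono_neutral_cong_right) auto
  also have "\<dots> \<le> real (card A)" using assms by (simp add: card_mono)
  also have "\<dots> \<le> (L powr a) powr (1 / a)" using assms F by (simp add: powr_powr)
  finally show "(\<Sum>k\<in>F. (if k \<in> A then 1 else 0 :: real) powr (1 / a)) \<le> (L powr a) powr (1 / a)" .
qed (use assms in \<open>auto intro: ge_one_powr_ge_zero\<close>)

text \<open>Holder's inequality along each row; since a column meets at most \<open>L\<close> rows, every \<open>x k\<close> is
  counted at most \<open>L\<close> times.\<close>

lemma lp_le_kernel: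
  assumes rows: "\<And>l. lp_le (1 - a) (G l) R"
    and cols: "\<And>k. lp_le 1 (\<lambda>l. if G l k \<noteq> 0 then 1 else 0) L"
    and x: "lp_le a x M" and a: "0 \<le> a" "a \<le> 1" and R: "0 \<le> R" and L: "1 \<le> L"
  shows "(\<lambda>k. G l k * x k) summable_on UNIV"
    and "lp_le a (\<lambda>l. \<Sum>\<^sub>\<infinity>k. G l k * x k) (R * L powr a * M)"
proof -
  note nn = lp_le_nonneg[OF rows] lp_le_nonneg[OF x] lp_le_bound_nonneg[OF x]
  have one: "lp_le 1 (\<lambda>k. G l k * x k) (R * M)" for l
    using lp_le_Holder[OF rows x, of l] a by simp
  then show sm: "(\<lambda>k. G l k * x k) summable_on UNIV" for l by (simp add: lp_le_1_iff)
  show "lp_le a (\<lambda>l. \<Sum>\<^sub>\<infinity>k. G l k * x k) (R * L powr a * M)"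
  proof (cases "a = 0")
    case True
    then show ?thesis using one nn R L by (auto simp: lp_le_1_iff lp_le_0_iff intro!: infsum_nonneg)
  next
    case False
    define Y where "Y E l = (if finite E then \<Sum>k\<in>E. G l k * x k else 0)" for E l
    have "lp_le a (Y E) (R * L powr a * M)" for E
    proof (cases "finite E")
      case E: True
      show ?thesis
      proof (rule lp_leI)
        fix F :: "'a set" assume F: "a \<noteq> 0" "finite F"
        have row: "(\<Sum>k\<in>E. G l k * x k) powr (1 / a)
             \<le> R powr (1 / a) * (\<Sum>k\<in>E. if G l k \<noteq> 0 then x k powr (1 / a) else 0)" for l
        proof -
          \<comment> \<open>Restricting \<open>x\<close> to the support of the row keeps only these
            entries in Holder's bound. Otherwise the full norm of \<open>x\<close> would be counted
            once per row and the column bound could not be used.\<close>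
          define z where "z k = (if k \<in> E \<and> G l k \<noteq> 0 then x k else 0)" for k
          define S where "S = (\<Sum>k\<in>E. z k powr (1 / a))"
          have S0: "0 \<le> S" by (simp add: S_def sum_nonneg)
          have "lp_le a z (S powr a)"
          proof (rule lp_leI)
            fix F' :: "'b set" assume F': "finite F'"
            have "(\<Sum>k\<in>F'. z k powr (1 / a)) = (\<Sum>k\<in>F' \<inter> E. z k powr (1 / a))"
              using F' by (intro sum.mono_neutral_right) (auto simp: z_def)
            also have "\<dots> \<le> S" unfolding S_def using E by (intro sum_mono2) auto
            also have "\<dots> = (S powr a) powr (1 / a)" using S0 F by (simp add: powr_powr)
            finally show "(\<Sum>k\<in>F'. z k powr (1 / a)) \<le> (S powr a) powr (1 / a)" .
          qed (use F nn in \<open>auto simp: z_def\<close>)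
          from lp_le_Holder[OF rows this, of l] a have "lp_le 1 (\<lambda>k. G l k * z k) (R * S powr a)"
            by simp
          from lp_le_sumD[OF this _ E] have "(\<Sum>k\<in>E. \<bar>G l k * z k\<bar>) \<le> R * S powr a"
            using R by simp
          moreover have "(\<Sum>k\<in>E. \<bar>G l k * z k\<bar>) = (\<Sum>k\<in>E. G l k * x k)"
            using nn by (intro sum.cong) (auto simp: z_def)
          ultimately have "(\<Sum>k\<in>E. G l k * x k) powr (1 / a) \<le> (R * S powr a) powr (1 / a)"
            using nn a by (intro powr_mono2 sum_nonneg) auto
          also have "\<dots> = R powr (1 / a) * S" using R S0 F by (simp add: powr_mult powr_powr)
          also have "S = (\<Sum>k\<in>E. if G l k \<noteq> 0 then x k powr (1 / a) else 0)"
            unfolding S_def z_def by (intro sum.cong) auto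
          finally show ?thesis .
        qed
        have "(\<Sum>l\<in>F. Y E l powr (1 / a)) \<le>
            (\<Sum>l\<in>F. R powr (1 / a) * (\<Sum>k\<in>E. if G l k \<noteq> 0 then x k powr (1 / a) else 0))"
          using E by (simp only: Y_def if_True) (intro sum_mono row)
        also have "\<dots> = R powr (1 / a) * (\<Sum>k\<in>E. \<Sum>l\<in>F. if G l k \<noteq> 0 then x k powr (1 / a) else 0)"
          by (simp add: sum_distrib_left sum.swap[of _ E F])
        also have "\<dots> = R powr (1 / a) * (\<Sum>k\<in>E. (\<Sum>l\<in>F. (if G l k \<noteq> 0 then 1 else 0)) * x k powr (1 / a))"
          unfolding sum_distrib_right by (intro arg_cong2[where f = "(*)"] refl sum.cong) auto
        also have "\<dots> \<le> R powr (1 / a) * (\<Sum>k\<in>E. L * x k powr (1 / a))"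
        proof (intro mult_left_mono sum_mono mult_right_mono)
          fix k
          have "(\<Sum>l\<in>F. (if G l k \<noteq> 0 then 1 else 0 :: real)) = (\<Sum>l\<in>F. (if G l k \<noteq> 0 then 1 else 0 :: real) powr (1 / 1))"
            by (intro sum.cong) auto
          also have "\<dots> \<le> L powr (1 / 1)" by (rule lp_le_sumD[OF cols]) (use F in auto)
          finally show "(\<Sum>l\<in>F. (if G l k \<noteq> 0 then 1 else 0 :: real)) \<le> L" using L by simp
        qed auto
        also have "\<dots> \<le> R powr (1 / a) * (L * M powr (1 / a))"
          using lp_le_sumD[OF x F(1) E] L by (simp add: mult_left_mono flip: sum_distrib_left)
        also have "\<dots> = (R * L powr a * M) powr (1 / a)"
          using R L nn F by (simp add: powr_mult powr_powr)
        finally show "(\<Sum>l\<in>F. Y E l powr (1 / a)) \<le> (R * L powr a * M) powr (1 / a)" .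
      qed (use False nn R L in \<open>auto simp: Y_def intro!: sum_nonneg\<close>)
    next
      case False
      then have "Y E = (\<lambda>l. 0)" by (auto simp: Y_def)
      then show ?thesis using R L nn lp_le_zero[of "R * L powr a * M"] by simp
    qed
    moreover have "((\<lambda>E. Y E l) \<longlongrightarrow> (\<Sum>\<^sub>\<infinity>k. G l k * x k)) (finite_subsets_at_top UNIV)" for l
    proof (rule Lim_transform_eventually[OF infsum_tendsto[OF sm[of l]]])
      show "\<forall>\<^sub>F E in finite_subsets_at_top UNIV. (\<Sum>k\<in>E. G l k * x k) = Y E l"
        by (rule eventually_finite_subsets_at_top_weakI) (simp add: Y_def)
    qed
    ultimately show ?thesis
      using a by (auto intro: lp_le_limit[of Y _ "finite_subsets_at_top UNIV" a])
  qed
qed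

section \<open>Power and geometric sequences\<close>

lemma lp_le_nat_power_decay:
  assumes "0 \<le> c" "c < e"
  shows "\<exists>C>0. lp_le c (\<lambda>n::nat. (1 + real n) powr - e) C"
proof (cases "c = 0")
  case True
  have "(1 + real n) powr - e \<le> 1" for n
    using powr_mono2'[of "- e" 1 "1 + real n"] assms by simp
  then show ?thesis using True by (intro exI[of _ 1]) (simp add: lp_le_0_iff)
next
  case False
  have "summable (\<lambda>n. real n powr - (e / c))"
    using assms False by (simp add: summable_real_powr_iff)
  then have sm: "summable (\<lambda>n. real (Suc n) powr - (e / c))"
    by (subst summable_Suc_iff)
  define S where "S = (\<Sum>n. real (Suc n) powr - (e / c))"
  have S: "0 < S" unfolding S_def using sm by (intro suminf_pos) auto
  have "(\<Sum>n\<in>F. ((1 + real n) powr - e) powr (1 / c)) \<le> (S powr c) powr (1 / c)" if "finite F" for F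
    using sum_le_suminf[OF sm that] S False by (simp add: powr_powr S_def add.commute)
  then have "lp_le c (\<lambda>n::nat. (1 + real n) powr - e) (S powr c)"
    using False by (intro lp_leI) auto
  then show ?thesis using S by (intro exI[of _ "S powr c"]) auto
qed

lemma lp_le_int_power_decay:
  assumes "0 \<le> c" "c < e"
  shows "\<exists>C>0. lp_le c (\<lambda>m::int. (1 + \<bar>real_of_int m\<bar>) powr - e) C"
proof -
  obtain C where C: "C > 0" "lp_le c (\<lambda>n::nat. (1 + real n) powr - e) C"
    using lp_le_nat_power_decay[OF assms] by blast
  have fib: "real (card {k\<in>F. nat \<bar>k\<bar> = m}) \<le> 2" if "finite F" for F :: "int set" and m
  proof -
    have "card {k\<in>F. nat \<bar>k\<bar> = m} \<le> card {int m, - int m}"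
      by (intro card_mono) auto
    also have "\<dots> \<le> 2" by (simp add: card_insert_if)
    finally show ?thesis by simp
  qed
  have "lp_le c (\<lambda>m::int. if m \<in> UNIV then (1 + real (nat \<bar>m\<bar>)) powr - e else 0) (2 powr c * C)"
    by (rule lp_le_reindex[OF C(2) assms(1) _ fib]) auto
  then have "lp_le c (\<lambda>m::int. (1 + \<bar>real_of_int m\<bar>) powr - e) (2 powr c * C)"
    by simp
  then show ?thesis using C by (intro exI[of _ "2 powr c * C"]) auto
qed

lemma lp_le_geometric:
  assumes "0 \<le> c" "0 < e"
  shows "\<exists>C>0. lp_le c (\<lambda>h::nat. 2 powr (- e * real h)) C"
proof (cases "c = 0")
  case True
  have "2 powr (- e * real h) \<le> 1" for h
    using powr_mono[of "- e * real h" 0 2] assms by simp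
  then show ?thesis using True by (intro exI[of _ 1]) (simp add: lp_le_0_iff)
next
  case False
  define q where "q = 2 powr (- e / c)"
  have q: "0 < q" "q < 1" using assms False by (auto simp: q_def powr_less_one field_simps)
  define S where "S = 1 / (1 - q)"
  have S: "S > 0" using q by (simp add: S_def)
  have "(\<Sum>h\<in>F. (2 powr (- e * real h)) powr (1 / c)) \<le> (S powr c) powr (1 / c)" if F: "finite F" for F
  proof -
    have "(\<Sum>h\<in>F. (2 powr (- e * real h)) powr (1 / c)) = (\<Sum>h\<in>F. q ^ h)"
      by (intro sum.cong refl) (simp add: q_def powr_powr powr_realpow[symmetric])
    also have "\<dots> \<le> (\<Sum>h. q ^ h)"
      using q F by (intro sum_le_suminf summable_geometric) auto
    also have "\<dots> = S" using q by (simp add: S_def suminf_geometric)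
    finally show ?thesis using S False by (simp add: powr_powr)
  qed
  then have "lp_le c (\<lambda>h::nat. 2 powr (- e * real h)) (S powr c)"
    using False by (intro lp_leI) auto
  then show ?thesis using S by (intro exI[of _ "S powr c"]) auto
qed

text \<open>There is a plateau of at most \<open>M + 1\<close> ones followed by a geometric tail.
  The plateau gives the factor \<open>(M + 1) powr c\<close>, which is the origin of the power of n
  in the rate.\<close>

lemma lp_le_geometric_beyond:
  assumes "0 \<le> c" "c \<le> 1" "0 < e"
  shows "\<exists>C>0. \<forall>M\<ge>0. lp_le c (\<lambda>u::nat. 2 powr (- e * max 0 (real u - M))) (C * (M + 1) powr c)"
proof -
  obtain C where C: "C > 0" "lp_le c (\<lambda>h::nat. 2 powr (- e * real h)) C"
    using lp_le_geometric[OF assms(1,3)] by blast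
  have "lp_le c (\<lambda>u::nat. 2 powr (- e * max 0 (real u - M))) ((1 + C) * (M + 1) powr c)" if M: "0 \<le> M" for M
  proof -
    define m where "m = nat \<lceil>M\<rceil>"
    have m: "M \<le> real m" unfolding m_def by linarith
    define A where "A = {u::nat. M < real u}"
    have mA: "m \<le> u" if "u \<in> A" for u using that unfolding A_def m_def by simp
    have inj: "inj_on (\<lambda>u. u - m) A"
      by (rule inj_onI) (metis mA eq_diff_iff)
    have cardM: "real (card {u. real u \<le> M}) \<le> M + 1"
    proof -
      have "{u. real u \<le> M} \<subseteq> {..nat \<lfloor>M\<rfloor>}" by (auto simp: le_nat_floor)
      then have "card {u. real u \<le> M} \<le> Suc (nat \<lfloor>M\<rfloor>)"
        using card_mono[of "{..nat \<lfloor>M\<rfloor>}"] by fastforce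
      then show ?thesis using M by linarith
    qed
    have fin: "finite {u::nat. real u \<le> M}"
      by (rule finite_subset[of _ "{..nat \<lfloor>M\<rfloor>}"]) (auto simp: le_nat_floor)
    have 1: "lp_le c (\<lambda>u::nat. if u \<in> {u. real u \<le> M} then 1 else 0) ((M + 1) powr c)"
      using lp_le_indicator[OF fin cardM] assms M by simp
    have 2: "lp_le c (\<lambda>u. if u \<in> A then 2 powr (- e * real (u - m)) else 0) C"
      by (rule lp_le_reindex_inj[OF C(2)]) (use assms inj in auto)
    have le: "(M + 1) powr c + C \<le> (1 + C) * (M + 1) powr c"
      using ge_one_powr_ge_zero[of "M + 1" c] M assms C by (simp add: algebra_simps)
    show ?thesis
    proof (rule lp_le_mono[OF lp_le_add[OF 1 2 assms(1,2)] _ _ le assms(1)])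
      fix u :: nat
      show "2 powr (- e * max 0 (real u - M)) \<le>
        (if u \<in> {u. real u \<le> M} then 1 else 0) + (if u \<in> A then 2 powr (- e * real (u - m)) else 0)"
      proof (cases "u \<in> A")
        case True
        then have "e * (real u - real m) \<le> e * (real u - M)" using m assms by (intro mult_left_mono) auto
        then show ?thesis using True mA[OF True] by (auto simp: A_def of_nat_diff)
      next
        case False
        then show ?thesis using assms by (auto simp: A_def max_def)
      qed
    qed simp
  qed
  then show ?thesis using C by (intro exI[of _ "1 + C"]) auto
qed

text \<open>The point is uniformity in the real centre \<open>L\<close>, later a logarithm of a
  frequency. Splitting at the floor of \<open>L\<close> gives one geometric majorant on each side,
  without loss from the fractional part.\<close>

lemma lp_le_two_sided_geometric:
  assumes "0 \<le> c" "c \<le> 1" "0 < e"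
  shows "\<exists>C>0. \<forall>L\<ge>0. lp_le c (\<lambda>j::nat. 2 powr (- e * \<bar>real j - L\<bar>)) C"
proof -
  obtain C where C: "C > 0" "lp_le c (\<lambda>h::nat. 2 powr (- e * real h)) C"
    using lp_le_geometric[OF assms(1,3)] by blast
  have "lp_le c (\<lambda>j::nat. 2 powr (- e * \<bar>real j - L\<bar>)) (C + C)" if L: "0 \<le> L" for L
  proof -
    define m where "m = nat \<lfloor>L\<rfloor>"
    have m: "real m \<le> L" "L < real m + 1" using L unfolding m_def by linarith+
    have 1: "lp_le c (\<lambda>j. if j \<in> {..m} then 2 powr (- e * real (m - j)) else 0) C"
      by (rule lp_le_reindex_inj[OF C(2)]) (use assms in \<open>auto simp: inj_on_def\<close>)
    have 2: "lp_le c (\<lambda>j. if j \<in> {m<..} then 2 powr (- e * real (j - Suc m)) else 0) C"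
      by (rule lp_le_reindex_inj[OF C(2)]) (use assms in \<open>auto simp: inj_on_def\<close>)
    show ?thesis
    proof (rule lp_le_mono[OF lp_le_add[OF 1 2 assms(1,2)] _ _ order_refl assms(1)])
      fix j :: nat
      show "2 powr (- e * \<bar>real j - L\<bar>) \<le>
        (if j \<in> {..m} then 2 powr (- e * real (m - j)) else 0) +
        (if j \<in> {m<..} then 2 powr (- e * real (j - Suc m)) else 0)"
      proof (cases "j \<le> m")
        case True
        then have "e * (real m - real j) \<le> e * \<bar>real j - L\<bar>" using m assms by (intro mult_left_mono) auto
        then show ?thesis using True by (auto simp: of_nat_diff)
      next
        case False
        then have "e * (real j - real (Suc m)) \<le> e * \<bar>real j - L\<bar>" using m assms by (intro mult_left_mono) auto
        then show ?thesis using False by (auto simp: of_nat_diff)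
      qed
    qed simp
  qed
  then show ?thesis using C by (intro exI[of _ "C + C"]) auto
qed

section \<open>The dyadic ratio of a frequency to a level\<close>

definition rho :: "nat \<Rightarrow> int \<Rightarrow> real" where
  "rho j k = (1 + \<bar>real_of_int k\<bar>) / 2 ^ j"

lemma rho_pos [simp]: "0 < rho j k" "rho j k \<noteq> 0" "0 \<le> rho j k"
proof -
  show "0 < rho j k" by (auto simp: rho_def intro!: divide_pos_pos)
  then show "rho j k \<noteq> 0" "0 \<le> rho j k" by simp_all
qed

text \<open>Summation over the levels for a fixed frequency. With \<open>L\<close> the binary
  logarithm of \<open>1 + \<bar>k\<bar>\<close>, the minimum equals
  \<open>2 powr - \<bar>j - L\<bar>\<close>, so the bound is uniform in \<open>k\<close>.\<close>

lemma lp_le_min_rho: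
  assumes "0 \<le> c" "c \<le> 1" "0 < e"
  shows "\<exists>C>0. \<forall>k. lp_le c (\<lambda>j. min (rho j k) (1 / rho j k) powr e) C"
proof -
  obtain C where C: "C > 0" "\<forall>L\<ge>0. lp_le c (\<lambda>j::nat. 2 powr (- e * \<bar>real j - L\<bar>)) C"
    using lp_le_two_sided_geometric[OF assms] by blast
  have "min (rho j k) (1 / rho j k) powr e = 2 powr (- e * \<bar>real j - log 2 (1 + \<bar>real_of_int k\<bar>)\<bar>)" for j k
  proof -
    define L where "L = log 2 (1 + \<bar>real_of_int k\<bar>)"
    have r: "rho j k = 2 powr (L - real j)"
      by (simp add: rho_def L_def powr_diff powr_realpow)
    have "min (rho j k) (1 / rho j k) = 2 powr (- \<bar>real j - L\<bar>)"
      unfolding r by (auto simp: min_def abs_if powr_minus_divide[symmetric])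
    then show ?thesis by (simp add: powr_powr L_def mult.commute)
  qed
  then show ?thesis using C by (intro exI[of _ C]) simp
qed

text \<open>Summation over the frequencies for a fixed level. Blocks of \<open>2 ^ j\<close>
  consecutive integers share a quotient, which costs \<open>2 powr (c * j)\<close>, and the
  quotients decay polynomially. The constant 3 arises from
  \<open>1 + \<bar>k div 2 ^ j\<bar> \<le> 2 + rho j k\<close>.\<close>

lemma lp_le_max_rho:
  assumes "0 \<le> c" "c < e"
  shows "\<exists>C>0. \<forall>j. lp_le c (\<lambda>k. max 1 (rho j k) powr - e) (C * 2 powr (c * real j))"
proof -
  obtain C where C: "C > 0" "lp_le c (\<lambda>m::int. (1 + \<bar>real_of_int m\<bar>) powr - e) C"
    using lp_le_int_power_decay[OF assms] by blast
  have "lp_le c (\<lambda>k. max 1 (rho j k) powr - e) (3 powr e * C * 2 powr (c * real j))" for j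
  proof -
    have fib: "real (card {k\<in>F. k div 2 ^ j = m}) \<le> 2 ^ j" if "finite F" for F and m :: int
    proof -
      have "{k\<in>F. k div 2 ^ j = m} \<subseteq> {m * 2 ^ j..<m * 2 ^ j + 2 ^ j}"
      proof
        fix k assume "k \<in> {k\<in>F. k div 2 ^ j = m}"
        then have "k = m * 2 ^ j + k mod 2 ^ j" by (auto simp: div_mult_mod_eq)
        moreover have "0 \<le> k mod 2 ^ j" "k mod 2 ^ j < 2 ^ j" by simp_all
        ultimately show "k \<in> {m * 2 ^ j..<m * 2 ^ j + 2 ^ j}"
          unfolding atLeastLessThan_iff by linarith
      qed
      then have "card {k\<in>F. k div 2 ^ j = m} \<le> card {m * 2 ^ j..<m * 2 ^ j + 2 ^ j}"
        by (intro card_mono) auto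
      also have "\<dots> = 2 ^ j" by (simp add: nat_power_eq)
      finally show ?thesis by (metis of_nat_le_iff of_nat_numeral of_nat_power)
    qed
    have "lp_le c (\<lambda>k::int. if k \<in> UNIV then (1 + \<bar>real_of_int (k div 2 ^ j)\<bar>) powr - e else 0) ((2 ^ j) powr c * C)"
      by (rule lp_le_reindex[OF C(2) assms(1) _ fib]) auto
    from lp_le_scale[OF this, of "3 powr e"]
    have "lp_le c (\<lambda>k::int. 3 powr e * (1 + \<bar>real_of_int (k div 2 ^ j)\<bar>) powr - e) (3 powr e * C * 2 powr (c * real j))"
      by (simp add: powr_powr powr_realpow[symmetric] mult_ac)
    then show ?thesis
    proof (rule lp_le_mono)
      fix k
      have "\<bar>real_of_int (k div 2 ^ j)\<bar> \<le> \<bar>real_of_int k\<bar> / 2 ^ j + 1"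
      proof -
        have "real_of_int (k div 2 ^ j) = of_int \<lfloor>real_of_int k / 2 ^ j\<rfloor>"
          using floor_divide_of_int_eq[of k "2 ^ j", where 'a = real] by simp
        moreover have "\<bar>of_int \<lfloor>x\<rfloor>\<bar> \<le> \<bar>x\<bar> + 1" for x :: real by linarith
        ultimately show ?thesis by (metis abs_divide abs_of_nonneg zero_le_numeral zero_le_power)
      qed
      also have "\<dots> \<le> rho j k + 1" by (simp add: rho_def divide_right_mono)
      finally have "(1 + \<bar>real_of_int (k div 2 ^ j)\<bar>) / 3 \<le> max 1 (rho j k)" by simp
      then have "max 1 (rho j k) powr - e \<le> ((1 + \<bar>real_of_int (k div 2 ^ j)\<bar>) / 3) powr - e"
        using assms by (intro powr_mono2') auto
      also have "\<dots> = 3 powr e * (1 + \<bar>real_of_int (k div 2 ^ j)\<bar>) powr - e"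
        by (simp add: powr_divide powr_minus field_simps)
      finally show "max 1 (rho j k) powr - e \<le> 3 powr e * (1 + \<bar>real_of_int (k div 2 ^ j)\<bar>) powr - e" .
    qed (use assms in auto)
  qed
  then show ?thesis using C by (intro exI[of _ "3 powr e * C"]) auto
qed

section \<open>The frequency sets \<open>D j\<close> and their residues\<close>

lemma D_0: "D 0 = {0}"
  by (auto simp: D_def power_int_minus)

lemma D_Suc: "D (Suc i) = {- (2 ^ i)..<2 ^ i}"
proof -
  have "k \<in> D (Suc i) \<longleftrightarrow> k \<in> {- (2 ^ i)..<2 ^ i}" for k
    using of_int_less_iff[of k "2 ^ i", where 'a = real] of_int_le_iff[of "- (2 ^ i)" k, where 'a = real]
    by (simp add: D_def del: of_int_less_iff of_int_le_iff)
  then show ?thesis by blast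
qed

lemma finite_D [simp]: "finite (D j)"
  by (cases j) (auto simp: D_0 D_Suc)

lemma card_D: "card (D j) = 2 ^ j"
proof (cases j)
  case (Suc i)
  have "int (card (D j)) = 2 ^ j" by (simp add: Suc D_Suc)
  then show ?thesis by (metis of_nat_eq_iff of_nat_numeral of_nat_power)
qed (simp add: D_0)

lemma D_bound: "l \<in> D j \<Longrightarrow> \<bar>real_of_int l\<bar> \<le> 2 ^ j / 2"
proof (cases j)
  case (Suc i)
  assume "l \<in> D j"
  then have "\<bar>l\<bar> \<le> 2 ^ i" by (auto simp: Suc D_Suc)
  then have "\<bar>real_of_int l\<bar> \<le> 2 ^ i"
    using of_int_le_iff[of "\<bar>l\<bar>" "2 ^ i", where 'a = real] by simp
  then show ?thesis by (simp add: Suc)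
qed (simp add: D_0)

lemma D_lower: "l \<notin> D j \<Longrightarrow> 2 ^ j / 2 \<le> \<bar>real_of_int l\<bar>"
proof (cases j)
  case (Suc i)
  assume "l \<notin> D j"
  then have "2 ^ i \<le> \<bar>l\<bar>" by (auto simp: Suc D_Suc)
  then have "2 ^ i \<le> \<bar>real_of_int l\<bar>"
    using of_int_le_iff[of "2 ^ i" "\<bar>l\<bar>", where 'a = real] by simp
  then show ?thesis by (simp add: Suc)
next
  case 0
  assume "l \<notin> D j"
  then have "l \<noteq> 0" by (simp add: 0 D_0)
  then have "1 \<le> \<bar>l\<bar>" by simp
  then have "1 \<le> \<bar>real_of_int l\<bar>" by linarith
  then show ?thesis by (simp add: 0)
qed

lemma D_mono_Suc: "D j \<subseteq> D (Suc j)"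
proof (cases j)
  case (Suc i)
  have "(0 :: int) < 2 ^ i" by simp
  then have "k \<in> {- (2 ^ Suc i)..<(2 :: int) ^ Suc i}" if "k \<in> {- (2 ^ i)..<2 ^ i}" for k
    using that unfolding atLeastLessThan_iff power_Suc by linarith
  then have "{- (2 ^ i)..<2 ^ i} \<subseteq> {- (2 ^ Suc i)..<(2 :: int) ^ Suc i}" by blast
  then show ?thesis by (simp only: Suc D_Suc)
qed (simp add: D_0 D_Suc)

text \<open>Two members of \<open>D j\<close> differ by less than \<open>2 ^ j\<close>. Hence an
  aliased frequency \<open>k\<close> contributes to only one output frequency per level, which
  bounds the columns of the kernel.\<close>

lemma D_unique_mod:
  assumes "l \<in> D j" "l' \<in> D j" "2 ^ j dvd k - l" "2 ^ j dvd k - l'"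
  shows "l = l'"
proof -
  have "2 ^ j dvd l - l'" using dvd_diff[OF assms(4,3)] by simp
  moreover have "\<bar>l - l'\<bar> < 2 ^ j" using assms(1,2) by (cases j) (auto simp: D_0 D_Suc)
  ultimately show ?thesis using dvd_imp_le_int[of "l - l'" "2 ^ j"] by fastforce
qed

section \<open>The kernel of a univariate quasi-interpolation operator\<close>

text \<open>\<open>mker P Q j l k\<close> is the \<open>l\<close>-th Fourier coefficient of \<open>Q\<^sub>j\<close> applied to the exponential of frequency
  \<open>k\<close>, where \<open>P j\<close> and \<open>Q j\<close> are the coefficients of \<open>\<phi>\<^sub>j\<close> and of its dual distribution; \<open>dker\<close> belongs to
  \<open>Q\<^sub>j - Q\<^sub>j\<^sub>-\<^sub>1\<close>.\<close>

definition mker :: "(nat \<Rightarrow> int \<Rightarrow> complex) \<Rightarrow> (nat \<Rightarrow> int \<Rightarrow> complex) \<Rightarrow> nat \<Rightarrow> int \<Rightarrow> int \<Rightarrow> complex" where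
  "mker P Q j l k = (if l \<in> D j \<and> 2 ^ j dvd k - l then P j l * Q j k else 0)"

definition dker :: "(nat \<Rightarrow> int \<Rightarrow> complex) \<Rightarrow> (nat \<Rightarrow> int \<Rightarrow> complex) \<Rightarrow> nat \<Rightarrow> int \<Rightarrow> int \<Rightarrow> complex" where
  "dker P Q j l k = mker P Q j l k - (if j = 0 then 0 else mker P Q (j - 1) l k)"

text \<open>A row has two regimes and each needs its own exponent: \<open>A\<close> controls the
  aliases beyond the level, \<open>B\<close> the small diagonal frequencies, where a negative power
  is large and the approximation order has to compensate.\<close>

definition weight :: "real \<Rightarrow> real \<Rightarrow> real \<Rightarrow> real" where
  "weight A B r = (if 1 \<le> r then r powr - A else r powr - B)"

lemma weight_pos: "0 < r \<Longrightarrow> 0 < weight A B r"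
  by (simp add: weight_def)

lemma rho_Suc: "rho (Suc j) k = rho j k / 2"
  by (simp add: rho_def)

lemma weight_rho_nonneg: "0 \<le> weight A B (rho j k)"
  by (simp add: weight_def)

locale quasi_kernel =
  fixes P Q :: "nat \<Rightarrow> int \<Rightarrow> complex" and C0 N s :: real
  assumes C0: "0 \<le> C0" and N: "0 \<le> N" and s: "0 < s"
    and P_bound: "\<And>j l. cmod (P j l) \<le> C0"
    and Q_bound: "\<And>j k. cmod (Q j k) \<le> C0 * (1 + \<bar>real_of_int k / 2 ^ j\<bar> powr N)"
    and PQ_approx: "\<And>j l. l \<in> D j \<Longrightarrow> cmod (1 - P j l * Q j l) \<le> C0 * \<bar>real_of_int l / 2 ^ j\<bar> powr s"
begin

abbreviation "mk \<equiv> mker P Q"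
abbreviation "dk \<equiv> dker P Q"

lemma sum_dk: "(\<Sum>j\<le>n. dk j l k) = mk n l k"
  by (induction n) (simp_all add: dker_def)

lemma dk_support: "dk j l k \<noteq> 0 \<Longrightarrow> l \<in> D j"
  using D_mono_Suc[of "j - 1"] by (cases j) (auto simp: dker_def mker_def split: if_splits)

lemma ratio_le_rho: "\<bar>real_of_int l / 2 ^ j\<bar> \<le> rho j l"
  by (simp add: rho_def divide_right_mono)

lemma mk_diag_bound: "cmod (mk j l l) \<le> C0 * (C0 * 2)"
proof (cases "l \<in> D j")
  case True
  have "\<bar>real_of_int l / 2 ^ j\<bar> \<le> 1" using D_bound[OF True] by (simp add: pos_divide_le_eq)
  then have "\<bar>real_of_int l / 2 ^ j\<bar> powr N \<le> 1 powr N" by (intro powr_mono2 N) auto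
  then have "C0 * (1 + \<bar>real_of_int l / 2 ^ j\<bar> powr N) \<le> C0 * 2" using C0 by (intro mult_left_mono) auto
  then have "cmod (Q j l) \<le> C0 * 2" using Q_bound[of j l] by linarith
  then show ?thesis using P_bound[of j l] C0 True by (simp add: mker_def norm_mult mult_mono)
qed (use C0 in \<open>simp add: mker_def\<close>)

text \<open>If \<open>l\<close> belongs to the frequency sets of both levels, the entry is a
  difference of two approximation errors. In the remaining nonzero case \<open>rho j l\<close> is at
  least 1/4, and the crude bound on the diagonal is absorbed by the factor
  \<open>4 powr s\<close>.\<close>

lemma dk_diag: "\<exists>K\<ge>0. \<forall>j l. cmod (dk j l l) \<le> K * rho j l powr s"
proof -
  define K where "K = C0 * (1 + 2 powr s) + C0 * (C0 * 2) * 4 powr s"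
  have K1: "0 \<le> C0 * (1 + 2 powr s)" "0 \<le> C0 * (C0 * 2) * 4 powr s" using C0 by auto
  have K0: "0 \<le> K" unfolding K_def using K1 by (rule add_nonneg_nonneg)
  have "cmod (dk j l l) \<le> K * rho j l powr s" for j l
  proof (cases "l \<in> D j")
    case False
    then have "dk j l l = 0" using dk_support by blast
    then show ?thesis using K0 by simp
  next
    case True
    have far: "cmod (mk j l l) \<le> K * rho j l powr s" if "1 / 4 \<le> rho j l"
    proof -
      have "1 \<le> (4 * rho j l) powr s" using that s by (intro ge_one_powr_ge_zero) auto
      then have "C0 * (C0 * 2) * 1 \<le> C0 * (C0 * 2) * (4 * rho j l) powr s"
        using C0 by (intro mult_left_mono) auto
      also have "\<dots> = C0 * (C0 * 2) * 4 powr s * rho j l powr s" by (simp add: powr_mult)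
      also have "\<dots> \<le> K * rho j l powr s"
        unfolding K_def using K1 by (intro mult_right_mono) auto
      finally show ?thesis using mk_diag_bound[of j l] by linarith
    qed
    show ?thesis
    proof (cases j)
      case 0
      then have "1 / 4 \<le> rho j l" by (simp add: rho_def)
      then show ?thesis using far 0 by (simp add: dker_def)
    next
      case (Suc i)
      show ?thesis
      proof (cases "l \<in> D i")
        case False
        then have "1 / 4 \<le> rho j l" using D_lower[OF False] by (simp add: rho_def Suc pos_le_divide_eq)
        moreover have "dk j l l = mk j l l" using False by (simp add: dker_def Suc mker_def)
        ultimately show ?thesis using far by simp
      next
        case i: True
        have "dk j l l = (1 - P i l * Q i l) - (1 - P j l * Q j l)"
          using True i by (simp add: dker_def mker_def Suc)
        then have "cmod (dk j l l) \<le> cmod (1 - P i l * Q i l) + cmod (1 - P j l * Q j l)"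
          by (metis norm_triangle_ineq4)
        also have "\<dots> \<le> C0 * \<bar>real_of_int l / 2 ^ i\<bar> powr s + C0 * \<bar>real_of_int l / 2 ^ j\<bar> powr s"
          by (intro add_mono PQ_approx i True)
        also have "\<dots> \<le> C0 * (2 * rho j l) powr s + C0 * rho j l powr s"
        proof (intro add_mono mult_left_mono powr_mono2 C0)
          show "\<bar>real_of_int l / 2 ^ i\<bar> \<le> 2 * rho j l"
            using ratio_le_rho[of l j] by (simp add: Suc field_simps)
        qed (use s ratio_le_rho in auto)
        also have "\<dots> = C0 * (1 + 2 powr s) * rho j l powr s" by (simp add: powr_mult algebra_simps)
        also have "\<dots> \<le> K * rho j l powr s" unfolding K_def using K1 by (intro mult_right_mono) auto
        finally show ?thesis .
      qed
    qed
  qed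
  then show ?thesis using K0 by blast
qed

text \<open>An alias differs from \<open>l\<close> by a multiple of \<open>2 ^ (j - 1)\<close>.
  Consequently every off-diagonal entry is nonzero at finitely many levels only.\<close>

lemma dk_eq_0_large:
  assumes "k \<noteq> l" "\<bar>k - l\<bar> < 2 ^ (j - 1)"
  shows "dk j l k = 0"
proof -
  have nd: "\<not> 2 ^ i dvd k - l" if "j - 1 \<le> i" for i
  proof
    assume "2 ^ i dvd k - l"
    then have "\<bar>2 ^ i\<bar> \<le> \<bar>k - l\<bar>" using assms by (intro dvd_imp_le_int) auto
    moreover have "(2 :: int) ^ (j - 1) \<le> 2 ^ i" using that by (intro power_increasing) auto
    ultimately show False using assms by simp
  qed
  show ?thesis using nd[of j] nd[of "j - 1"] by (simp add: dker_def mker_def)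
qed

lemma dk_abs_summable: "(\<lambda>j. norm (dk j l k)) summable_on UNIV"
proof (cases "k = l")
  case True
  obtain K where K: "K \<ge> 0" "\<And>j l. cmod (dk j l l) \<le> K * rho j l powr s" using dk_diag by blast
  obtain C where "lp_le 1 (\<lambda>h::nat. 2 powr (- s * real h)) C" using lp_le_geometric[of 1 s] s by auto
  then have "(\<lambda>h::nat. 2 powr (- s * real h)) summable_on UNIV" by (simp add: lp_le_1_iff)
  then have "(\<lambda>h::nat. K * (1 + \<bar>real_of_int l\<bar>) powr s * 2 powr (- s * real h)) summable_on UNIV"
    by (rule summable_on_cmult_right)
  then show ?thesis
  proof (rule Infinite_Sum.abs_summable_on_comparison_test')
    fix j
    show "norm (dk j l k) \<le> K * (1 + \<bar>real_of_int l\<bar>) powr s * 2 powr (- s * real j)"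
      using K(2)[of j l] unfolding True rho_def
      by (simp add: powr_divide powr_realpow[symmetric] powr_powr powr_minus_divide mult.commute)
  qed
next
  case False
  obtain m where m: "\<bar>k - l\<bar> < 2 ^ m"
    using of_nat_less_two_power[of "nat \<bar>k - l\<bar>", where 'a = int] by auto
  have "dk j l k = 0" if "j \<notin> {..m}" for j
  proof (rule dk_eq_0_large[OF False])
    have "(2::int) ^ m \<le> 2 ^ (j - 1)" using that by (intro power_increasing) auto
    then show "\<bar>k - l\<bar> < 2 ^ (j - 1)" using m by linarith
  qed
  then have "{j \<in> UNIV. norm (dk j l k) \<noteq> 0} \<subseteq> {..m}" by fastforce
  then have "finite {j \<in> UNIV. norm (dk j l k) \<noteq> 0}" using finite_subset by blast
  then show ?thesis by (rule finite_nonzero_values_imp_summable_on)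
qed

text \<open>On the diagonal the approximation bound applies once \<open>l\<close> has entered
  \<open>D n\<close>, and it tends to 0 because \<open>s\<close> is positive. Off the diagonal the
  entries vanish at high levels.\<close>

lemma mk_tendsto: "(\<lambda>n. mk n l k) \<longlonglongrightarrow> (if k = l then 1 else 0)"
proof (cases "k = l")
  case False
  obtain m where m: "\<bar>k - l\<bar> < 2 ^ m"
    using of_nat_less_two_power[of "nat \<bar>k - l\<bar>", where 'a = int] by auto
  have "mk n l k = 0" if "n \<ge> m" for n
  proof -
    have "\<not> 2 ^ n dvd k - l"
    proof
      assume "2 ^ n dvd k - l"
      then have "\<bar>2 ^ n\<bar> \<le> \<bar>k - l\<bar>" using False by (intro dvd_imp_le_int) auto
      moreover have "(2 :: int) ^ m \<le> 2 ^ n" using that by (intro power_increasing) auto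
      ultimately show False using m by simp
    qed
    then show ?thesis by (simp add: mker_def)
  qed
  then show ?thesis using False
    by (auto intro!: tendsto_eventually eventually_sequentiallyI)
next
  case True
  have lim0: "(\<lambda>n. \<bar>real_of_int l / 2 ^ n\<bar>) \<longlonglongrightarrow> 0"
  proof -
    have "(\<lambda>n. \<bar>real_of_int l\<bar> * (1 / 2) ^ n) \<longlonglongrightarrow> \<bar>real_of_int l\<bar> * 0"
      by (intro tendsto_mult tendsto_const LIMSEQ_power_zero) simp
    then show ?thesis by (simp add: power_one_over abs_divide field_simps)
  qed
  have "(\<lambda>n. C0 * \<bar>real_of_int l / 2 ^ n\<bar> powr s) \<longlonglongrightarrow> C0 * 0 powr s"
    using lim0 s by (intro tendsto_mult tendsto_const tendsto_powr2) auto
  then have lim: "(\<lambda>n. C0 * \<bar>real_of_int l / 2 ^ n\<bar> powr s) \<longlonglongrightarrow> 0" by simp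
  have "\<forall>\<^sub>F n in sequentially. \<bar>real_of_int l / 2 ^ n\<bar> < 1 / 2"
    using order_tendstoD(2)[OF lim0, of "1 / 2"] by simp
  then have ev: "\<forall>\<^sub>F n in sequentially. l \<in> D n"
  proof eventually_elim
    case (elim n)
    then show ?case using D_lower[of l n] by (force simp: field_simps)
  qed
  have "(\<lambda>n. 1 - mk n l l) \<longlonglongrightarrow> 0"
  proof (rule Lim_null_comparison[OF _ lim])
    show "\<forall>\<^sub>F n in sequentially. norm (1 - mk n l l) \<le> C0 * \<bar>real_of_int l / 2 ^ n\<bar> powr s"
      using ev by eventually_elim (use PQ_approx in \<open>simp add: mker_def\<close>)
  qed
  from tendsto_diff[OF tendsto_const[of 1] this] show ?thesis using True by simp
qed

lemma infsum_dk: "(\<Sum>\<^sub>\<infinity>j. dk j l k) = (if k = l then 1 else 0)"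
proof -
  have sm: "(\<lambda>j. dk j l k) summable_on UNIV"
    by (rule abs_summable_summable[OF dk_abs_summable])
  then have "(\<lambda>j. dk j l k) sums (\<Sum>\<^sub>\<infinity>j. dk j l k)"
    by (intro has_sum_imp_sums has_sum_infsum)
  then have "(\<lambda>n. mk n l k) \<longlonglongrightarrow> (\<Sum>\<^sub>\<infinity>j. dk j l k)"
    by (simp add: sums_def_le sum_dk)
  then show ?thesis using mk_tendsto LIMSEQ_unique by blast
qed

text \<open>At most one row is hit by the kernel of level \<open>j\<close> and at most one by that
  of level \<open>j - 1\<close>.\<close>

lemma dk_columns: "lp_le 1 (\<lambda>l. if dk j l k \<noteq> 0 then 1 else 0) 2"
proof -
  define S where "S i = {l \<in> D i. 2 ^ i dvd k - l}" for i
  have S: "finite (S i)" "card (S i) \<le> 1" for i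
  proof -
    show "finite (S i)" by (simp add: S_def)
    then show "card (S i) \<le> 1"
      by (simp add: card_le_Suc0_iff_eq) (auto simp: S_def intro: D_unique_mod)
  qed
  have "card (S j \<union> S (j - 1)) \<le> 2"
    using card_Un_le[of "S j" "S (j - 1)"] S(2)[of j] S(2)[of "j - 1"] by linarith
  then have "lp_le 1 (\<lambda>l. if l \<in> S j \<union> S (j - 1) then 1 else 0) (2 powr 1)"
    using S by (intro lp_le_indicator) auto
  then have "lp_le 1 (\<lambda>l. if dk j l k \<noteq> 0 then 1 else 0) (2 powr 1)"
  proof (rule lp_le_mono)
    show "(if dk j l k \<noteq> 0 then 1 else 0) \<le> (if l \<in> S j \<union> S (j - 1) then 1 else 0 :: real)" for l
      by (auto simp: dker_def mker_def S_def split: if_splits)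
  qed auto
  then show ?thesis by simp
qed

text \<open>The weighted rows are bounded uniformly in the level and the row. The diagonal needs
  \<open>B \<le> s\<close>, so that \<open>rho powr s\<close> beats the weight at low frequencies.
  Off the diagonal the frequency is about \<open>\<bar>\<mu>\<bar> * 2 ^ j\<close>. Either the
  weight beats the growth \<open>N\<close> of the dual coefficients and leaves a sequence in \<mu>
  with decay exponent \<open>A - N > c\<close>, or the weight is merely bounded and the norm of the
  dual coefficients along a residue class is used.\<close>

lemma dk_rows:
  assumes c: "0 \<le> c" "c \<le> 1" and AB: "0 \<le> A" "0 \<le> B" "B \<le> s"
    and alt: "c < A - N \<or> (\<exists>K. \<forall>j. \<forall>l\<in>D j. lp_le c (\<lambda>\<mu>. cmod (Q j (l + 2 ^ j * \<mu>))) K)"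
  shows "\<exists>R\<ge>0. \<forall>j l. lp_le c (\<lambda>k. cmod (dk j l k) * weight A B (rho j k)) R"
proof -
  have far: "\<bar>real_of_int \<mu>\<bar> / 2 \<le> rho i (l + 2 ^ i * \<mu>)" if "l \<in> D i" "\<mu> \<noteq> 0" for i l \<mu>
  proof -
    have "1 \<le> \<bar>real_of_int \<mu>\<bar>" using that by linarith
    then have "2 ^ i * 1 \<le> 2 ^ i * \<bar>real_of_int \<mu>\<bar>" by (intro mult_left_mono) auto
    moreover have "\<bar>real_of_int (l + 2 ^ i * \<mu>)\<bar> \<ge> 2 ^ i * \<bar>real_of_int \<mu>\<bar> - 2 ^ i / 2"
      using D_bound[OF that(1)] abs_triangle_ineq2[of "2 ^ i * real_of_int \<mu>" "- real_of_int l"]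
      by (simp add: abs_mult add.commute)
    \<comment> \<open>Here \<open>p\<close> stands for \<open>2 ^ i\<close> and \<open>a\<close> for
      \<open>\<bar>\<mu>\<bar>\<close>: since \<open>a\<close> is at least 1,
      \<open>a - 1 / 2\<close> is at least \<open>a / 2\<close>.\<close>
    moreover have "p * 1 \<le> p * a \<Longrightarrow> p * a - p / 2 \<le> b \<Longrightarrow> a / 2 * p \<le> 1 + b" for p a b :: real
      by (simp add: mult.commute)
    ultimately have "\<bar>real_of_int \<mu>\<bar> / 2 * 2 ^ i \<le> 1 + \<bar>real_of_int (l + 2 ^ i * \<mu>)\<bar>" by blast
    then show ?thesis by (simp only: rho_def pos_le_divide_eq zero_less_power zero_less_numeral)
  qed
  \<comment> \<open>All nonzero off-diagonal entries sit at ratios of at least 1/4, where the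
    exponent \<open>B\<close> can be traded for \<open>A\<close> at the price
    \<open>4 powr B\<close>.\<close>
  have wt: "weight A B r \<le> 4 powr B * r powr - A" if "1 / 4 \<le> r" for r
  proof (cases "1 \<le> r")
    case True
    then show ?thesis using AB ge_one_powr_ge_zero[of 4 B] by (simp add: weight_def mult_le_cancel_right1)
  next
    case False
    have "r powr - B \<le> (1 / 4) powr - B" using that AB by (intro powr_mono2') auto
    also have "\<dots> = 4 powr B" by (simp add: powr_divide powr_minus field_simps)
    also have "\<dots> * 1 \<le> 4 powr B * r powr - A"
      using that False AB powr_mono2'[of "- A" r 1] by (intro mult_left_mono) auto
    finally show ?thesis using False by (simp add: weight_def)
  qed
  \<comment> \<open>The difference at level \<open>j\<close> contains kernels of levels
    \<open>j\<close> and \<open>j - 1\<close>, but is weighted at level \<open>j\<close> throughout.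
    So kernel level \<open>i\<close> has to be paired with weight levels \<open>i\<close> and
    \<open>Suc i\<close>; the latter only halves the ratio. The majorant \<open>g\<close> in the
    alias index hides which alternative holds.\<close>
  have G: "\<exists>K\<ge>0. \<forall>i. \<forall>l\<in>D i. \<exists>g. lp_le c g K \<and> (\<forall>j\<in>{i, Suc i}. \<forall>\<mu>. \<mu> \<noteq> 0 \<longrightarrow>
      cmod (mk i l (l + 2 ^ i * \<mu>)) * weight A B (rho j (l + 2 ^ i * \<mu>)) \<le> g \<mu>)"
    using alt
  proof
    assume cA: "c < A - N"
    obtain K where K: "K > 0" "lp_le c (\<lambda>m::int. (1 + \<bar>real_of_int m\<bar>) powr - (A - N)) K"
      using lp_le_int_power_decay[OF c(1) cA] by blast
    define K1 where "K1 = C0 * (C0 * (4 powr N + 2 powr N)) * 4 powr B * 8 powr (A - N)"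
    have K1: "0 \<le> K1" using C0 by (simp add: K1_def)
    have "cmod (mk i l (l + 2 ^ i * \<mu>)) * weight A B (rho j (l + 2 ^ i * \<mu>))
       \<le> K1 * (1 + \<bar>real_of_int \<mu>\<bar>) powr - (A - N)"
      if "l \<in> D i" "j \<in> {i, Suc i}" "\<mu> \<noteq> 0" for i j l \<mu>
    proof -
      define k where "k = l + 2 ^ i * \<mu>"
      define r where "r = rho j k"
      have "1 \<le> \<bar>real_of_int \<mu>\<bar>" using that by linarith
      moreover have ri: "rho i k \<le> 2 * r"
        using that rho_pos(3)[of i k] by (auto simp: r_def rho_Suc)
      moreover have "\<bar>real_of_int \<mu>\<bar> / 2 \<le> rho i k" using far that by (simp add: k_def)
      ultimately have r: "(1 + \<bar>real_of_int \<mu>\<bar>) / 8 \<le> r" "1 / 4 \<le> r" by auto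
      have "1 \<le> (4 * r) powr N" using r N by (intro ge_one_powr_ge_zero) auto
      moreover have "\<bar>real_of_int k / 2 ^ i\<bar> powr N \<le> (2 * r) powr N"
        using ri ratio_le_rho[of k i] N by (intro powr_mono2) auto
      ultimately have "1 + \<bar>real_of_int k / 2 ^ i\<bar> powr N \<le> (4 powr N + 2 powr N) * r powr N"
        by (simp add: powr_mult algebra_simps)
      then have "C0 * (1 + \<bar>real_of_int k / 2 ^ i\<bar> powr N) \<le> C0 * ((4 powr N + 2 powr N) * r powr N)"
        using C0 by (intro mult_left_mono) auto
      then have "cmod (Q i k) \<le> C0 * (4 powr N + 2 powr N) * r powr N"
        using Q_bound[of i k] by (simp add: mult.assoc)
      then have "cmod (mk i l k) \<le> C0 * (C0 * (4 powr N + 2 powr N) * r powr N)"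
        using P_bound[of i l] C0 by (simp add: mker_def norm_mult mult_mono)
      then have "cmod (mk i l k) * weight A B r
          \<le> C0 * (C0 * (4 powr N + 2 powr N) * r powr N) * (4 powr B * r powr - A)"
        using wt[OF r(2)] C0 r weight_pos[of r A B] by (intro mult_mono) auto
      also have "\<dots> = C0 * (C0 * (4 powr N + 2 powr N)) * 4 powr B * (r powr N * r powr - A)"
        by (simp only: mult_ac)
      also have "r powr N * r powr - A = r powr - (A - N)" by (simp flip: powr_add)
      also have "\<dots> \<le> ((1 + \<bar>real_of_int \<mu>\<bar>) / 8) powr - (A - N)"
        using r c cA by (intro powr_mono2') auto
      also have "\<dots> = 8 powr (A - N) * (1 + \<bar>real_of_int \<mu>\<bar>) powr - (A - N)"
        by (simp add: powr_divide powr_minus powr_diff field_simps)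
      finally show ?thesis
        using C0 by (simp add: K1_def k_def r_def mult.assoc mult_left_mono)
    qed
    moreover have "lp_le c (\<lambda>m::int. K1 * (1 + \<bar>real_of_int m\<bar>) powr - (A - N)) (K1 * K)"
      by (rule lp_le_scale[OF K(2) K1])
    ultimately show ?thesis
      using K K1 by (intro exI[of _ "K1 * K"] conjI mult_nonneg_nonneg allI ballI
        exI[of _ "\<lambda>m::int. K1 * (1 + \<bar>real_of_int m\<bar>) powr - (A - N)"]) auto
  next
    assume "\<exists>K. \<forall>j. \<forall>l\<in>D j. lp_le c (\<lambda>\<mu>. cmod (Q j (l + 2 ^ j * \<mu>))) K"
    then obtain K where K: "\<And>j l. l \<in> D j \<Longrightarrow> lp_le c (\<lambda>\<mu>. cmod (Q j (l + 2 ^ j * \<mu>))) K" by blast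
    have K0: "0 \<le> K" using lp_le_bound_nonneg[OF K[of 0 0]] by (simp add: D_0)
    define K1 where "K1 = C0 * (4 powr B * 4 powr A)"
    have K1: "0 \<le> K1" using C0 by (simp add: K1_def)
    have bnd: "cmod (mk i l (l + 2 ^ i * \<mu>)) * weight A B (rho j (l + 2 ^ i * \<mu>)) \<le> K1 * cmod (Q i (l + 2 ^ i * \<mu>))"
      if "l \<in> D i" "j \<in> {i, Suc i}" "\<mu> \<noteq> 0" for i j l \<mu>
    proof -
      define k where "k = l + 2 ^ i * \<mu>"
      define r where "r = rho j k"
      have "1 \<le> \<bar>real_of_int \<mu>\<bar>" using that by linarith
      moreover have ri: "rho i k \<le> 2 * r"
        using that rho_pos(3)[of i k] by (auto simp: r_def rho_Suc)
      moreover have "\<bar>real_of_int \<mu>\<bar> / 2 \<le> rho i k" using far that by (simp add: k_def)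
      ultimately have r: "1 / 4 \<le> r" by auto
      have "r powr - A \<le> (1 / 4) powr - A" using r AB by (intro powr_mono2') auto
      also have "\<dots> = 4 powr A" by (simp add: powr_divide powr_minus field_simps)
      finally have "4 powr B * r powr - A \<le> 4 powr B * 4 powr A" by (intro mult_left_mono) auto
      then have w: "weight A B r \<le> 4 powr B * 4 powr A" using wt[OF r] by linarith
      have "cmod (mk i l k) \<le> C0 * cmod (Q i k)"
        using P_bound[of i l] C0 by (simp add: mker_def norm_mult mult_right_mono)
      then have "cmod (mk i l k) * weight A B r \<le> C0 * cmod (Q i k) * (4 powr B * 4 powr A)"
        using w C0 r weight_pos[of r A B] by (intro mult_mono) auto
      then show ?thesis by (simp add: K1_def k_def r_def mult_ac)
    qed
    show ?thesis
    proof (intro exI[of _ "K1 * K"] conjI allI ballI)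
      fix i l assume l: "l \<in> D i"
      show "\<exists>g. lp_le c g (K1 * K) \<and> (\<forall>j\<in>{i, Suc i}. \<forall>\<mu>. \<mu> \<noteq> 0 \<longrightarrow>
        cmod (mk i l (l + 2 ^ i * \<mu>)) * weight A B (rho j (l + 2 ^ i * \<mu>)) \<le> g \<mu>)"
        using lp_le_scale[OF K[OF l] K1] bnd[OF l] by blast
    qed (use K1 K0 in simp)
  qed
  then obtain K where K: "K \<ge> 0" "\<And>i l. l \<in> D i \<Longrightarrow> \<exists>g. lp_le c g K \<and> (\<forall>j\<in>{i, Suc i}. \<forall>\<mu>. \<mu> \<noteq> 0 \<longrightarrow>
      cmod (mk i l (l + 2 ^ i * \<mu>)) * weight A B (rho j (l + 2 ^ i * \<mu>)) \<le> g \<mu>)" by meson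
  have off: "lp_le c (\<lambda>k. if k \<noteq> l then cmod (mk i l k) * weight A B (rho j k) else 0) K"
    if j: "j \<in> {i, Suc i}" for i j l
  proof (cases "l \<in> D i")
    case False
    then show ?thesis using K(1) by (simp add: mker_def lp_le_zero if_distrib cong: if_cong)
  next
    case True
    obtain g where g: "lp_le c g K" and gb: "\<And>\<mu>. \<mu> \<noteq> 0 \<Longrightarrow>
      cmod (mk i l (l + 2 ^ i * \<mu>)) * weight A B (rho j (l + 2 ^ i * \<mu>)) \<le> g \<mu>"
      using K(2)[OF True] j by blast
    define E where "E = {k. k \<noteq> l \<and> 2 ^ i dvd k - l}"
    have "inj_on (\<lambda>k. (k - l) div 2 ^ i) E"
      by (rule inj_onI) (auto simp: E_def dvd_def)
    from lp_le_reindex_inj[OF g c(1) this]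
    show ?thesis
    proof (rule lp_le_mono)
      fix k
      show "(if k \<noteq> l then cmod (mk i l k) * weight A B (rho j k) else 0) \<le> (if k \<in> E then g ((k - l) div 2 ^ i) else 0)"
      proof (cases "k \<in> E")
        case True
        then have "k = l + 2 ^ i * ((k - l) div 2 ^ i)" "(k - l) div 2 ^ i \<noteq> 0"
          by (auto simp: E_def dvd_def)
        then show ?thesis using gb[of "(k - l) div 2 ^ i"] True by (auto simp: E_def)
      next
        case False
        then show ?thesis by (auto simp: E_def mker_def)
      qed
    qed (use c in \<open>auto intro: weight_rho_nonneg mult_nonneg_nonneg\<close>)
  qed
  obtain K2 where K2: "K2 \<ge> 0" "\<And>j l. cmod (dk j l l) \<le> K2 * rho j l powr s" using dk_diag by blast
  define R1 where "R1 = K2 * (3 / 2) powr s"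
  have diag: "cmod (dk j l l) * weight A B (rho j l) \<le> R1" for j l
  proof (cases "l \<in> D j")
    case False
    then have "dk j l l = 0" using dk_support by blast
    then show ?thesis using K2 by (simp add: R1_def)
  next
    case True
    have r: "rho j l \<le> 3 / 2"
    proof -
      have "1 + \<bar>real_of_int l\<bar> \<le> 2 ^ j + 2 ^ j / 2"
        using D_bound[OF True] by (intro add_mono) auto
      then show ?thesis by (simp add: rho_def pos_divide_le_eq)
    qed
    have "rho j l powr s * weight A B (rho j l) \<le> (3 / 2) powr s"
    proof (cases "1 \<le> rho j l")
      case True
      have "rho j l powr - A \<le> 1" using True AB powr_mono2'[of "- A" 1 "rho j l"] by simp
      moreover have "rho j l powr s \<le> (3 / 2) powr s" using r s by (intro powr_mono2) auto
      ultimately have "rho j l powr s * rho j l powr - A \<le> (3 / 2) powr s * 1" by (intro mult_mono) auto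
      then show ?thesis using True by (simp add: weight_def)
    next
      case False
      have "rho j l powr s * rho j l powr - B = rho j l powr (s - B)" by (simp flip: powr_add)
      also have "\<dots> \<le> 1 powr (s - B)" using False AB by (intro powr_mono2) auto
      also have "\<dots> \<le> (3 / 2) powr s" using s ge_one_powr_ge_zero[of "3 / 2" s] by simp
      finally show ?thesis using False by (simp add: weight_def)
    qed
    then have "K2 * (rho j l powr s * weight A B (rho j l)) \<le> R1"
      unfolding R1_def using K2 by (intro mult_left_mono)
    moreover have "cmod (dk j l l) * weight A B (rho j l) \<le> K2 * rho j l powr s * weight A B (rho j l)"
      by (intro mult_right_mono K2(2) weight_rho_nonneg)
    ultimately show ?thesis by (simp add: mult.assoc)
  qed
  have R1: "0 \<le> R1" using K2 by (simp add: R1_def)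
  \<comment> \<open>The three terms are the diagonal and the off-diagonal parts of the two levels.
    At \<open>j = 0\<close> truncated subtraction repeats level 0, which only enlarges the
    majorant.\<close>
  have "lp_le c (\<lambda>k. cmod (dk j l k) * weight A B (rho j k)) (R1 + K + K)" for j l
  proof (rule lp_le_mono[OF lp_le_add[OF lp_le_add[OF lp_le_single[OF R1 c(1), of l] off[of j j l] c]
        off[of j "j - 1" l] c] _ _ order_refl c(1)])
    show "j \<in> {j, Suc j}" by simp
    show "0 \<le> cmod (dk j l k) * weight A B (rho j k)" for k
      by (intro mult_nonneg_nonneg weight_rho_nonneg) simp
  next
    show "j \<in> {j - 1, Suc (j - 1)}" by auto
  next
    fix k
    define w where "w = weight A B (rho j k)"
    have w: "0 \<le> w" by (simp add: w_def weight_rho_nonneg)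
    show "cmod (dk j l k) * weight A B (rho j k)
       \<le> (if k = l then R1 else 0) + (if k \<noteq> l then cmod (mk j l k) * weight A B (rho j k) else 0) +
         (if k \<noteq> l then cmod (mk (j - 1) l k) * weight A B (rho j k) else 0)"
    proof (cases "k = l")
      case True
      then show ?thesis using diag by simp
    next
      case False
      have "cmod (dk j l k) \<le> cmod (mk j l k) + cmod (mk (j - 1) l k)"
        using norm_triangle_ineq4[of "mk j l k" "mk (j - 1) l k"] by (simp add: dker_def)
      from mult_right_mono[OF this w] False show ?thesis by (simp add: w_def distrib_right)
    qed
  qed
  then show ?thesis using R1 K(1) by (intro exI[of _ "R1 + K + K"]) auto
qed

end

section \<open>Summation outside the sparse grid\<close>

definition vsum :: "nat ^ 'd::finite \<Rightarrow> real" where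
  "vsum j = real (\<Sum>i\<in>UNIV. j $ i)"

definition vmax :: "nat ^ 'd::finite \<Rightarrow> real" where
  "vmax j = real (Max (range (\<lambda>i. j $ i)))"

lemma vmax_ge: "real (j $ i) \<le> vmax j"
  unfolding vmax_def by (intro of_nat_mono Max_ge) auto

lemma vmax_attained: "\<exists>i. real (j $ i) = vmax j"
proof -
  have "Max (range (\<lambda>i. j $ i)) \<in> range (\<lambda>i. j $ i)" by (intro Max_in) auto
  then obtain i where "Max (range (\<lambda>i. j $ i)) = j $ i" by blast
  then show ?thesis by (auto simp: vmax_def)
qed

lemma vmax_nonneg: "0 \<le> vmax j"
  by (simp add: vmax_def)

lemma vsum_split: "vsum j = real (j $ i) + (\<Sum>i'\<in>-{i}. real (j $ i'))"
  unfolding vsum_def of_nat_sum Compl_eq_Diff_UNIV by (rule sum.remove) auto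

lemma vsum_le: "vsum (j :: nat ^ 'd::finite) \<le> real CARD('d) * vmax j"
  using sum_bounded_above[of UNIV "\<lambda>i. real (j $ i)" "vmax j"] vmax_ge[of j]
  by (simp add: vsum_def)

lemma Delta_iff: "j \<in> Delta n T \<longleftrightarrow> vsum j - T * vmax j \<le> (1 - T) * real n"
  by (simp add: Delta_def vsum_def vmax_def)

lemma finite_Delta:
  assumes "T < 1" shows "finite (Delta n T :: (nat ^ 'd::finite) set)"
proof (rule finite_subset)
  show "finite {v :: nat ^ 'd. \<forall>i. v $ i \<in> {..n}}" by (rule finite_vec_box) simp
  show "Delta n T \<subseteq> {v :: nat ^ 'd. \<forall>i. v $ i \<in> {..n}}"
  proof (intro subsetI CollectI allI)
    fix j :: "nat ^ 'd" and i assume "j \<in> Delta n T"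
    then have le: "vsum j - T * vmax j \<le> (1 - T) * real n" by (simp add: Delta_iff)
    obtain m where m: "real (j $ m) = vmax j" using vmax_attained by blast
    have "vmax j \<le> vsum j" unfolding vsum_split[of j m] m by (simp add: sum_nonneg)
    then have "(1 - T) * vmax j \<le> (1 - T) * real n" using le by (simp add: algebra_simps)
    then have "vmax j \<le> real n" using assms by (simp add: mult_le_cancel_left)
    then show "j $ i \<in> {..n}" using vmax_ge[of j i] by simp
  qed
qed

text \<open>Replacing the \<open>i\<close>-th coordinate by the integer part \<open>h\<close> of the distance to the boundary of the grid
  decouples the variables: the substitution is injective, and the majorant becomes a product.\<close>

lemma lp_le_shifted_coordinate:
  fixes i :: "'d::finite" and X :: "nat ^ 'd \<Rightarrow> real"
  assumes "0 \<le> c" "T < 1" and fh: "lp_le c fh R1" and fu: "lp_le c fu R2" and K: "0 \<le> K"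
    and X0: "\<And>j. 0 \<le> X j"
    and X: "\<And>j h. M < (1 - T) * real (j $ i) + (\<Sum>i'\<in>-{i}. real (j $ i')) \<Longrightarrow>
      (1 - T) * real h \<le> (1 - T) * real (j $ i) + (\<Sum>i'\<in>-{i}. real (j $ i')) - M \<Longrightarrow>
      X j \<le> K * (fh h * (\<Prod>i'\<in>-{i}. fu (j $ i')))"
  shows "lp_le c (\<lambda>j. if M < (1 - T) * real (j $ i) + (\<Sum>i'\<in>-{i}. real (j $ i')) then X j else 0)
    (K * (R1 * R2 ^ (CARD('d) - 1)))"
proof -
  define S where "S j = (\<Sum>i'\<in>-{i}. real (j $ i'))" for j :: "nat ^ 'd"
  define A where "A = {j. M < (1 - T) * real (j $ i) + S j}"
  \<comment> \<open>The quotient depends only on the other coordinates, and adding an integer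
    commutes with the floor. So for fixed other coordinates \<open>h j\<close> determines
    \<open>j $ i\<close>; on \<open>A\<close> the argument is positive and the conversion to
    \<open>nat\<close> loses nothing.\<close>
  define h where "h j = nat \<lfloor>real (j $ i) + (S j - M) / (1 - T)\<rfloor>" for j
  define \<tau> where "\<tau> j = (\<chi> i'. if i' = i then h j else j $ i')" for j
  have pos: "0 < real (j $ i) + (S j - M) / (1 - T)" if "j \<in> A" for j
  proof -
    have "0 < ((1 - T) * real (j $ i) + S j - M) / (1 - T)" using that assms by (simp add: A_def)
    also have "\<dots> = real (j $ i) + (S j - M) / (1 - T)" using assms by (simp add: field_simps)
    finally show ?thesis .
  qed
  have hle: "(1 - T) * real (h j) \<le> (1 - T) * real (j $ i) + S j - M" if "j \<in> A" for j
  proof -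
    have "real (h j) \<le> real (j $ i) + (S j - M) / (1 - T)"
      using pos[OF that] unfolding h_def by linarith
    then have "(1 - T) * real (h j) \<le> (1 - T) * (real (j $ i) + (S j - M) / (1 - T))"
      using assms by (intro mult_left_mono) auto
    also have "\<dots> = (1 - T) * real (j $ i) + S j - M" using assms by (simp add: field_simps)
    finally show ?thesis .
  qed
  have inj: "inj_on \<tau> A"
  proof (rule inj_onI)
    fix j j' assume j: "j \<in> A" "j' \<in> A" "\<tau> j = \<tau> j'"
    then have c: "(\<tau> j) $ i' = (\<tau> j') $ i'" for i' by simp
    have oth: "j $ i' = j' $ i'" if "i' \<noteq> i" for i' using c[of i'] that by (simp add: \<tau>_def)
    then have S: "S j = S j'" unfolding S_def by (intro sum.cong) auto
    have "h j = h j'" using c[of i] by (simp add: \<tau>_def)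
    moreover have "0 \<le> \<lfloor>real (j $ i) + (S j - M) / (1 - T)\<rfloor>" "0 \<le> \<lfloor>real (j' $ i) + (S j' - M) / (1 - T)\<rfloor>"
      using pos[OF j(1)] pos[OF j(2)] by linarith+
    ultimately have "\<lfloor>real (j $ i) + (S j - M) / (1 - T)\<rfloor> = \<lfloor>real (j' $ i) + (S j' - M) / (1 - T)\<rfloor>"
      unfolding h_def by (metis eq_nat_nat_iff)
    moreover have "\<lfloor>real m + x\<rfloor> = int m + \<lfloor>x\<rfloor>" for m x by linarith
    ultimately have "j $ i = j' $ i" unfolding S by simp
    then show "j = j'" using oth by (metis vec_eq_iff)
  qed
  define f where "f i' = (if i' = i then fh else fu)" for i'
  have "lp_le c (\<lambda>k. \<Prod>i'\<in>UNIV. f i' (k $ i')) (\<Prod>i'\<in>UNIV. if i' = i then R1 else R2)"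
    using fh fu \<open>0 \<le> c\<close> by (intro lp_le_vec_prod) (auto simp: f_def)
  also have "(\<Prod>i'\<in>UNIV. if i' = i then R1 else R2) = R1 * R2 ^ (CARD('d) - 1)"
    by (subst prod.remove[of _ i]) (auto simp: card_Diff_subset)
  finally have "lp_le c (\<lambda>j. K * (if j \<in> A then \<Prod>i'\<in>UNIV. f i' (\<tau> j $ i') else 0)) (K * (R1 * R2 ^ (CARD('d) - 1)))"
    using lp_le_reindex_inj[OF _ \<open>0 \<le> c\<close> inj] lp_le_scale[OF _ K] by blast
  then show ?thesis
  proof (rule lp_le_mono)
    fix j :: "nat ^ 'd"
    show "(if M < (1 - T) * real (j $ i) + (\<Sum>i'\<in>-{i}. real (j $ i')) then X j else 0)
      \<le> K * (if j \<in> A then \<Prod>i'\<in>UNIV. f i' (\<tau> j $ i') else 0)"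
    proof (cases "j \<in> A")
      case True
      have "(\<Prod>i'\<in>UNIV. f i' (\<tau> j $ i')) = f i (\<tau> j $ i) * (\<Prod>i'\<in>UNIV - {i}. f i' (\<tau> j $ i'))"
        by (rule prod.remove) auto
      also have "\<dots> = fh (h j) * (\<Prod>i'\<in>-{i}. fu (j $ i'))"
        unfolding Compl_eq_Diff_UNIV by (intro arg_cong2[where f = "(*)"] prod.cong) (auto simp: f_def \<tau>_def)
      finally show ?thesis using X[of j "h j"] hle[OF True] True by (simp add: A_def S_def)
    qed (auto simp: A_def S_def)
  qed (use X0 \<open>0 \<le> c\<close> in auto)
qed

text \<open>The rate in the reduced parameters \<open>c\<close> = 1 - 1/p, \<open>a\<close> =
  \<alpha> - \<sigma> and \<open>g\<close> = \<gamma> - \<beta>, the only combinations that enter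
  the summation over levels.\<close>

definition sparse_rate :: "real \<Rightarrow> real \<Rightarrow> real \<Rightarrow> real \<Rightarrow> real \<Rightarrow> nat \<Rightarrow> real" where
  "sparse_rate d c a g T n =
     (if T \<ge> g / a
      then 2 powr (- (a - g - (a * T - g) * ((d - 1) / (d - T))) * real n) * real n powr ((d - 1) * c)
      else 2 powr (- (a - g) * real n))"

text \<open>Levels are sorted by a coordinate \<open>i\<close> at which the maximum is attained;
  there \<open>z i j\<close> is the linear form defining the grid. For \<open>T \<ge> g / a\<close>
  the exponent is \<open>a * z i j + (a * T - g) * vmax j\<close> with a nonnegative second
  coefficient, and outside the grid both \<open>z i j\<close> and \<open>vmax j\<close> are bounded
  below, the latter through \<open>vsum j \<le> d * vmax j\<close>. For smaller T the second
  coefficient is negative, and the exponent is instead split into a multiple of \<open>z i j\<close>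
  and a positive multiple of the other coordinates.\<close>

lemma lp_le_outside_Delta:
  assumes c: "0 \<le> c" "c \<le> 1" and a: "0 < a" and g: "g < a" and T: "T < 1"
  shows "\<exists>C>0. \<forall>n\<ge>1. lp_le c (\<lambda>j :: nat ^ 'd::finite.
      if j \<in> Delta n T then 0 else 2 powr (- (a * vsum j - g * vmax j)))
      (C * sparse_rate (real CARD('d)) c a g T n)"
proof -
  define d where "d = real CARD('d)"
  have d: "1 \<le> d" "real (CARD('d) - 1) = d - 1"
    unfolding d_def by (auto simp: of_nat_diff Suc_leI)
  have d0: "0 < d" using d(1) by linarith
  have dT0: "0 < d - T" using d(1) T by linarith
  define z where "z i j = (1 - T) * real (j $ i) + (\<Sum>i'\<in>-{i}. real (j $ i'))" for i and j :: "nat ^ 'd"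
  define X where "X i j = (if real (j $ i) = vmax j then 2 powr (- (a * vsum j - g * vmax j)) else 0)"
    for i and j :: "nat ^ 'd"
  have zmax: "z i j = vsum j - T * vmax j" if "real (j $ i) = vmax j" for i j
    unfolding z_def vsum_split[of j i] that by (simp add: algebra_simps)
  have "\<exists>C>0. \<forall>n\<ge>1. \<forall>i. lp_le c (\<lambda>j. if (1 - T) * real n < z i j then X i j else 0)
      (C * sparse_rate d c a g T n)"
  proof (cases "T \<ge> g / a")
    case True
    then have aT: "0 \<le> a * T - g" using a by (simp add: pos_divide_le_eq mult.commute)
    \<comment> \<open>The decay in the excess \<open>z i j - M\<close> is shared equally by
      \<open>h\<close> and the \<open>d - 1\<close> other coordinates, each of which exceeds
      \<open>M\<close> by no more than this excess.\<close>
    define e where "e = a / d"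
    have e: "0 < e" using a d0 by (simp add: e_def)
    obtain C1 where C1: "C1 > 0" "lp_le c (\<lambda>h::nat. 2 powr (- (e * (1 - T)) * real h)) C1"
      using lp_le_geometric[OF c(1), of "e * (1 - T)"] e T by auto
    obtain C2 where C2: "C2 > 0"
      "\<And>M. M \<ge> 0 \<Longrightarrow> lp_le c (\<lambda>u::nat. 2 powr (- e * max 0 (real u - M))) (C2 * (M + 1) powr c)"
      using lp_le_geometric_beyond[OF c e] by blast
    \<comment> \<open>The power of \<open>2 - T\<close> comes from
      \<open>M + 1 \<le> (2 - T) * n\<close> for \<open>n \<ge> 1\<close>, which turns the plateau
      lengths into powers of n.\<close>
    define C where "C = C1 * C2 ^ (CARD('d) - 1) * (2 - T) powr (c * (d - 1))"
    have "lp_le c (\<lambda>j. if (1 - T) * real n < z i j then X i j else 0) (C * sparse_rate d c a g T n)"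
      if n: "1 \<le> n" for n i
    proof -
      define M where "M = (1 - T) * real n"
      have M: "0 \<le> M" using T by (simp add: M_def)
      define K where "K = 2 powr (- (a * M + (a * T - g) * (M / (d - T))))"
      have le: "X i j \<le> K * (2 powr (- (e * (1 - T)) * real h) * (\<Prod>i'\<in>-{i}. 2 powr (- e * max 0 (real (j $ i') - M))))"
        if zM: "M < (1 - T) * real (j $ i) + (\<Sum>i'\<in>-{i}. real (j $ i'))"
          and h: "(1 - T) * real h \<le> (1 - T) * real (j $ i) + (\<Sum>i'\<in>-{i}. real (j $ i')) - M" for j h
      proof (cases "real (j $ i) = vmax j")
        case False
        then show ?thesis by (simp add: X_def K_def prod_nonneg)
      next
        case True
        have zM': "M < z i j" and h': "(1 - T) * real h \<le> z i j - M" using zM h by (simp_all add: z_def)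
        have "z i j \<le> (d - T) * vmax j" using vsum_le[of j] unfolding zmax[OF True] by (simp add: d_def algebra_simps)
        then have "M \<le> (d - T) * vmax j" using zM' by simp
        then have y: "M / (d - T) \<le> vmax j" using dT0 by (simp add: pos_divide_le_eq mult.commute)
        have u: "max 0 (real (j $ i') - M) \<le> z i j - M" if "i' \<in> - {i}" for i'
        proof -
          have "real (j $ i') \<le> (\<Sum>i'\<in>-{i}. real (j $ i'))" using that by (intro member_le_sum) auto
          moreover have "0 \<le> (1 - T) * real (j $ i)" using T by simp
          ultimately show ?thesis using zM' by (simp add: z_def)
        qed
        have "(1 - T) * real h + (\<Sum>i'\<in>-{i}. max 0 (real (j $ i') - M))
            \<le> (z i j - M) + (\<Sum>i'\<in>-{i}. z i j - M)"
          by (intro add_mono sum_mono u h')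
        also have "\<dots> = d * (z i j - M)" using d by (simp add: Compl_eq_Diff_UNIV card_Diff_subset algebra_simps)
        finally have "e * ((1 - T) * real h + (\<Sum>i'\<in>-{i}. max 0 (real (j $ i') - M))) \<le> e * (d * (z i j - M))"
          using e by (intro mult_left_mono) auto
        also have "\<dots> = a * (z i j - M)" using d0 by (simp add: e_def)
        finally have 1: "e * (1 - T) * real h + (\<Sum>i'\<in>-{i}. e * max 0 (real (j $ i') - M)) \<le> a * (z i j - M)"
          by (simp add: distrib_left sum_distrib_left mult.assoc)
        have 2: "(a * T - g) * (M / (d - T)) \<le> (a * T - g) * vmax j" using y aT by (rule mult_left_mono)
        have "a * vsum j - g * vmax j = a * z i j + (a * T - g) * vmax j"
          unfolding zmax[OF True] by (simp add: algebra_simps)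
        moreover have "a * (z i j - M) = a * z i j - a * M" by (rule right_diff_distrib)
        moreover have "(\<Sum>i'\<in>-{i}. - e * max 0 (real (j $ i') - M)) = - (\<Sum>i'\<in>-{i}. e * max 0 (real (j $ i') - M))"
          by (simp add: sum_negf)
        moreover have "- (e * (1 - T)) * real h = - (e * (1 - T) * real h)" by (rule mult_minus_left)
        ultimately have "- (a * vsum j - g * vmax j) \<le> - (a * M + (a * T - g) * (M / (d - T)))
          + (- (e * (1 - T)) * real h + (\<Sum>i'\<in>-{i}. - e * max 0 (real (j $ i') - M)))"
          using 1 2 by linarith
        then have "X i j \<le> 2 powr (- (a * M + (a * T - g) * (M / (d - T)))
          + (- (e * (1 - T)) * real h + (\<Sum>i'\<in>-{i}. - e * max 0 (real (j $ i') - M))))"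
          unfolding X_def using True by simp
        also have "\<dots> = K * (2 powr (- (e * (1 - T)) * real h) * (\<Prod>i'\<in>-{i}. 2 powr (- e * max 0 (real (j $ i') - M))))"
          unfolding K_def powr_add by (subst powr_sum) auto
        finally show ?thesis .
      qed
      have X0: "0 \<le> X i j" for j by (simp add: X_def)
      have lp: "lp_le c (\<lambda>j. if M < z i j then X i j else 0) (K * (C1 * (C2 * (M + 1) powr c) ^ (CARD('d) - 1)))"
        unfolding z_def
        by (rule lp_le_shifted_coordinate[OF c(1) T C1(2) C2(2)[OF M] _ X0 le]) (simp_all add: K_def)
      have le: "K * (C1 * (C2 * (M + 1) powr c) ^ (CARD('d) - 1)) \<le> C * sparse_rate d c a g T n"
      proof -
        have "K * (C1 * (C2 * (M + 1) powr c) ^ (CARD('d) - 1))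
          = C1 * C2 ^ (CARD('d) - 1) * (K * (M + 1) powr (c * (d - 1)))"
          using M d(2) by (simp add: power_mult_distrib powr_powr powr_realpow[symmetric] mult_ac)
        also have "\<dots> \<le> C1 * C2 ^ (CARD('d) - 1) * (K * ((2 - T) * real n) powr (c * (d - 1)))"
        proof (intro mult_left_mono powr_mono2)
          show "0 \<le> c * (d - 1)" using c(1) d(1) by simp
          show "0 \<le> M + 1" using M by simp
          show "M + 1 \<le> (2 - T) * real n" using n by (simp add: M_def algebra_simps)
          show "0 \<le> K" by (simp add: K_def)
          show "0 \<le> C1 * C2 ^ (CARD('d) - 1)" using C1(1) C2(1) by simp
        qed
        also have "\<dots> = C * (K * real n powr ((d - 1) * c))"
          using T by (simp add: C_def powr_mult mult_ac)
        finally have le: "K * (C1 * (C2 * (M + 1) powr c) ^ (CARD('d) - 1)) \<le> C * (K * real n powr ((d - 1) * c))" .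
        have "K = 2 powr (- (a - g - (a * T - g) * ((d - 1) / (d - T))) * real n)"
        proof -
          have dT: "d - T \<noteq> 0" using dT0 by simp
          have q: "(d - 1) / (d - T) = 1 - (1 - T) / (d - T)"
            using dT by (simp add: field_simps)
          have "a * M + (a * T - g) * (M / (d - T)) = (a - g - (a * T - g) * ((d - 1) / (d - T))) * real n"
            unfolding q M_def by (simp add: algebra_simps)
          then show ?thesis unfolding K_def by (simp only: minus_mult_left)
        qed
        then have "sparse_rate d c a g T n = K * real n powr ((d - 1) * c)"
          unfolding sparse_rate_def using True by (simp only: if_True)
        with le show ?thesis by (simp only:)
      qed
      show ?thesis
        unfolding M_def[symmetric] by (rule lp_le_mono[OF lp _ _ le c(1)]) (use X0 in auto)
    qed
    moreover have "C > 0" using C1 C2 T by (simp add: C_def)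
    ultimately show ?thesis by blast
  next
    case False
    \<comment> \<open>The multiple \<open>l1\<close> of \<open>(1 - T) * vmax j + S\<close> uses up
      the whole coefficient \<open>a - g\<close> of the maximum. It leaves \<open>b = a - l1\<close>
      for the other coordinates, positive exactly because \<open>T < g / a\<close>; so these decay
      from 0 on and no power of n appears.\<close>
    define l1 where "l1 = (a - g) / (1 - T)"
    define b where "b = (g - a * T) / (1 - T)"
    have l1: "0 < l1" using g T by (simp add: l1_def)
    have b: "0 < b" using False a T by (simp add: b_def pos_le_divide_eq pos_divide_le_eq not_le mult.commute)
    have "l1 + b = a * (1 - T) / (1 - T)"
      by (simp add: l1_def b_def right_diff_distrib flip: add_divide_distrib)
    then have l1b: "l1 * (1 - T) = a - g" "l1 + b = a"
      using T by (simp_all add: l1_def)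
    obtain C1 where C1: "C1 > 0" "lp_le c (\<lambda>h::nat. 2 powr (- (a - g) * real h)) C1"
      using lp_le_geometric[OF c(1), of "a - g"] g by auto
    obtain C2 where C2: "C2 > 0" "lp_le c (\<lambda>u::nat. 2 powr (- b * real u)) C2"
      using lp_le_geometric[OF c(1) b] by blast
    define C where "C = C1 * C2 ^ (CARD('d) - 1)"
    have "lp_le c (\<lambda>j. if (1 - T) * real n < z i j then X i j else 0) (C * sparse_rate d c a g T n)"
      if n: "1 \<le> n" for n i
    proof -
      define M where "M = (1 - T) * real n"
      define K where "K = 2 powr (- (a - g) * real n)"
      have le: "X i j \<le> K * (2 powr (- (a - g) * real h) * (\<Prod>i'\<in>-{i}. 2 powr (- b * real (j $ i'))))"
        if zM: "M < (1 - T) * real (j $ i) + (\<Sum>i'\<in>-{i}. real (j $ i'))"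
          and h: "(1 - T) * real h \<le> (1 - T) * real (j $ i) + (\<Sum>i'\<in>-{i}. real (j $ i')) - M" for j h
      proof (cases "real (j $ i) = vmax j")
        case False
        then show ?thesis by (simp add: X_def K_def prod_nonneg)
      next
        case True
        define S where "S = (\<Sum>i'\<in>-{i}. real (j $ i'))"
        have "(1 - T) * (real n + real h) \<le> (1 - T) * vmax j + S"
          using h unfolding True S_def[symmetric] M_def by (simp add: algebra_simps)
        then have "l1 * ((1 - T) * (real n + real h)) \<le> l1 * ((1 - T) * vmax j + S)"
          using l1 by (intro mult_left_mono) auto
        then have "(a - g) * (real n + real h) \<le> (a - g) * vmax j + l1 * S"
          by (simp only: distrib_left mult.assoc[symmetric] l1b)
        moreover have "a * vsum j - g * vmax j = (a - g) * vmax j + (l1 + b) * S"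
          unfolding vsum_split[of j i] True S_def[symmetric] l1b by (simp add: algebra_simps)
        ultimately have "- (a * vsum j - g * vmax j) \<le> - (a - g) * real n + (- (a - g) * real h + - b * S)"
          by (simp add: algebra_simps)
        also have "- b * S = (\<Sum>i'\<in>-{i}. - b * real (j $ i'))" by (simp add: S_def sum_distrib_left)
        finally have "X i j \<le> 2 powr (- (a - g) * real n + (- (a - g) * real h + (\<Sum>i'\<in>-{i}. - b * real (j $ i'))))"
          unfolding X_def using True by simp
        also have "\<dots> = K * (2 powr (- (a - g) * real h) * (\<Prod>i'\<in>-{i}. 2 powr (- b * real (j $ i'))))"
          unfolding K_def powr_add by (subst powr_sum) auto
        finally show ?thesis .
      qed
      have X0: "0 \<le> X i j" for j by (simp add: X_def)
      have "lp_le c (\<lambda>j. if M < z i j then X i j else 0) (K * (C1 * C2 ^ (CARD('d) - 1)))"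
        unfolding z_def
        by (rule lp_le_shifted_coordinate[OF c(1) T C1(2) C2(2) _ X0 le]) (simp_all add: K_def)
      then show ?thesis
        using False by (simp add: M_def K_def C_def sparse_rate_def mult.commute)
    qed
    moreover have "C > 0" using C1 C2 by (simp add: C_def)
    ultimately show ?thesis by blast
  qed
  then obtain C where C: "C > 0" "\<And>n i. n \<ge> 1 \<Longrightarrow>
      lp_le c (\<lambda>j. if (1 - T) * real n < z i j then X i j else 0) (C * sparse_rate d c a g T n)" by blast
  have "lp_le c (\<lambda>j :: nat ^ 'd. if j \<in> Delta n T then 0 else 2 powr (- (a * vsum j - g * vmax j)))
      (d * C * sparse_rate d c a g T n)" if n: "n \<ge> 1" for n
  proof -
    \<comment> \<open>Every level outside the grid is caught by a coordinate attaining its maximum;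
      adding over the coordinates costs the factor \<open>d\<close>.\<close>
    have "lp_le c (\<lambda>j. \<Sum>i\<in>UNIV. if (1 - T) * real n < z i j then X i j else 0)
       (\<Sum>i\<in>(UNIV :: 'd set). C * sparse_rate d c a g T n)"
      by (rule lp_le_sum) (use C(2)[OF n] c in auto)
    then show ?thesis
    proof (rule lp_le_mono)
      fix j :: "nat ^ 'd"
      obtain i where i: "real (j $ i) = vmax j" using vmax_attained by blast
      show "(if j \<in> Delta n T then 0 else 2 powr (- (a * vsum j - g * vmax j)))
         \<le> (\<Sum>i\<in>UNIV. if (1 - T) * real n < z i j then X i j else 0)"
      proof (cases "j \<in> Delta n T")
        case True
        then show ?thesis by (simp add: X_def sum_nonneg)
      next
        case False
        then have "(1 - T) * real n < z i j" unfolding zmax[OF i] by (simp add: Delta_iff)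
        then have "2 powr (- (a * vsum j - g * vmax j)) = (if (1 - T) * real n < z i j then X i j else 0)"
          using i by (simp add: X_def)
        also have "\<dots> \<le> (\<Sum>i\<in>UNIV. if (1 - T) * real n < z i j then X i j else 0)"
          by (rule member_le_sum) (auto simp: X_def)
        finally show ?thesis using False by simp
      qed
    qed (use c in \<open>auto simp: d_def\<close>)
  qed
  then show ?thesis using C(1) d0 unfolding d_def[symmetric] by (intro exI[of _ "d * C"]) auto
qed

section \<open>Tensor products of the kernels\<close>

definition hybrid_weight :: "real \<Rightarrow> real \<Rightarrow> int ^ 'd::finite \<Rightarrow> real" where
  "hybrid_weight \<alpha> \<beta> k = (\<Prod>i\<in>UNIV. (1 + \<bar>real_of_int (k $ i)\<bar>) powr \<alpha>) * (1 + norm (real_vec k)) powr \<beta>"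

lemma hybrid_weight_pos: "0 < hybrid_weight \<alpha> \<beta> k"
proof -
  have "0 < 1 + norm (real_vec k)" by (rule add_pos_nonneg) auto
  then show ?thesis by (auto simp: hybrid_weight_def intro!: prod_pos mult_pos_pos)
qed

lemma real_vec_component: "real_vec k $ i = real_of_int (k $ i)"
  by (simp add: real_vec_def)

lemma norm_real_vec_ge: "\<bar>real_of_int (k $ i)\<bar> \<le> norm (real_vec k)"
  using component_le_norm_cart[of "real_vec k" i] by (simp add: real_vec_component)

lemma norm_real_vec_le:
  fixes k :: "int ^ 'd::finite"
  assumes "\<And>i. \<bar>real_of_int (k $ i)\<bar> \<le> b"
  shows "norm (real_vec k) \<le> real CARD('d) * b"
proof -
  have "norm (real_vec k) \<le> (\<Sum>i\<in>UNIV. \<bar>real_vec k $ i\<bar>)" by (rule norm_le_l1_cart)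
  also have "\<dots> \<le> real CARD('d) * b"
    using sum_bounded_above[of UNIV "\<lambda>i. \<bar>real_vec k $ i\<bar>" b] assms by (simp add: real_vec_component)
  finally show ?thesis .
qed

lemma weight_mult: "weight A B r * weight A' B' r = weight (A + A') (B + B') r"
  by (simp add: weight_def flip: powr_add)

lemma weight_ge:
  assumes "0 < r" "A \<le> x" "x \<le> B" shows "r powr - x \<le> weight A B r"
  using assms powr_mono[of "- x" "- A" r] powr_mono'[of "- B" "- x" r] by (auto simp: weight_def)

text \<open>The isotropic factor is charged to one coordinate. For \<beta> \<ge> 0 it is one where
  \<open>j\<close> is maximal, since the norm dominates each component; for \<beta> < 0 it is one
  where \<open>k\<close> is largest, since the norm is at most d times that component. That
  coordinate then carries the exponent \<alpha> + \<beta> and the others \<alpha>, and the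
  two-regime weight dominates both.\<close>

lemma inverse_hybrid_weight_le:
  fixes k :: "int ^ 'd::finite" and j :: "nat ^ 'd"
  shows "1 / hybrid_weight \<alpha> \<beta> k \<le> real CARD('d) powr \<bar>\<beta>\<bar> * 2 powr (- (\<alpha> * vsum j + \<beta> * vmax j)) *
     (\<Prod>i\<in>UNIV. weight (min \<alpha> (\<alpha> + \<beta>)) (max \<alpha> (\<alpha> + \<beta>)) (rho (j $ i) (k $ i)))"
proof -
  define d where "d = real CARD('d)"
  have d: "1 \<le> d" by (auto simp: d_def Suc_leI)
  have d1: "1 \<le> d powr \<bar>\<beta>\<bar>" using d by (intro ge_one_powr_ge_zero) auto
  have rho2: "1 + \<bar>real_of_int (k $ i)\<bar> = 2 ^ (j $ i) * rho (j $ i) (k $ i)" for i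
    by (simp add: rho_def)
  have "\<exists>i. (1 + norm (real_vec k)) powr - \<beta> \<le> d powr \<bar>\<beta>\<bar> * (2 powr (- \<beta> * vmax j) * rho (j $ i) (k $ i) powr - \<beta>)"
  proof (cases "0 \<le> \<beta>")
    case True
    obtain i where i: "real (j $ i) = vmax j" using vmax_attained by blast
    have "(1 + norm (real_vec k)) powr - \<beta> \<le> (1 + \<bar>real_of_int (k $ i)\<bar>) powr - \<beta>"
      using norm_real_vec_ge[of k i] True by (intro powr_mono2') auto
    also have "\<dots> = 1 * (2 powr (- \<beta> * vmax j) * rho (j $ i) (k $ i) powr - \<beta>)"
      unfolding rho2 i[symmetric] by (simp add: powr_mult powr_realpow[symmetric] powr_powr mult.commute)
    also have "\<dots> \<le> d powr \<bar>\<beta>\<bar> * (2 powr (- \<beta> * vmax j) * rho (j $ i) (k $ i) powr - \<beta>)"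
      using d1 by (intro mult_right_mono) auto
    finally show ?thesis by blast
  next
    case False
    define b where "b = Max (range (\<lambda>i. \<bar>real_of_int (k $ i)\<bar>))"
    have "b \<in> range (\<lambda>i. \<bar>real_of_int (k $ i)\<bar>)" unfolding b_def by (intro Max_in) auto
    then obtain i where i: "b = \<bar>real_of_int (k $ i)\<bar>" by blast
    have "\<bar>real_of_int (k $ i)\<bar> \<le> b" for i unfolding b_def by (intro Max_ge) auto
    then have "norm (real_vec k) \<le> d * b" unfolding d_def by (rule norm_real_vec_le)
    then have "1 + norm (real_vec k) \<le> d * (1 + b)" using d by (simp add: algebra_simps)
    also have "\<dots> = d * (2 powr (real (j $ i)) * rho (j $ i) (k $ i))"
      unfolding i rho2 by (simp add: powr_realpow)
    also have "\<dots> \<le> d * (2 powr vmax j * rho (j $ i) (k $ i))"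
      using d vmax_ge[of j i] by (intro mult_left_mono mult_right_mono) auto
    finally have "(1 + norm (real_vec k)) powr - \<beta> \<le> (d * (2 powr vmax j * rho (j $ i) (k $ i))) powr - \<beta>"
      using False by (intro powr_mono2) auto
    also have "\<dots> = d powr \<bar>\<beta>\<bar> * (2 powr (- \<beta> * vmax j) * rho (j $ i) (k $ i) powr - \<beta>)"
      using False by (simp add: powr_mult powr_powr mult.commute)
    finally show ?thesis by blast
  qed
  then obtain i where i: "(1 + norm (real_vec k)) powr - \<beta> \<le>
      d powr \<bar>\<beta>\<bar> * (2 powr (- \<beta> * vmax j) * rho (j $ i) (k $ i) powr - \<beta>)" by blast
  have prod: "(\<Prod>i\<in>UNIV. (1 + \<bar>real_of_int (k $ i)\<bar>) powr - \<alpha>)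
      = 2 powr (- \<alpha> * vsum j) * (\<Prod>i\<in>UNIV. rho (j $ i) (k $ i) powr - \<alpha>)"
  proof -
    have "(1 + \<bar>real_of_int (k $ i)\<bar>) powr - \<alpha> = 2 powr (- \<alpha> * real (j $ i)) * rho (j $ i) (k $ i) powr - \<alpha>" for i
      unfolding rho2 by (simp add: powr_mult powr_realpow[symmetric] powr_powr mult.commute)
    moreover have "- \<alpha> * vsum j = (\<Sum>i\<in>UNIV. - \<alpha> * real (j $ i))"
      by (simp add: vsum_def sum_distrib_left)
    then have "2 powr (- \<alpha> * vsum j) = (\<Prod>i\<in>UNIV. 2 powr (- \<alpha> * real (j $ i)))"
      by (simp only:) (rule powr_sum, simp)
    ultimately show ?thesis by (simp add: prod.distrib)
  qed
  have "1 / hybrid_weight \<alpha> \<beta> k = (\<Prod>i\<in>UNIV. (1 + \<bar>real_of_int (k $ i)\<bar>) powr - \<alpha>) * (1 + norm (real_vec k)) powr - \<beta>"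
    by (simp add: hybrid_weight_def powr_minus_divide prod_dividef)
  also have "\<dots> \<le> (2 powr (- \<alpha> * vsum j) * (\<Prod>i\<in>UNIV. rho (j $ i) (k $ i) powr - \<alpha>)) *
      (d powr \<bar>\<beta>\<bar> * (2 powr (- \<beta> * vmax j) * rho (j $ i) (k $ i) powr - \<beta>))"
    unfolding prod by (intro mult_left_mono i mult_nonneg_nonneg prod_nonneg) auto
  also have "\<dots> = d powr \<bar>\<beta>\<bar> * 2 powr (- (\<alpha> * vsum j + \<beta> * vmax j)) *
      ((\<Prod>i\<in>UNIV. rho (j $ i) (k $ i) powr - \<alpha>) * rho (j $ i) (k $ i) powr - \<beta>)"
    by (simp add: powr_diff powr_minus powr_add field_simps)
  also have "\<dots> \<le> d powr \<bar>\<beta>\<bar> * 2 powr (- (\<alpha> * vsum j + \<beta> * vmax j)) *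
     (\<Prod>i\<in>UNIV. weight (min \<alpha> (\<alpha> + \<beta>)) (max \<alpha> (\<alpha> + \<beta>)) (rho (j $ i) (k $ i)))"
  proof (intro mult_left_mono)
    let ?w = "weight (min \<alpha> (\<alpha> + \<beta>)) (max \<alpha> (\<alpha> + \<beta>))"
    have "(\<Prod>i\<in>UNIV. rho (j $ i) (k $ i) powr - \<alpha>) * rho (j $ i) (k $ i) powr - \<beta>
       = rho (j $ i) (k $ i) powr - (\<alpha> + \<beta>) * (\<Prod>i\<in>UNIV - {i}. rho (j $ i) (k $ i) powr - \<alpha>)"
      by (subst prod.remove[of _ i]) (auto simp: powr_add[symmetric] mult_ac)
    also have "\<dots> \<le> ?w (rho (j $ i) (k $ i)) * (\<Prod>i\<in>UNIV - {i}. ?w (rho (j $ i) (k $ i)))"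
      by (intro mult_mono prod_mono conjI weight_ge prod_nonneg weight_rho_nonneg) auto
    also have "\<dots> = (\<Prod>i\<in>UNIV. ?w (rho (j $ i) (k $ i)))"
      by (rule prod.remove[symmetric]) auto
    finally show "(\<Prod>i\<in>UNIV. rho (j $ i) (k $ i) powr - \<alpha>) * rho (j $ i) (k $ i) powr - \<beta>
       \<le> (\<Prod>i\<in>UNIV. ?w (rho (j $ i) (k $ i)))" .
  qed auto
  finally show ?thesis by (simp add: d_def)
qed

section \<open>Localisation of a sequence around a level\<close>

definition decay :: "real \<Rightarrow> nat ^ 'd::finite \<Rightarrow> int ^ 'd \<Rightarrow> real" where
  "decay \<epsilon> j k = (\<Prod>i\<in>UNIV. min (rho (j $ i) (k $ i)) (1 / rho (j $ i) (k $ i)) powr \<epsilon>)"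

lemma decay_nonneg: "0 \<le> decay \<epsilon> j k"
  by (simp add: decay_def prod_nonneg)

lemma decay_le_1: assumes "0 \<le> \<epsilon>" shows "decay \<epsilon> j k \<le> 1"
proof -
  have "min (rho j k) (1 / rho j k) powr \<epsilon> \<le> 1" for j k
  proof -
    have "min (rho j k) (1 / rho j k) \<le> 1" by (cases "rho j k \<le> 1") (auto simp: min_le_iff_disj)
    then show ?thesis using powr_mono2[OF assms, of "min (rho j k) (1 / rho j k)" 1] by simp
  qed
  then show ?thesis unfolding decay_def by (intro prod_le_1) auto
qed

lemma infsum_finite_sum:
  fixes f :: "'a \<Rightarrow> 'b \<Rightarrow> 'c :: real_normed_vector"
  assumes "finite J" "\<And>j. j \<in> J \<Longrightarrow> f j summable_on A"
  shows "infsum (\<lambda>k. \<Sum>j\<in>J. f j k) A = (\<Sum>j\<in>J. infsum (f j) A)"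
    and "(\<lambda>k. \<Sum>j\<in>J. f j k) summable_on A"
proof -
  have "((\<lambda>k. \<Sum>j\<in>J. f j k) has_sum (\<Sum>j\<in>J. infsum (f j) A)) A"
    using assms by (induction J rule: finite_induct) (auto intro: has_sum_add)
  then show "infsum (\<lambda>k. \<Sum>j\<in>J. f j k) A = (\<Sum>j\<in>J. infsum (f j) A)"
    "(\<lambda>k. \<Sum>j\<in>J. f j k) summable_on A" by (auto simp: infsumI has_sum_imp_summable)
qed

text \<open>Each frequency is charged essentially to the levels \<open>j\<close> with \<open>2\<^sup>j\<close> comparable to it, so the localised
  norms \<open>M j\<close> are again bounded in the same sequence space.\<close>

lemma lp_le_decay:
  assumes a: "0 \<le> a" "a \<le> 1" and e: "0 < \<epsilon>"
  shows "\<exists>C>0. \<forall>(x :: int ^ 'd::finite \<Rightarrow> real) H. lp_le a x H \<longrightarrow>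
    (\<exists>M. (\<forall>j. lp_le a (\<lambda>k. decay \<epsilon> j k * x k) (M j)) \<and> lp_le a M (C * H))"
proof (cases "a = 0")
  case True
  show ?thesis
  proof (intro exI[of _ "1 :: real"] conjI allI impI)
    fix x :: "int ^ 'd \<Rightarrow> real" and H assume x: "lp_le a x H"
    have "lp_le a (\<lambda>k. decay \<epsilon> j k * x k) H" for j
      using e by (intro lp_le_mono[OF x _ _ _ a(1)] mult_nonneg_nonneg decay_nonneg lp_le_nonneg[OF x] mult_left_le_one_le decay_le_1) auto
    moreover have "lp_le a (\<lambda>j. H) (1 * H)"
      using True lp_le_bound_nonneg[OF x] by (simp add: lp_le_0_iff)
    ultimately show "\<exists>M. (\<forall>j. lp_le a (\<lambda>k. decay \<epsilon> j k * x k) (M j)) \<and> lp_le a M (1 * H)"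
      by (intro exI[of _ "\<lambda>j. H"]) blast
  qed simp
next
  case False
  obtain C where C: "C > 0" "\<And>k. lp_le a (\<lambda>j. min (rho j k) (1 / rho j k) powr \<epsilon>) C"
    using lp_le_min_rho[OF a e] by blast
  have dec: "lp_le a (\<lambda>j. decay \<epsilon> j k) (C ^ CARD('d))" for k :: "int ^ 'd"
    unfolding decay_def
    using lp_le_vec_prod[of a "\<lambda>i j. min (rho j (k $ i)) (1 / rho j (k $ i)) powr \<epsilon>" "\<lambda>_. C"] C(2) a by simp
  show ?thesis
  proof (intro exI[of _ "C ^ CARD('d)"] conjI allI impI)
    show "0 < C ^ CARD('d)" using C by simp
    fix x :: "int ^ 'd \<Rightarrow> real" and H assume x: "lp_le a x H"
    note nn = lp_le_nonneg[OF x] lp_le_bound_nonneg[OF x]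
    have x1: "lp_le 1 (\<lambda>k. x k powr (1 / a)) (H powr (1 / a))"
      using lp_le_sumD[OF x False] by (auto simp: lp_le_def)
    then have smx: "(\<lambda>k. x k powr (1 / a)) summable_on UNIV" by (simp add: lp_le_1_iff)
    define f where "f j k = (decay \<epsilon> j k * x k) powr (1 / a)" for j :: "nat ^ 'd" and k
    have sm: "f j summable_on UNIV" for j
    proof (rule summable_on_comparison_test[OF smx])
      show "f j k \<le> x k powr (1 / a)" for k
        unfolding f_def using e a nn
        by (intro powr_mono2 mult_left_le_one_le decay_le_1 decay_nonneg mult_nonneg_nonneg) auto
    qed (simp add: f_def)
    \<comment> \<open>\<open>M j\<close> is the exact norm of the localised sequence. Its power is
      therefore a sum over \<open>k\<close>, which can be exchanged with the sum over levels before
      the summability of the localisation factors in \<open>j\<close> is applied.\<close>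
    define M where "M j = (\<Sum>\<^sub>\<infinity>k. f j k) powr a" for j
    have S0: "0 \<le> (\<Sum>\<^sub>\<infinity>k. f j k)" for j by (intro infsum_nonneg) (simp add: f_def)
    have M: "M j powr (1 / a) = (\<Sum>\<^sub>\<infinity>k. f j k)" for j
      using S0[of j] False by (simp add: M_def powr_powr)
    have "lp_le a (\<lambda>k. decay \<epsilon> j k * x k) (M j)" for j
    proof (rule lp_leI)
      show "(\<Sum>k\<in>F. (decay \<epsilon> j k * x k) powr (1 / a)) \<le> M j powr (1 / a)" if "finite F" for F
        using finite_sum_le_infsum[OF sm that, of j] unfolding M by (simp add: f_def)
    qed (use False nn in \<open>auto simp: M_def intro!: mult_nonneg_nonneg decay_nonneg\<close>)
    moreover have "lp_le a M (C ^ CARD('d) * H)"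
    proof (rule lp_leI)
      fix J :: "(nat ^ 'd) set" assume J: "finite J"
      have "(\<Sum>j\<in>J. M j powr (1 / a)) = (\<Sum>\<^sub>\<infinity>k. \<Sum>j\<in>J. f j k)"
        unfolding M using infsum_finite_sum[OF J sm] by simp
      also have "\<dots> \<le> (\<Sum>\<^sub>\<infinity>k. (C ^ CARD('d)) powr (1 / a) * x k powr (1 / a))"
      proof (intro infsum_mono infsum_finite_sum[OF J sm] summable_on_cmult_right smx)
        fix k
        have "(\<Sum>j\<in>J. f j k) = (\<Sum>j\<in>J. decay \<epsilon> j k powr (1 / a)) * x k powr (1 / a)"
          by (simp add: f_def powr_mult sum_distrib_right)
        also have "\<dots> \<le> (C ^ CARD('d)) powr (1 / a) * x k powr (1 / a)"
          by (intro mult_right_mono lp_le_sumD[OF dec False J]) auto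
        finally show "(\<Sum>j\<in>J. f j k) \<le> (C ^ CARD('d)) powr (1 / a) * x k powr (1 / a)" .
      qed
      also have "\<dots> = (C ^ CARD('d)) powr (1 / a) * (\<Sum>\<^sub>\<infinity>k. x k powr (1 / a))"
        by (rule infsum_cmult_right) (use smx in simp)
      also have "\<dots> \<le> (C ^ CARD('d)) powr (1 / a) * H powr (1 / a)"
        using x1 by (intro mult_left_mono) (auto simp: lp_le_1_iff)
      also have "\<dots> = (C ^ CARD('d) * H) powr (1 / a)" by (simp add: powr_mult)
      finally show "(\<Sum>j\<in>J. M j powr (1 / a)) \<le> (C ^ CARD('d) * H) powr (1 / a)" .
    qed (use False C nn in \<open>auto simp: M_def\<close>)
    ultimately show "\<exists>M. (\<forall>j. lp_le a (\<lambda>k. decay \<epsilon> j k * x k) (M j)) \<and> lp_le a M (C ^ CARD('d) * H)"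
      by blast
  qed
qed

section \<open>Norm estimates for the tensor product kernel\<close>

context quasi_kernel
begin

definition tensor_dk :: "nat ^ 'd::finite \<Rightarrow> int ^ 'd \<Rightarrow> int ^ 'd \<Rightarrow> complex" where
  "tensor_dk j l k = (\<Prod>i\<in>UNIV. dk (j $ i) (l $ i) (k $ i))"

lemma tensor_dk_support: "tensor_dk j l k \<noteq> 0 \<Longrightarrow> l $ i \<in> D (j $ i)"
  unfolding tensor_dk_def using dk_support by (metis UNIV_I finite prod_zero)

lemma tensor_dk_columns: "lp_le 1 (\<lambda>l. if tensor_dk j l k \<noteq> 0 then 1 else 0) (2 ^ CARD('d))"
  for j :: "nat ^ 'd::finite"
proof -
  have "lp_le 1 (\<lambda>l. \<Prod>i\<in>UNIV. if dk (j $ i) (l $ i) (k $ i) \<noteq> 0 then 1 else 0) (\<Prod>i\<in>(UNIV :: 'd set). 2)"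
    by (intro lp_le_vec_prod dk_columns) simp
  also have "(\<lambda>l. \<Prod>i\<in>UNIV. if dk (j $ i) (l $ i) (k $ i) \<noteq> 0 then 1 else 0) = (\<lambda>l. if tensor_dk j l k \<noteq> 0 then 1 else 0 :: real)"
  proof
    fix l
    show "(\<Prod>i\<in>UNIV. if dk (j $ i) (l $ i) (k $ i) \<noteq> 0 then 1 else 0) = (if tensor_dk j l k \<noteq> 0 then 1 else 0 :: real)"
    proof (cases "tensor_dk j l k = 0")
      case True
      then obtain i where "dk (j $ i) (l $ i) (k $ i) = 0" by (auto simp: tensor_dk_def)
      then have "(\<Prod>i\<in>UNIV. if dk (j $ i) (l $ i) (k $ i) \<noteq> 0 then 1 else 0 :: real) = 0"
        by (intro prod_zero) auto
      then show ?thesis using True by simp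
    next
      case False
      then have "dk (j $ i) (l $ i) (k $ i) \<noteq> 0" for i by (auto simp: tensor_dk_def)
      then show ?thesis using False by simp
    qed
  qed
  finally show ?thesis by simp
qed

text \<open>The inverse hybrid weight is split: the part with exponents \<open>A\<close>,
  \<open>B\<close> stays with the kernel and makes its rows bounded, and the remainder is handed to
  \<open>x\<close>. The parameter \<open>a\<close> is left open because it is the reciprocal of p in
  one alternative and of q in the other.\<close>

lemma tensor_dk_kernel_bound:
  fixes j :: "nat ^ 'd::finite"
  assumes a: "0 \<le> a" "a \<le> 1" and R: "0 \<le> R"
    and rows: "\<And>j l. lp_le (1 - a) (\<lambda>k. cmod (dk j l k) * weight A B (rho j k)) R"
    and y: "lp_le a (\<lambda>k. (\<Prod>i\<in>UNIV. weight (min \<alpha> (\<alpha> + \<beta>) - A) (max \<alpha> (\<alpha> + \<beta>) - B) (rho (j $ i) (k $ i))) * x k) M"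
    and x: "\<And>k. 0 \<le> x k"
  shows "(\<lambda>k. cmod (tensor_dk j l k) * (x k / hybrid_weight \<alpha> \<beta> k)) summable_on UNIV"
    and "lp_le a (\<lambda>l. \<Sum>\<^sub>\<infinity>k. cmod (tensor_dk j l k) * (x k / hybrid_weight \<alpha> \<beta> k))
       (real CARD('d) powr \<bar>\<beta>\<bar> * R ^ CARD('d) * (2 ^ CARD('d)) powr a
        * 2 powr (- (\<alpha> * vsum j + \<beta> * vmax j)) * M)"
proof -
  define y where "y k = (\<Prod>i\<in>UNIV. weight (min \<alpha> (\<alpha> + \<beta>) - A) (max \<alpha> (\<alpha> + \<beta>) - B) (rho (j $ i) (k $ i))) * x k" for k
  define G where "G l k = (\<Prod>i\<in>UNIV. cmod (dk (j $ i) (l $ i) (k $ i)) * weight A B (rho (j $ i) (k $ i)))" for l k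
  define c where "c = real CARD('d) powr \<bar>\<beta>\<bar> * 2 powr (- (\<alpha> * vsum j + \<beta> * vmax j))"
  have c: "0 \<le> c" by (simp add: c_def)
  have rowsG: "lp_le (1 - a) (G l) (R ^ CARD('d))" for l
    unfolding G_def
    using lp_le_vec_prod[of "1 - a" "\<lambda>i k. cmod (dk (j $ i) (l $ i) k) * weight A B (rho (j $ i) k)" "\<lambda>_. R"] rows a
    by simp
  have colsG: "lp_le 1 (\<lambda>l. if G l k \<noteq> 0 then 1 else 0) (2 ^ CARD('d))" for k
  proof (rule lp_le_mono[OF tensor_dk_columns[of j k]])
    fix l
    have "G l k = 0" if "tensor_dk j l k = 0"
      using that by (auto simp: tensor_dk_def G_def)
    then show "(if G l k \<noteq> 0 then 1 else 0) \<le> (if tensor_dk j l k \<noteq> 0 then 1 else 0 :: real)" by auto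
  qed auto
  note K = lp_le_kernel[OF rowsG colsG y[folded y_def] a _ _]
  have le: "cmod (tensor_dk j l k) * (x k / hybrid_weight \<alpha> \<beta> k) \<le> c * (G l k * y k)" for l k
  proof -
    let ?w = "weight (min \<alpha> (\<alpha> + \<beta>)) (max \<alpha> (\<alpha> + \<beta>))"
    have "cmod (tensor_dk j l k) * (x k * (1 / hybrid_weight \<alpha> \<beta> k)) \<le> cmod (tensor_dk j l k) * (x k * (c * (\<Prod>i\<in>UNIV. ?w (rho (j $ i) (k $ i)))))"
      unfolding c_def by (intro mult_left_mono inverse_hybrid_weight_le x) auto
    also have "?w r = weight A B r * weight (min \<alpha> (\<alpha> + \<beta>) - A) (max \<alpha> (\<alpha> + \<beta>) - B) r" for r
      by (simp add: weight_mult)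
    then have "cmod (tensor_dk j l k) * (x k * (c * (\<Prod>i\<in>UNIV. ?w (rho (j $ i) (k $ i))))) = c * (G l k * y k)"
      by (simp add: G_def y_def tensor_dk_def prod_norm[symmetric] prod.distrib mult_ac)
    finally show ?thesis by simp
  qed
  have sm: "(\<lambda>k. c * (G l k * y k)) summable_on UNIV" for l
    using K(1)[of l] R by (intro summable_on_cmult_right) auto
  have nn: "0 \<le> cmod (tensor_dk j l k) * (x k / hybrid_weight \<alpha> \<beta> k)" for l k
    using x hybrid_weight_pos[of \<alpha> \<beta> k] by simp
  show sm': "(\<lambda>k. cmod (tensor_dk j l k) * (x k / hybrid_weight \<alpha> \<beta> k)) summable_on UNIV" for l
    by (rule summable_on_comparison_test[OF sm le nn])
  have "lp_le a (\<lambda>l. c * (\<Sum>\<^sub>\<infinity>k. G l k * y k)) (c * (R ^ CARD('d) * (2 ^ CARD('d)) powr a * M))"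
    using K(2) R c by (intro lp_le_scale) auto
  then have "lp_le a (\<lambda>l. \<Sum>\<^sub>\<infinity>k. cmod (tensor_dk j l k) * (x k / hybrid_weight \<alpha> \<beta> k)) (c * (R ^ CARD('d) * (2 ^ CARD('d)) powr a * M))"
  proof (rule lp_le_mono)
    fix l
    show "0 \<le> (\<Sum>\<^sub>\<infinity>k. cmod (tensor_dk j l k) * (x k / hybrid_weight \<alpha> \<beta> k))" by (intro infsum_nonneg nn)
    have "(\<Sum>\<^sub>\<infinity>k. cmod (tensor_dk j l k) * (x k / hybrid_weight \<alpha> \<beta> k)) \<le> (\<Sum>\<^sub>\<infinity>k. c * (G l k * y k))"
      by (intro infsum_mono sm sm' le)
    also have "\<dots> = c * (\<Sum>\<^sub>\<infinity>k. G l k * y k)"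
      using K(1)[of l] R by (intro infsum_cmult_right) auto
    finally show "(\<Sum>\<^sub>\<infinity>k. cmod (tensor_dk j l k) * (x k / hybrid_weight \<alpha> \<beta> k)) \<le> c * (\<Sum>\<^sub>\<infinity>k. G l k * y k)" .
  qed (use a in auto)
  then show "lp_le a (\<lambda>l. \<Sum>\<^sub>\<infinity>k. cmod (tensor_dk j l k) * (x k / hybrid_weight \<alpha> \<beta> k))
       (real CARD('d) powr \<bar>\<beta>\<bar> * R ^ CARD('d) * (2 ^ CARD('d)) powr a
        * 2 powr (- (\<alpha> * vsum j + \<beta> * vmax j)) * M)"
    by (simp add: c_def mult_ac)
qed

end

lemma powr_vsum_prod: "(\<Prod>i\<in>UNIV. C * 2 powr (c * real (j $ i))) = C ^ CARD('d) * 2 powr (c * vsum j)"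
  for j :: "nat ^ 'd::finite"
proof -
  have "2 powr (c * vsum j) = 2 powr (\<Sum>i\<in>UNIV. c * real (j $ i))"
    by (simp add: vsum_def sum_distrib_left)
  also have "\<dots> = (\<Prod>i\<in>UNIV. 2 powr (c * real (j $ i)))" by (rule powr_sum) simp
  finally show ?thesis by (simp add: prod.distrib)
qed

lemma weight_min:
  assumes "0 < r" shows "weight e (- e) r = min r (1 / r) powr e"
proof (cases "1 \<le> r")
  case True
  then have "1 / r \<le> r" using order_trans[of "1 / r" 1 r] by simp
  then have "min r (1 / r) = 1 / r" by simp
  then show ?thesis using True by (simp add: weight_def powr_divide powr_minus_divide)
next
  case False
  then have "r \<le> 1 / r" using assms order_trans[of r 1 "1 / r"] by simp
  then have "min r (1 / r) = r" by simp
  then show ?thesis using False by (simp add: weight_def)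
qed

text \<open>The share of the weight left to the input: the first factor pays for lowering the
  exponent, the second is the localisation around the level.\<close>

lemma weight_min_max:
  assumes "0 < r" shows "weight (e + t) (- e) r = max 1 r powr - t * min r (1 / r) powr e"
proof -
  have "weight (e + t) (- e) r = weight t 0 r * weight e (- e) r" by (simp add: weight_mult add.commute)
  also have "weight t 0 r = max 1 r powr - t" using assms by (auto simp: weight_def max_def)
  finally show ?thesis using assms by (simp add: weight_min)
qed

context quasi_kernel
begin

text \<open>In the first alternative the kernel acts on l_p and Holder's inequality with the
  indicator of the output box, of \<open>2 powr vsum j\<close> elements, lowers the exponent
  afterwards. In the second the kernel acts on l_q, and the factors
  \<open>max 1 (rho j k) powr - \<theta>\<close> lower the exponent beforehand. Both cost
  \<open>2 powr (\<sigma> * vsum j)\<close>. When q is at least p, \<sigma> vanishes and the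
  embedding does the rest.\<close>

lemma tensor_dk_bound:
  assumes p: "0 \<le> ip" "ip \<le> 1" and q: "0 \<le> iq" "iq \<le> 1" and \<sigma>: "\<sigma> = max 0 (iq - ip)"
    and s2: "max \<alpha> (\<alpha> + \<beta>) < s" and s1: "\<sigma> < min \<alpha> (\<alpha> + \<beta>)"
    and alt: "N + (1 - ip) < min \<alpha> (\<alpha> + \<beta>) \<or>
      (\<exists>K. \<forall>j. \<forall>l\<in>D j. lp_le (1 - iq) (\<lambda>\<mu>. cmod (Q j (l + 2 ^ j * \<mu>))) K)"
  shows "\<exists>\<epsilon>>0. \<exists>C>0. \<forall>(j :: nat ^ 'd::finite) x M. (\<forall>k. 0 \<le> x k) \<longrightarrow>
    lp_le ip (\<lambda>k. decay \<epsilon> j k * x k) M \<longrightarrow>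
    (\<forall>l. (\<lambda>k. cmod (tensor_dk j l k) * (x k / hybrid_weight \<alpha> \<beta> k)) summable_on UNIV) \<and>
    lp_le iq (\<lambda>l. \<Sum>\<^sub>\<infinity>k. cmod (tensor_dk j l k) * (x k / hybrid_weight \<alpha> \<beta> k))
      (C * 2 powr (- ((\<alpha> - \<sigma>) * vsum j + \<beta> * vmax j)) * M)"
proof -
  define \<alpha>1 where "\<alpha>1 = min \<alpha> (\<alpha> + \<beta>)"
  define \<alpha>2 where "\<alpha>2 = max \<alpha> (\<alpha> + \<beta>)"
  have \<sigma>0: "0 \<le> \<sigma>" "iq \<le> \<sigma> + ip" using \<sigma> by auto
  have a12: "0 < \<alpha>1" "\<alpha>1 \<le> \<alpha>2" "\<alpha>2 < s" "\<sigma> < \<alpha>1" using s1 s2 \<sigma>0 by (auto simp: \<alpha>1_def \<alpha>2_def)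
  have pow: "2 powr (- (\<alpha> * vsum j + \<beta> * vmax j)) * 2 powr (\<sigma> * vsum j)
      = 2 powr (- ((\<alpha> - \<sigma>) * vsum j + \<beta> * vmax j))" for j :: "nat ^ 'd"
    by (simp add: algebra_simps flip: powr_add)
  from alt show ?thesis
  proof
    assume i: "N + (1 - ip) < min \<alpha> (\<alpha> + \<beta>)"
    \<comment> \<open>The first bound keeps the diagonal exponent
      \<open>\<alpha>2 + \<epsilon>\<close> below \<open>s\<close>; the second preserves the strict
      decay condition of the rows after \<open>\<epsilon>\<close> has been given away for
      localisation.\<close>
    define \<epsilon> where "\<epsilon> = min (s - \<alpha>2) ((\<alpha>1 - N - (1 - ip)) / 2)"
    have e: "0 < \<epsilon>" "\<epsilon> \<le> s - \<alpha>2" "\<epsilon> < \<alpha>1 - N - (1 - ip)"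
      using a12 i[folded \<alpha>1_def] by (auto simp: \<epsilon>_def min_def)
    have AB: "0 \<le> \<alpha>1 - \<epsilon>" "0 \<le> \<alpha>2 + \<epsilon>" "\<alpha>2 + \<epsilon> \<le> s" "1 - ip < \<alpha>1 - \<epsilon> - N"
      using e a12 p N by auto
    obtain R where R: "R \<ge> 0"
      "\<And>j l. lp_le (1 - ip) (\<lambda>k. cmod (dk j l k) * weight (\<alpha>1 - \<epsilon>) (\<alpha>2 + \<epsilon>) (rho j k)) R"
      using dk_rows[of "1 - ip" "\<alpha>1 - \<epsilon>" "\<alpha>2 + \<epsilon>"] AB p by auto
    define C where "C = real CARD('d) powr \<bar>\<beta>\<bar> * R ^ CARD('d) * (2 ^ CARD('d)) powr ip"
    have C: "0 \<le> C" using R by (simp add: C_def)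
    have "(\<forall>l. (\<lambda>k. cmod (tensor_dk j l k) * (x k / hybrid_weight \<alpha> \<beta> k)) summable_on UNIV) \<and>
      lp_le iq (\<lambda>l. \<Sum>\<^sub>\<infinity>k. cmod (tensor_dk j l k) * (x k / hybrid_weight \<alpha> \<beta> k))
        ((C + 1) * 2 powr (- ((\<alpha> - \<sigma>) * vsum j + \<beta> * vmax j)) * M)"
      if x: "\<forall>k. 0 \<le> x k" and xM: "lp_le ip (\<lambda>k. decay \<epsilon> j k * x k) M" for j :: "nat ^ 'd" and x M
    proof (intro conjI allI)
      have y: "lp_le ip (\<lambda>k. (\<Prod>i\<in>UNIV. weight (min \<alpha> (\<alpha> + \<beta>) - (\<alpha>1 - \<epsilon>)) (max \<alpha> (\<alpha> + \<beta>) - (\<alpha>2 + \<epsilon>)) (rho (j $ i) (k $ i))) * x k) M"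
        using xM by (simp add: \<alpha>1_def[symmetric] \<alpha>2_def[symmetric] weight_min decay_def)
      note V = tensor_dk_kernel_bound[OF p R y spec[OF x]]
      show "(\<lambda>k. cmod (tensor_dk j l k) * (x k / hybrid_weight \<alpha> \<beta> k)) summable_on UNIV" for l by (rule V(1))
      define X where "X l = (\<Sum>\<^sub>\<infinity>k. cmod (tensor_dk j l k) * (x k / hybrid_weight \<alpha> \<beta> k))" for l
      define I where "I l = (\<Prod>i\<in>UNIV. if l $ i \<in> D (j $ i) then 1 else 0 :: real)" for l
      have "lp_le \<sigma> (\<lambda>k. if k \<in> D (j $ i) then 1 else 0) ((2 ^ (j $ i)) powr \<sigma>)" for i
        by (rule lp_le_indicator) (use \<sigma>0 in \<open>auto simp: card_D\<close>)
      then have "lp_le \<sigma> (\<lambda>k. if k \<in> D (j $ i) then 1 else 0) (1 * 2 powr (\<sigma> * real (j $ i)))" for i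
        by (simp add: powr_realpow[symmetric] powr_powr mult.commute)
      then have "lp_le \<sigma> I (\<Prod>i\<in>UNIV. 1 * 2 powr (\<sigma> * real (j $ i)))"
        unfolding I_def by (intro lp_le_vec_prod \<sigma>0)
      then have I: "lp_le \<sigma> I (2 powr (\<sigma> * vsum j))" unfolding powr_vsum_prod by simp
      have X: "lp_le ip X (C * 2 powr (- (\<alpha> * vsum j + \<beta> * vmax j)) * M)"
        using V(2) unfolding X_def C_def .
      have "I l * X l = X l" for l
      proof (cases "\<forall>i. l $ i \<in> D (j $ i)")
        case True
        then show ?thesis by (simp add: I_def)
      next
        case False
        then have "tensor_dk j l k = 0" for k using tensor_dk_support by blast
        then show ?thesis by (simp add: X_def)
      qed
      then have IX: "(\<lambda>l. I l * X l) = X" by blast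
      have "lp_le (\<sigma> + ip) X (2 powr (\<sigma> * vsum j) * (C * 2 powr (- (\<alpha> * vsum j + \<beta> * vmax j)) * M))"
        using lp_le_Holder[OF I X \<sigma>0(1) p(1)] unfolding IX .
      from lp_le_embed[OF this q(1) \<sigma>0(2)]
      have lp: "lp_le iq X (C * 2 powr (- ((\<alpha> - \<sigma>) * vsum j + \<beta> * vmax j)) * M)"
        unfolding pow[symmetric] by (simp add: mult_ac)
      \<comment> \<open>\<open>C\<close> vanishes if the row bound \<open>R\<close> does;
        \<open>C + 1\<close> provides the positive constant.\<close>
      show "lp_le iq X ((C + 1) * 2 powr (- ((\<alpha> - \<sigma>) * vsum j + \<beta> * vmax j)) * M)"
        by (rule lp_le_mono[OF lp lp_le_nonneg[OF lp] order_refl _ q(1)])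
          (intro mult_right_mono lp_le_bound_nonneg[OF xM], auto)
    qed
    then show ?thesis using e(1) C by (intro exI[of _ \<epsilon>] conjI exI[of _ "C + 1"]) auto
  next
    assume ii: "\<exists>K. \<forall>j. \<forall>l\<in>D j. lp_le (1 - iq) (\<lambda>\<mu>. cmod (Q j (l + 2 ^ j * \<mu>))) K"
    \<comment> \<open>The input takes \<open>\<epsilon>\<close> for localisation and
      \<open>\<theta> = \<sigma> + \<epsilon>\<close> for the change of exponent, where \<theta> >
      \<sigma> is what makes the decay summable. The halving leaves the nonnegative exponent
      \<open>\<alpha>1 - \<sigma> - 2 * \<epsilon>\<close> for the kernel.\<close>
    define \<epsilon> where "\<epsilon> = min (s - \<alpha>2) ((\<alpha>1 - \<sigma>) / 2)"
    have e: "0 < \<epsilon>" "\<epsilon> \<le> s - \<alpha>2" "2 * \<epsilon> \<le> \<alpha>1 - \<sigma>"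
      using a12 by (auto simp: \<epsilon>_def min_def)
    define \<theta> where "\<theta> = \<sigma> + \<epsilon>"
    have AB: "0 \<le> \<alpha>1 - (\<epsilon> + \<theta>)" "0 \<le> \<alpha>2 + \<epsilon>" "\<alpha>2 + \<epsilon> \<le> s"
      using e a12 by (auto simp: \<theta>_def)
    obtain R where R: "R \<ge> 0"
      "\<And>j l. lp_le (1 - iq) (\<lambda>k. cmod (dk j l k) * weight (\<alpha>1 - (\<epsilon> + \<theta>)) (\<alpha>2 + \<epsilon>) (rho j k)) R"
      using dk_rows[of "1 - iq" "\<alpha>1 - (\<epsilon> + \<theta>)" "\<alpha>2 + \<epsilon>"] AB q ii by auto
    obtain C4 where C4: "C4 > 0" "\<And>j. lp_le \<sigma> (\<lambda>k. max 1 (rho j k) powr - \<theta>) (C4 * 2 powr (\<sigma> * real j))"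
      using lp_le_max_rho[of \<sigma> \<theta>] \<sigma>0 e by (auto simp: \<theta>_def)
    define C where "C = real CARD('d) powr \<bar>\<beta>\<bar> * R ^ CARD('d) * (2 ^ CARD('d)) powr iq * C4 ^ CARD('d)"
    have C: "0 \<le> C" using R C4 by (simp add: C_def)
    have "(\<forall>l. (\<lambda>k. cmod (tensor_dk j l k) * (x k / hybrid_weight \<alpha> \<beta> k)) summable_on UNIV) \<and>
      lp_le iq (\<lambda>l. \<Sum>\<^sub>\<infinity>k. cmod (tensor_dk j l k) * (x k / hybrid_weight \<alpha> \<beta> k))
        ((C + 1) * 2 powr (- ((\<alpha> - \<sigma>) * vsum j + \<beta> * vmax j)) * M)"
      if x: "\<forall>k. 0 \<le> x k" and xM: "lp_le ip (\<lambda>k. decay \<epsilon> j k * x k) M" for j :: "nat ^ 'd" and x M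
    proof (intro conjI allI)
      have "lp_le \<sigma> (\<lambda>k. \<Prod>i\<in>UNIV. max 1 (rho (j $ i) (k $ i)) powr - \<theta>) (\<Prod>i\<in>UNIV. C4 * 2 powr (\<sigma> * real (j $ i)))"
        by (intro lp_le_vec_prod C4 \<sigma>0)
      from lp_le_embed[OF lp_le_Holder[OF this xM \<sigma>0(1) p(1)] q(1) \<sigma>0(2)]
      have "lp_le iq (\<lambda>k. (\<Prod>i\<in>UNIV. max 1 (rho (j $ i) (k $ i)) powr - \<theta>) * (decay \<epsilon> j k * x k))
        (C4 ^ CARD('d) * 2 powr (\<sigma> * vsum j) * M)"
        unfolding powr_vsum_prod .
      then have y: "lp_le iq (\<lambda>k. (\<Prod>i\<in>UNIV. weight (min \<alpha> (\<alpha> + \<beta>) - (\<alpha>1 - (\<epsilon> + \<theta>))) (max \<alpha> (\<alpha> + \<beta>) - (\<alpha>2 + \<epsilon>)) (rho (j $ i) (k $ i))) * x k)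
         (C4 ^ CARD('d) * 2 powr (\<sigma> * vsum j) * M)"
        by (simp add: \<alpha>1_def[symmetric] \<alpha>2_def[symmetric] weight_min_max decay_def prod.distrib mult.assoc)
      note V = tensor_dk_kernel_bound[OF q R y spec[OF x]]
      show "(\<lambda>k. cmod (tensor_dk j l k) * (x k / hybrid_weight \<alpha> \<beta> k)) summable_on UNIV" for l by (rule V(1))
      have lp: "lp_le iq (\<lambda>l. \<Sum>\<^sub>\<infinity>k. cmod (tensor_dk j l k) * (x k / hybrid_weight \<alpha> \<beta> k))
          (C * 2 powr (- ((\<alpha> - \<sigma>) * vsum j + \<beta> * vmax j)) * M)"
        using V(2) unfolding pow[symmetric] C_def by (simp only: mult_ac)
      show "lp_le iq (\<lambda>l. \<Sum>\<^sub>\<infinity>k. cmod (tensor_dk j l k) * (x k / hybrid_weight \<alpha> \<beta> k))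
          ((C + 1) * 2 powr (- ((\<alpha> - \<sigma>) * vsum j + \<beta> * vmax j)) * M)"
        by (rule lp_le_mono[OF lp lp_le_nonneg[OF lp] order_refl _ q(1)])
          (intro mult_right_mono lp_le_bound_nonneg[OF xM], auto)
    qed
    then show ?thesis using e(1) C by (intro exI[of _ \<epsilon>] conjI exI[of _ "C + 1"]) auto
  qed
qed

section \<open>Reproduction of coefficients and the error estimate\<close>

lemma infsum_tensor_dk: "(\<Sum>\<^sub>\<infinity>j. tensor_dk j l k) = (if k = l then 1 else 0)"
proof -
  have "(\<Sum>\<^sub>\<infinity>j. tensor_dk j l k) = (\<Sum>\<^sub>\<infinity>g\<in>PiE UNIV (\<lambda>i. UNIV). \<Prod>i\<in>UNIV. dk (g i) (l $ i) (k $ i))"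
    using infsum_reindex_bij_betw[OF bij_betw_vec_PiE[of "\<lambda>_. UNIV"],
      of "\<lambda>g. \<Prod>i\<in>UNIV. dk (g i) (l $ i) (k $ i)"]
    by (simp add: tensor_dk_def)
  also have "\<dots> = (\<Prod>i\<in>UNIV. \<Sum>\<^sub>\<infinity>j. dk j (l $ i) (k $ i))"
    by (rule infsum_prod_PiE_abs) (auto intro: dk_abs_summable)
  also have "\<dots> = (\<Prod>i\<in>UNIV. if k $ i = l $ i then 1 else 0)" by (simp add: infsum_dk)
  also have "\<dots> = (if k = l then 1 else 0)"
    by (auto simp: vec_eq_iff intro: prod_zero)
  finally show ?thesis .
qed

text \<open>Absolute summability over pairs of a level and a frequency allows the two sums to be
  exchanged; the sum over levels is then the identity matrix.\<close>

lemma infsum_tensor_dk_coefficients: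
  fixes c :: "int ^ 'd::finite \<Rightarrow> complex"
  assumes sm: "\<And>j. (\<lambda>k. cmod (tensor_dk j l k * c k)) summable_on UNIV"
    and smE: "(\<lambda>j. \<Sum>\<^sub>\<infinity>k. cmod (tensor_dk j l k * c k)) summable_on UNIV"
  shows "(\<Sum>\<^sub>\<infinity>j. \<Sum>\<^sub>\<infinity>k. tensor_dk j l k * c k) = c l"
proof -
  have "(\<lambda>z. norm (case z of (j, k) \<Rightarrow> tensor_dk j l k * c k)) summable_on (UNIV \<times> UNIV)"
    using Infinite_Sum.abs_summable_on_Sigma_iff[of "\<lambda>(j, k). tensor_dk j l k * c k" UNIV "\<lambda>_. UNIV"] sm smE
    by (simp add: infsum_nonneg)
  then have "(\<lambda>(j, k). tensor_dk j l k * c k) summable_on (UNIV \<times> UNIV)"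
    by (rule abs_summable_summable)
  then have "(\<Sum>\<^sub>\<infinity>j. \<Sum>\<^sub>\<infinity>k. tensor_dk j l k * c k) = (\<Sum>\<^sub>\<infinity>k. \<Sum>\<^sub>\<infinity>j. tensor_dk j l k * c k)"
    by (rule infsum_swap_banach)
  also have "\<dots> = (\<Sum>\<^sub>\<infinity>k. (if k = l then 1 else 0) * c k)"
    by (simp add: infsum_cmult_left' infsum_tensor_dk)
  also have "\<dots> = (\<Sum>\<^sub>\<infinity>k\<in>{l}. (if k = l then 1 else 0) * c k)"
    by (rule infsum_cong_neutral) auto
  finally show ?thesis by simp
qed

text \<open>The error is the tail of the reproducing series over levels outside the grid.
  Minkowski's inequality bounds its norm by the sum of the norms of the differences, and Holder's
  inequality pairs the exponential factors in the dual space with the localised norms of the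
  coefficients.\<close>

lemma approx_error:
  assumes p: "0 \<le> ip" "ip \<le> 1" and q: "0 \<le> iq" "iq \<le> 1" and \<sigma>: "\<sigma> = max 0 (iq - ip)"
    and s2: "max \<alpha> (\<alpha> + \<beta>) < s" and \<alpha>: "\<sigma> < \<alpha>"
    and alt: "N + (1 - ip) < min \<alpha> (\<alpha> + \<beta>) \<or>
      (\<exists>K. \<forall>j. \<forall>l\<in>D j. lp_le (1 - iq) (\<lambda>\<mu>. cmod (Q j (l + 2 ^ j * \<mu>))) K)"
    and \<gamma>: "0 \<le> \<gamma>" "\<gamma> - \<beta> < \<alpha> - \<sigma>" and T: "T < 1"
  shows "\<exists>C>0. \<forall>(c :: int ^ 'd::finite \<Rightarrow> complex) H. lp_le ip (\<lambda>k. hybrid_weight \<alpha> \<beta> k * cmod (c k)) H \<longrightarrow>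
    (\<forall>j l. (\<lambda>k. cmod (tensor_dk j l k * c k)) summable_on UNIV) \<and>
    (\<forall>n\<ge>1. lp_le iq (\<lambda>l. (1 + norm (real_vec l)) powr \<gamma> *
        cmod (c l - (\<Sum>j\<in>Delta n T. \<Sum>\<^sub>\<infinity>k. tensor_dk j l k * c k)))
      (C * sparse_rate (real CARD('d)) (1 - ip) (\<alpha> - \<sigma>) (\<gamma> - \<beta>) T n * H))"
proof -
  have \<sigma>0: "0 \<le> \<sigma>" using \<sigma> by simp
  \<comment> \<open>The part for \<alpha> + \<beta> follows from \<alpha> + \<beta> > \<gamma> +
    \<sigma> together with \<gamma> \<ge> 0.\<close>
  have s1: "\<sigma> < min \<alpha> (\<alpha> + \<beta>)" using \<alpha> \<gamma> by simp
  obtain \<epsilon> C1 where e: "0 < \<epsilon>" and C1: "C1 > 0" and V: "\<And>(j :: nat ^ 'd) x M. (\<forall>k. 0 \<le> x k) \<Longrightarrow>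
    lp_le ip (\<lambda>k. decay \<epsilon> j k * x k) M \<Longrightarrow>
    (\<forall>l. (\<lambda>k. cmod (tensor_dk j l k) * (x k / hybrid_weight \<alpha> \<beta> k)) summable_on UNIV) \<and>
    lp_le iq (\<lambda>l. \<Sum>\<^sub>\<infinity>k. cmod (tensor_dk j l k) * (x k / hybrid_weight \<alpha> \<beta> k))
      (C1 * 2 powr (- ((\<alpha> - \<sigma>) * vsum j + \<beta> * vmax j)) * M)"
    using tensor_dk_bound[OF p q \<sigma> s2 s1 alt, where 'd = 'd] by blast
  obtain C2 where C2: "C2 > 0" and Dec: "\<And>(x :: int ^ 'd \<Rightarrow> real) H. lp_le ip x H \<Longrightarrow>
    (\<exists>M. (\<forall>j. lp_le ip (\<lambda>k. decay \<epsilon> j k * x k) (M j)) \<and> lp_le ip M (C2 * H))"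
    using lp_le_decay[OF p e, where 'd = 'd] by blast
  define B where "B j = 2 powr (- ((\<alpha> - \<sigma>) * vsum j - (\<gamma> - \<beta>) * vmax j))" for j :: "nat ^ 'd"
  have c01: "0 \<le> 1 - ip" "1 - ip \<le> 1" using p by auto
  obtain C3 where C3: "C3 > 0" and Rate: "\<And>n. n \<ge> 1 \<Longrightarrow>
      lp_le (1 - ip) (\<lambda>j :: nat ^ 'd. if j \<in> Delta n T then 0 else B j)
        (C3 * sparse_rate (real CARD('d)) (1 - ip) (\<alpha> - \<sigma>) (\<gamma> - \<beta>) T n)"
    using lp_le_outside_Delta[OF c01 _ \<gamma>(2) T, where 'd = 'd] \<alpha> unfolding B_def by auto
  define C0 where "C0 = (1 + real CARD('d)) powr \<gamma> * C1"
  have C0: "C0 > 0" using C1 by (simp add: C0_def)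
  define C where "C = C0 * C3 * C2"
  show ?thesis
  proof (intro exI[of _ C] conjI allI impI)
    show "0 < C" using C0 C2 C3 by (simp add: C_def)
  next
    fix c :: "int ^ 'd \<Rightarrow> complex" and H
    assume H: "lp_le ip (\<lambda>k. hybrid_weight \<alpha> \<beta> k * cmod (c k)) H"
    obtain M where M: "\<And>j. lp_le ip (\<lambda>k. decay \<epsilon> j k * (hybrid_weight \<alpha> \<beta> k * cmod (c k))) (M j)" "lp_le ip M (C2 * H)"
      using Dec[OF H] by blast
    have M0: "0 \<le> M j" for j by (rule lp_le_nonneg[OF M(2)])
    have eq: "cmod (tensor_dk j l k) * (hybrid_weight \<alpha> \<beta> k * cmod (c k) / hybrid_weight \<alpha> \<beta> k) = cmod (tensor_dk j l k * c k)" for j l k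
      using hybrid_weight_pos[of \<alpha> \<beta> k] by (simp add: norm_mult)
    define E where "E j l = (\<Sum>\<^sub>\<infinity>k. cmod (tensor_dk j l k * c k))" for j l
    have nn: "\<forall>k. 0 \<le> hybrid_weight \<alpha> \<beta> k * cmod (c k)" using lp_le_nonneg[OF H] by blast
    have sm: "(\<lambda>k. cmod (tensor_dk j l k * c k)) summable_on UNIV" for j l
      using V[OF nn M(1)] unfolding eq by blast
    have E: "lp_le iq (E j) (C1 * 2 powr (- ((\<alpha> - \<sigma>) * vsum j + \<beta> * vmax j)) * M j)" for j
      using V[OF nn M(1)] unfolding eq E_def by blast
    have E0: "0 \<le> E j l" for j l by (rule lp_le_nonneg[OF E])
    define w where "w l = (1 + norm (real_vec l)) powr \<gamma>" for l :: "int ^ 'd"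
    have w0: "0 < w l" for l
      unfolding w_def powr_gt_zero by (smt (verit) norm_ge_zero)
    have wE: "lp_le iq (\<lambda>l. w l * E j l) (C0 * (B j * M j))" for j
    proof -
      \<comment> \<open>On the output box every component is at most \<open>2 powr vmax j\<close>,
        and \<gamma> is nonnegative, so the target weight is bounded by its size at the edge of the
        box. This brings in the exponent \<gamma> of the maximum.\<close>
      define b where "b = ((1 + real CARD('d)) * 2 powr vmax j) powr \<gamma>"
      have leb: "w l * E j l \<le> b * E j l" for l
      proof (cases "\<forall>i. l $ i \<in> D (j $ i)")
        case True
        have "\<bar>real_of_int (l $ i)\<bar> \<le> 2 powr vmax j" for i
        proof -
          have "\<bar>real_of_int (l $ i)\<bar> \<le> 2 ^ (j $ i) / 2" using True D_bound by blast
          also have "\<dots> \<le> 2 powr (real (j $ i))" by (simp add: powr_realpow)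
          also have "\<dots> \<le> 2 powr vmax j" using vmax_ge[of j i] by simp
          finally show ?thesis .
        qed
        then have "norm (real_vec l) \<le> real CARD('d) * 2 powr vmax j" by (rule norm_real_vec_le)
        moreover have "1 \<le> 2 powr vmax j" using vmax_nonneg[of j] ge_one_powr_ge_zero[of 2 "vmax j"] by simp
        ultimately have "1 + norm (real_vec l) \<le> (1 + real CARD('d)) * 2 powr vmax j"
          by (simp add: distrib_right)
        then have "w l \<le> b" unfolding w_def b_def using \<gamma>(1) by (intro powr_mono2) auto
        then show ?thesis using E0 by (rule mult_right_mono)
      next
        case False
        then have "tensor_dk j l k = 0" for k using tensor_dk_support by blast
        then show ?thesis by (simp add: E_def)
      qed
      have lpb: "lp_le iq (\<lambda>l. b * E j l) (b * (C1 * 2 powr (- ((\<alpha> - \<sigma>) * vsum j + \<beta> * vmax j)) * M j))"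
        by (rule lp_le_scale[OF E]) (simp add: b_def)
      have "b * (C1 * 2 powr (- ((\<alpha> - \<sigma>) * vsum j + \<beta> * vmax j)) * M j) = C0 * (B j * M j)"
      proof -
        have "b = (1 + real CARD('d)) powr \<gamma> * 2 powr (\<gamma> * vmax j)"
          by (simp add: b_def powr_mult powr_powr mult.commute)
        moreover have "2 powr (\<gamma> * vmax j) * 2 powr (- ((\<alpha> - \<sigma>) * vsum j + \<beta> * vmax j)) = B j"
          unfolding B_def by (simp add: algebra_simps flip: powr_add)
        ultimately show ?thesis by (simp add: C0_def mult_ac)
      qed
      from lpb[unfolded this] show ?thesis
        by (rule lp_le_mono[OF _ mult_nonneg_nonneg[OF less_imp_le[OF w0] E0] leb order_refl q(1)])
    qed
    show "(\<lambda>k. cmod (tensor_dk j l k * c k)) summable_on UNIV" for j l by (rule sm)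
    fix n :: nat assume n: "1 \<le> n"
    define r where "r = sparse_rate (real CARD('d)) (1 - ip) (\<alpha> - \<sigma>) (\<gamma> - \<beta>) T n"
    define \<Delta> where "\<Delta> = (Delta n T :: (nat ^ 'd) set)"
    have fin: "finite \<Delta>" unfolding \<Delta>_def by (rule finite_Delta[OF T])
    have "lp_le 1 (\<lambda>j. (if j \<in> \<Delta> then 0 else B j) * M j) (C3 * r * (C2 * H))"
      using lp_le_Holder[OF Rate[OF n] M(2) c01(1) p(1)] by (simp add: r_def \<Delta>_def)
    then have BM: "lp_le 1 (\<lambda>j. C0 * ((if j \<in> \<Delta> then 0 else B j) * M j)) (C0 * (C3 * r * (C2 * H)))"
      by (rule lp_le_scale) (use C0 in simp)
    have smw: "(\<lambda>j. w l * E j l) summable_on (- \<Delta>)" for l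
    proof -
      have "(\<lambda>j. C0 * ((if j \<in> \<Delta> then 0 else B j) * M j)) summable_on (- \<Delta>)"
        using BM by (auto simp: lp_le_1_iff intro: summable_on_subset_banach)
      then show ?thesis
      proof (rule summable_on_comparison_test)
        fix j assume "j \<in> - \<Delta>"
        then show "w l * E j l \<le> C0 * ((if j \<in> \<Delta> then 0 else B j) * M j)"
          using lp_le_pointwise[OF wE q(1)] by simp
      qed (rule mult_nonneg_nonneg[OF less_imp_le[OF w0] E0])
    qed
    \<comment> \<open>The weight is constant in \<open>j\<close> and positive, so it can be divided
      out; the finitely many levels of the grid are added back later to obtain summability over all
      levels.\<close>
    have smE: "(\<lambda>j. E j l) summable_on (- \<Delta>)" for l
      using summable_on_cmult_right[OF smw, of "1 / w l" l] w0[of l] by simp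
    have lp: "lp_le iq (\<lambda>l. \<Sum>\<^sub>\<infinity>j\<in>- \<Delta>. w l * E j l) (C0 * (C3 * r * (C2 * H)))"
    proof (rule lp_le_infsum[OF wE q smw])
      fix F assume F: "finite F" "F \<subseteq> - \<Delta>"
      have "(\<Sum>j\<in>F. C0 * (B j * M j)) = (\<Sum>j\<in>F. (C0 * ((if j \<in> \<Delta> then 0 else B j) * M j)) powr (1 / 1))"
        using F C0 M0 by (intro sum.cong) (auto simp: B_def)
      also have "\<dots> \<le> (C0 * (C3 * r * (C2 * H))) powr (1 / 1)"
        using lp_le_sumD[OF BM _ F(1)] by simp
      also have "\<dots> = C0 * (C3 * r * (C2 * H))" using lp_le_bound_nonneg[OF BM] by simp
      finally show "(\<Sum>j\<in>F. C0 * (B j * M j)) \<le> C0 * (C3 * r * (C2 * H))" .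
    qed
    have err: "w l * cmod (c l - (\<Sum>j\<in>\<Delta>. \<Sum>\<^sub>\<infinity>k. tensor_dk j l k * c k)) \<le> (\<Sum>\<^sub>\<infinity>j\<in>- \<Delta>. w l * E j l)" for l
    proof -
      define f where "f j = (\<Sum>\<^sub>\<infinity>k. tensor_dk j l k * c k)" for j
      have fE: "norm (f j) \<le> E j l" for j
        unfolding f_def E_def by (rule norm_infsum_bound[OF sm])
      have "(\<lambda>j. E j l) summable_on (- \<Delta> \<union> \<Delta>)"
        using fin smE by (intro summable_on_Un_disjoint) auto
      then have smU: "(\<lambda>j. E j l) summable_on UNIV" by simp
      have absf: "(\<lambda>j. norm (f j)) summable_on UNIV"
        by (rule summable_on_comparison_test[OF smU]) (use fE in auto)
      then have smf: "f summable_on UNIV" by (rule abs_summable_summable)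
      have "c l = infsum f UNIV"
        using infsum_tensor_dk_coefficients[OF sm] smU unfolding f_def E_def by simp
      also have "\<dots> = infsum f (\<Delta> \<union> - \<Delta>)" by simp
      also have "\<dots> = infsum f \<Delta> + infsum f (- \<Delta>)"
        using smf fin by (intro infsum_Un_disjoint) (auto intro: summable_on_subset_banach)
      finally have "c l - (\<Sum>j\<in>\<Delta>. f j) = infsum f (- \<Delta>)" using fin by simp
      then have "cmod (c l - (\<Sum>j\<in>\<Delta>. f j)) = norm (infsum f (- \<Delta>))" by simp
      also have "\<dots> \<le> (\<Sum>\<^sub>\<infinity>j\<in>- \<Delta>. norm (f j))"
        by (rule norm_infsum_bound) (use absf in \<open>auto intro: summable_on_subset_banach\<close>)
      also have "\<dots> \<le> (\<Sum>\<^sub>\<infinity>j\<in>- \<Delta>. E j l)"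
        using absf smE fE by (intro infsum_mono) (auto intro: summable_on_subset_banach)
      finally have "w l * cmod (c l - (\<Sum>j\<in>\<Delta>. f j)) \<le> w l * (\<Sum>\<^sub>\<infinity>j\<in>- \<Delta>. E j l)"
        using w0[of l] by (intro mult_left_mono) auto
      also have "\<dots> = (\<Sum>\<^sub>\<infinity>j\<in>- \<Delta>. w l * E j l)"
        by (rule infsum_cmult_right[symmetric]) (use smE in simp)
      finally show ?thesis by (simp add: f_def)
    qed
    have "lp_le iq (\<lambda>l. w l * cmod (c l - (\<Sum>j\<in>\<Delta>. \<Sum>\<^sub>\<infinity>k. tensor_dk j l k * c k))) (C * r * H)"
    proof (rule lp_le_mono[OF lp _ err _ q(1)])
      show "C0 * (C3 * r * (C2 * H)) \<le> C * r * H" by (simp add: C_def mult_ac)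
    qed (rule mult_nonneg_nonneg[OF less_imp_le[OF w0] norm_ge_zero])
    then show "lp_le iq (\<lambda>l. (1 + norm (real_vec l)) powr \<gamma> *
        cmod (c l - (\<Sum>j\<in>Delta n T. \<Sum>\<^sub>\<infinity>k. tensor_dk j l k * c k)))
      (C * sparse_rate (real CARD('d)) (1 - ip) (\<alpha> - \<sigma>) (\<gamma> - \<beta>) T n * H)"
      by (simp only: w_def \<Delta>_def r_def)
  qed
qed

end

section \<open>Fourier coefficients of the sparse grid operator\<close>

lemma integral_cis_period:
  "(LINT t|lborel. indicator {0..2 * pi} t *\<^sub>R cis (real_of_int m * t)) = (if m = 0 then 2 * pi else 0)"
proof (cases "m = 0")
  case True
  have "(LINT t|lborel. indicator {0..2 * pi} t *\<^sub>R (1 :: complex)) = of_real (2 * pi) - of_real 0"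
  proof (rule integral_FTC_Icc)
    show "((\<lambda>t. complex_of_real t) has_vector_derivative 1) (at x within {0..2 * pi})" for x
      by (auto intro!: derivative_eq_intros)
  qed (auto intro: continuous_intros)
  then show ?thesis using True by simp
next
  case False
  define F where "F t = cis (real_of_int m * t) / (\<i> * of_int m)" for t
  have "(LINT t|lborel. indicator {0..2 * pi} t *\<^sub>R cis (real_of_int m * t)) = F (2 * pi) - F 0"
  proof (rule integral_FTC_Icc)
    show "continuous_on {0..2 * pi} (\<lambda>t. cis (real_of_int m * t))" by (intro continuous_intros)
    fix x
    have "((\<lambda>z. exp (\<i> * of_int m * z) / (\<i> * of_int m)) has_field_derivative exp (\<i> * of_int m * of_real x))
      (at (of_real x))"
      using False by (auto intro!: derivative_eq_intros)
    from has_vector_derivative_real_field[OF this]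
    show "(F has_vector_derivative cis (real_of_int m * x)) (at x within {0..2 * pi})"
      by (simp add: F_def[abs_def] cis_conv_exp mult.assoc)
  qed simp
  also have "F (2 * pi) = F 0"
    using cis_multiple_2pi[of "real_of_int m"] by (simp add: F_def mult_ac)
  finally show ?thesis using False by simp
qed

text \<open>Including the indicator of the cube in the integrand makes it a product over the basis
  directions, so the integral over the product measure factors into one-dimensional ones.\<close>

lemma integral_cis_torus:
  fixes l :: "int ^ 'd::finite"
  shows "(LINT x:torus_cube|lebesgue. cis (real_vec l \<bullet> x)) = (if l = 0 then (2 * pi) ^ CARD('d) else 0)"
proof -
  define g where "g b t = indicator {0..2 * pi} t *\<^sub>R cis ((real_vec l \<bullet> b) * t)" for b :: "real ^ 'd" and t
  define f where "f x = indicator torus_cube x *\<^sub>R cis (real_vec l \<bullet> x)" for x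
  interpret product_sigma_finite "\<lambda>_ :: real ^ 'd. lborel :: real measure" ..
  have cont: "continuous_on UNIV (\<lambda>x. cis (real_vec l \<bullet> x))" by (intro continuous_intros)
  have fm [measurable]: "f \<in> borel_measurable borel"
    unfolding f_def torus_cube_def
    by (intro borel_measurable_scaleR borel_measurable_indicator borel_measurable_continuous_onI cont) auto
  have ftog: "f (\<Sum>b\<in>Basis. h b *\<^sub>R b) = (\<Prod>b\<in>Basis. g b (h b))" for h :: "real ^ 'd \<Rightarrow> real"
  proof -
    define x where "x = (\<Sum>b\<in>Basis. h b *\<^sub>R b)"
    have xb: "x \<bullet> b = h b" if "b \<in> Basis" for b using that by (simp add: x_def)
    have "(\<chi> i. 2 * pi) \<bullet> b = 2 * pi" if "b \<in> Basis" for b :: "real ^ 'd"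
      using that by (auto simp: Basis_vec_def inner_axis)
    then have mem: "x \<in> torus_cube \<longleftrightarrow> (\<forall>b\<in>Basis. h b \<in> {0..2 * pi})"
      using xb by (auto simp: torus_cube_def mem_box)
    have cis: "cis (real_vec l \<bullet> x) = (\<Prod>b\<in>Basis. cis ((real_vec l \<bullet> b) * h b))"
    proof -
      have "real_vec l \<bullet> x = (\<Sum>b\<in>Basis. (real_vec l \<bullet> b) * h b)"
        by (simp add: x_def inner_sum_right mult.commute)
      then show ?thesis by (simp add: cis_conv_exp exp_sum[symmetric] sum_distrib_left)
    qed
    show ?thesis
    proof (cases "x \<in> torus_cube")
      case True
      then have "g b (h b) = cis ((real_vec l \<bullet> b) * h b)" if "b \<in> Basis" for b
        using that mem by (auto simp: g_def indicator_def)
      then show ?thesis using True cis by (simp add: f_def x_def[symmetric])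
    next
      case False
      then obtain b where b: "b \<in> Basis" "h b \<notin> {0..2 * pi}" using mem by blast
      then have "g b (h b) = 0" by (simp add: g_def)
      then have "(\<Prod>b\<in>Basis. g b (h b)) = 0" using b by (intro prod_zero) auto
      then show ?thesis using False by (simp add: f_def x_def[symmetric])
    qed
  qed
  have gi: "integrable lborel (g b)" for b
    unfolding g_def set_integrable_def[symmetric]
    by (intro borel_integrable_atLeastAtMost' continuous_intros)
  have gb: "integral\<^sup>L lborel (g (axis i 1)) = (if l $ i = 0 then 2 * pi else 0)" for i
  proof -
    have "g (axis i 1) = (\<lambda>t. indicator {0..2 * pi} t *\<^sub>R cis (real_of_int (l $ i) * t))"
      by (simp add: g_def[abs_def] inner_axis real_vec_component)
    then show ?thesis using integral_cis_period[of "l $ i"] by (simp only:)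
  qed
  have "(LINT x:torus_cube|lebesgue. cis (real_vec l \<bullet> x)) = integral\<^sup>L lborel f"
    unfolding set_lebesgue_integral_def f_def[symmetric] by (rule integral_completion) simp
  also have "\<dots> = integral\<^sup>L (PiM Basis (\<lambda>_. lborel)) (\<lambda>h. f (\<Sum>b\<in>Basis. h b *\<^sub>R b))"
    by (subst lborel_eq) (rule integral_distr; measurable)
  also have "\<dots> = integral\<^sup>L (PiM Basis (\<lambda>_. lborel)) (\<lambda>h. \<Prod>b\<in>Basis. g b (h b))" by (simp add: ftog)
  also have "\<dots> = (\<Prod>b\<in>Basis. integral\<^sup>L lborel (g b))"
    by (rule product_integral_prod) (auto intro: gi)
  also have "\<dots> = (\<Prod>i\<in>UNIV. integral\<^sup>L lborel (g (axis i 1)))"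
  proof -
    have "inj (\<lambda>i. axis i 1 :: real ^ 'd)" by (auto simp: inj_def axis_eq_axis)
    moreover have "Basis = (\<lambda>i. axis i 1 :: real ^ 'd) ` UNIV" by (auto simp: Basis_vec_def)
    ultimately show ?thesis by (rule prod.reindex_cong) simp
  qed
  also have "\<dots> = (\<Prod>i\<in>UNIV. if l $ i = 0 then 2 * pi else 0)" by (simp add: gb)
  also have "\<dots> = (if l = 0 then (2 * pi) ^ CARD('d) else 0)"
    by (auto simp: vec_eq_iff intro: prod_zero)
  finally show ?thesis .
qed

lemma set_integrable_mult_cis:
  fixes f :: "real ^ 'd::finite \<Rightarrow> complex"
  assumes "set_integrable lebesgue S f"
  shows "set_integrable lebesgue S (\<lambda>x. f x * cis (v \<bullet> x))"
proof -
  have "(\<lambda>x. cis (v \<bullet> x)) \<in> borel_measurable borel"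
    by (intro borel_measurable_continuous_onI continuous_intros)
  then have "(\<lambda>x. cis (v \<bullet> x)) \<in> borel_measurable lborel" by simp
  then have "(\<lambda>x. cis (v \<bullet> x)) \<in> borel_measurable lebesgue" by (rule measurable_completion)
  then have "(\<lambda>x. (indicator S x *\<^sub>R f x) * cis (v \<bullet> x)) \<in> borel_measurable lebesgue"
    using assms unfolding set_integrable_def by (intro borel_measurable_times) auto
  then have "integrable lebesgue (\<lambda>x. (indicator S x *\<^sub>R f x) * cis (v \<bullet> x))"
    by (rule Bochner_Integration.integrable_bound[OF assms[unfolded set_integrable_def]])
      (simp add: norm_mult)
  then show ?thesis by (simp add: set_integrable_def)
qed

lemma set_integrable_cis: "set_integrable lebesgue torus_cube (\<lambda>x. cis (v \<bullet> x))"
  unfolding torus_cube_def by (intro absolutely_integrable_continuous continuous_intros)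

text \<open>The sparse grid operator produces a trigonometric polynomial, so orthogonality gives its
  coefficients exactly and integrability is all that is required of \<open>f\<close>.\<close>

lemma fourier_coeff_minus_trig:
  fixes f :: "real ^ 'd::finite \<Rightarrow> complex"
  assumes f: "f \<in> L1_torus" and B: "finite B"
  shows "fourier_coeff (\<lambda>x. f x - (\<Sum>l\<in>B. b l * cis (real_vec l \<bullet> x))) k
     = fourier_coeff f k - (if k \<in> B then b k else 0)"
proof -
  define e where "e x = cis (- (real_vec k \<bullet> x))" for x :: "real ^ 'd"
  have fi: "set_integrable lebesgue torus_cube (\<lambda>x. f x * e x)"
    using set_integrable_mult_cis[of torus_cube f "- real_vec k"] f by (simp add: L1_torus_def e_def)
  have prod: "cis (real_vec l \<bullet> x) * e x = cis (real_vec (l - k) \<bullet> x)" for l x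
  proof -
    have "real_vec (l - k) = real_vec l - real_vec k" by (simp add: real_vec_def vec_eq_iff)
    then show ?thesis by (simp add: e_def cis_mult inner_diff_left)
  qed
  have li: "set_integrable lebesgue torus_cube (\<lambda>x. b l * cis (real_vec (l - k) \<bullet> x))" for l
    by (intro set_integrable_mult_right) (rule set_integrable_cis)
  have "(\<lambda>x. (f x - (\<Sum>l\<in>B. b l * cis (real_vec l \<bullet> x))) * e x)
      = (\<lambda>x. f x * e x - (\<Sum>l\<in>B. b l * cis (real_vec (l - k) \<bullet> x)))"
    by (simp add: left_diff_distrib sum_distrib_right mult.assoc prod)
  then have "(LINT x:torus_cube|lebesgue. (f x - (\<Sum>l\<in>B. b l * cis (real_vec l \<bullet> x))) * e x)
      = (LINT x:torus_cube|lebesgue. f x * e x - (\<Sum>l\<in>B. b l * cis (real_vec (l - k) \<bullet> x)))" by simp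
  also have "\<dots> = (LINT x:torus_cube|lebesgue. f x * e x)
      - (LINT x:torus_cube|lebesgue. \<Sum>l\<in>B. b l * cis (real_vec (l - k) \<bullet> x))"
    using absolutely_integrable_sum[OF B li] fi by (intro set_integral_diff)
  also have "(LINT x:torus_cube|lebesgue. \<Sum>l\<in>B. b l * cis (real_vec (l - k) \<bullet> x))
      = (\<Sum>l\<in>B. LINT x:torus_cube|lebesgue. b l * cis (real_vec (l - k) \<bullet> x))"
    unfolding set_lebesgue_integral_def scaleR_sum_right
    by (rule Bochner_Integration.integral_sum) (use li in \<open>simp add: set_integrable_def\<close>)
  also have "\<dots> = (\<Sum>l\<in>B. if l = k then b k * (2 * pi) ^ CARD('d) else 0)"
    by (intro sum.cong refl) (simp add: integral_cis_torus)
  also have "\<dots> = (if k \<in> B then b k else 0) * (2 * pi) ^ CARD('d)" using B by simp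
  finally show ?thesis
    by (simp add: fourier_coeff_def e_def[symmetric] diff_divide_distrib)
qed

section \<open>Identification of the operators with their kernels\<close>

lemma D_mono: "j \<le> j' \<Longrightarrow> D j \<subseteq> D j'"
  by (rule lift_Suc_mono_le[of D, OF D_mono_Suc])

text \<open>The kernel row of \<open>l\<close> is supported on the aliases of \<open>l\<close>, so
  the sum over all \<open>k\<close> reindexes to the sum over \<mu>. Each rewriting also respects
  the default value 0 of a divergent sum, so no summability is assumed.\<close>

lemma quasi_prod_eq:
  fixes j :: "nat ^ 'd::finite" and f :: "real ^ 'd \<Rightarrow> complex"
    and \<phi> :: "nat \<Rightarrow> real \<Rightarrow> complex" and \<phi>t :: "nat \<Rightarrow> (real \<Rightarrow> complex) \<Rightarrow> complex"
  defines "P \<equiv> \<lambda>j l. fourier_coeff1 (\<phi> j) l" and "Q \<equiv> \<lambda>j k. dist_coeff (\<phi>t j) k"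
  shows "quasi_prod \<phi> \<phi>t (\<chi> i. int (j $ i)) f x =
    (\<Sum>l\<in>{l. \<forall>i. l $ i \<in> D (j $ i)}.
      (\<Sum>\<^sub>\<infinity>k. (\<Prod>i\<in>UNIV. mker P Q (j $ i) (l $ i) (k $ i)) * fourier_coeff f k) * cis (real_vec l \<bullet> x))"
proof -
  have key: "(\<Sum>\<^sub>\<infinity>k. (\<Prod>i\<in>UNIV. mker P Q (j $ i) (l $ i) (k $ i)) * fourier_coeff f k)
     = (\<Prod>i\<in>UNIV. P (j $ i) (l $ i)) * (\<Sum>\<^sub>\<infinity>\<mu> :: int ^ 'd. fourier_coeff f (\<chi> i. l $ i + 2 ^ (j $ i) * \<mu> $ i) *
           (\<Prod>i\<in>UNIV. Q (j $ i) (l $ i + 2 ^ (j $ i) * \<mu> $ i)))"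
    if l: "\<forall>i. l $ i \<in> D (j $ i)" for l :: "int ^ 'd"
  proof -
    define F where "F k = (\<Prod>i\<in>UNIV. mker P Q (j $ i) (l $ i) (k $ i)) * fourier_coeff f k" for k :: "int ^ 'd"
    define h where "h \<mu> = (\<chi> i. l $ i + 2 ^ (j $ i) * \<mu> $ i)" for \<mu> :: "int ^ 'd"
    have inj: "inj h" by (auto simp: inj_def h_def vec_eq_iff)
    have "F k = 0" if "k \<notin> range h" for k
    proof (rule ccontr)
      assume "F k \<noteq> 0"
      then have "mker P Q (j $ i) (l $ i) (k $ i) \<noteq> 0" for i by (auto simp: F_def)
      then have dv: "2 ^ (j $ i) dvd k $ i - l $ i" for i unfolding mker_def by metis
      have "k = h (\<chi> i. (k $ i - l $ i) div 2 ^ (j $ i))"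
        using dv by (auto simp: h_def vec_eq_iff)
      then show False using that by blast
    qed
    then have "infsum F UNIV = infsum F (range h)" by (intro infsum_cong_neutral) auto
    also have "\<dots> = infsum (F \<circ> h) UNIV" by (rule infsum_reindex[OF inj])
    also have "F \<circ> h = (\<lambda>\<mu>. (\<Prod>i\<in>UNIV. P (j $ i) (l $ i)) * (fourier_coeff f (h \<mu>) * (\<Prod>i\<in>UNIV. Q (j $ i) (h \<mu> $ i))))"
    proof
      fix \<mu>
      have "mker P Q (j $ i) (l $ i) (h \<mu> $ i) = P (j $ i) (l $ i) * Q (j $ i) (h \<mu> $ i)" for i
        using l by (simp add: mker_def h_def)
      then show "(F \<circ> h) \<mu> = (\<Prod>i\<in>UNIV. P (j $ i) (l $ i)) * (fourier_coeff f (h \<mu>) * (\<Prod>i\<in>UNIV. Q (j $ i) (h \<mu> $ i)))"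
        by (simp add: F_def prod.distrib)
    qed
    also have "infsum \<dots> UNIV = (\<Prod>i\<in>UNIV. P (j $ i) (l $ i)) * (\<Sum>\<^sub>\<infinity>\<mu>. fourier_coeff f (h \<mu>) * (\<Prod>i\<in>UNIV. Q (j $ i) (h \<mu> $ i)))"
      by (rule infsum_cmult_right')
    finally show ?thesis by (simp add: F_def h_def)
  qed
  have "quasi_prod \<phi> \<phi>t (\<chi> i. int (j $ i)) f x = (\<Sum>l\<in>{l. \<forall>i. l $ i \<in> D (j $ i)}.
     (\<Prod>i\<in>UNIV. P (j $ i) (l $ i)) * (\<Sum>\<^sub>\<infinity>\<mu> :: int ^ 'd. fourier_coeff f (\<chi> i. l $ i + 2 ^ (j $ i) * \<mu> $ i) *
           (\<Prod>i\<in>UNIV. Q (j $ i) (l $ i + 2 ^ (j $ i) * \<mu> $ i))) * cis (real_vec l \<bullet> x))"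
    by (simp add: quasi_prod_def P_def Q_def)
  also have "\<dots> = (\<Sum>l\<in>{l. \<forall>i. l $ i \<in> D (j $ i)}.
      (\<Sum>\<^sub>\<infinity>k. (\<Prod>i\<in>UNIV. mker P Q (j $ i) (l $ i) (k $ i)) * fourier_coeff f k) * cis (real_vec l \<bullet> x))"
    by (rule sum.cong[OF refl], drule CollectD, drule key, simp only:)
  finally show ?thesis .
qed

context quasi_kernel
begin

lemma prod_mk_eq_sum: "(\<Prod>i\<in>UNIV. mk (j $ i) (l $ i) (k $ i)) = (\<Sum>j'\<in>{v. \<forall>i. v $ i \<in> {..j $ i}}. tensor_dk j' l k)"
  for j :: "nat ^ 'd::finite"
  unfolding tensor_dk_def by (subst sum_vec_prod) (simp_all add: sum_dk)

text \<open>The estimates concern differences, whereas the operators are defined by full levels.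
  Telescoping in every coordinate writes a full level as a finite sum of differences and transfers
  summability.\<close>

lemma prod_mk_summable:
  fixes c :: "int ^ 'd::finite \<Rightarrow> complex"
  assumes sm: "\<And>j. (\<lambda>k. cmod (tensor_dk j l k * c k)) summable_on UNIV"
  shows "(\<lambda>k. (\<Prod>i\<in>UNIV. mk (j $ i) (l $ i) (k $ i)) * c k) summable_on UNIV"
  unfolding prod_mk_eq_sum sum_distrib_right
  by (intro infsum_finite_sum(2) finite_vec_box abs_summable_summable[OF sm]) simp

end

locale quasi_interpolation = quasi_kernel "\<lambda>j. fourier_coeff1 (\<phi> j)" "\<lambda>j. dist_coeff (\<phi>t j)" C0 N s
  for \<phi> :: "nat \<Rightarrow> real \<Rightarrow> complex" and \<phi>t :: "nat \<Rightarrow> (real \<Rightarrow> complex) \<Rightarrow> complex" and C0 N s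
begin

text \<open>The alternating sum over sets of coordinates is the expansion of a product of
  differences. The summability assumption lets it be pulled inside the infinite sum over
  \<open>k\<close>.\<close>

lemma eta_eq:
  fixes j :: "nat ^ 'd::finite" and f :: "real ^ 'd \<Rightarrow> complex"
  assumes sm: "\<And>j l. (\<lambda>k. cmod (tensor_dk j l k * fourier_coeff f k)) summable_on UNIV"
  shows "eta \<phi> \<phi>t j f x =
    (\<Sum>l\<in>{l. \<forall>i. l $ i \<in> D (j $ i)}. (\<Sum>\<^sub>\<infinity>k. tensor_dk j l k * fourier_coeff f k) * cis (real_vec l \<bullet> x))"
proof -
  define B where "B = {l :: int ^ 'd. \<forall>i. l $ i \<in> D (j $ i)}"
  have B: "finite B" unfolding B_def by (rule finite_vec_box) simp
  \<comment> \<open>The case distinction encodes the zero operator of level -1. A set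
    \<open>S\<close> that contains a coordinate of level 0 thus contributes nothing, and otherwise
    the truncated subtraction in \<open>lev\<close> is a true one.\<close>
  define pm where "pm i l k = (if j $ i = 0 then 0 else mk (j $ i - 1) l k)" for i l k
  define G where "G S l k = (\<Prod>i\<in>S. pm i (l $ i) (k $ i)) * (\<Prod>i\<in>UNIV - S. mk (j $ i) (l $ i) (k $ i)) * fourier_coeff f k"
    for S l k
  define lev where "lev S = (\<chi> i. if i \<in> S then j $ i - 1 else j $ i)" for S
  have G_lev: "G S l k = (\<Prod>i\<in>UNIV. mk (lev S $ i) (l $ i) (k $ i)) * fourier_coeff f k"
    if "\<forall>i\<in>S. j $ i \<noteq> 0" for S l k
  proof -
    have "(\<Prod>i\<in>UNIV. mk (lev S $ i) (l $ i) (k $ i))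
       = (\<Prod>i\<in>S. mk (lev S $ i) (l $ i) (k $ i)) * (\<Prod>i\<in>UNIV - S. mk (lev S $ i) (l $ i) (k $ i))"
      using prod.subset_diff[of S UNIV "\<lambda>i. mk (lev S $ i) (l $ i) (k $ i)"] by (simp add: mult.commute)
    also have "(\<Prod>i\<in>S. mk (lev S $ i) (l $ i) (k $ i)) = (\<Prod>i\<in>S. pm i (l $ i) (k $ i))"
      using that by (intro prod.cong) (auto simp: lev_def pm_def)
    also have "(\<Prod>i\<in>UNIV - S. mk (lev S $ i) (l $ i) (k $ i)) = (\<Prod>i\<in>UNIV - S. mk (j $ i) (l $ i) (k $ i))"
      by (intro prod.cong) (auto simp: lev_def)
    finally show ?thesis by (simp add: G_def)
  qed
  have G_0: "G S l k = 0" if "\<not> (\<forall>i\<in>S. j $ i \<noteq> 0)" for S l k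
  proof -
    obtain i where i: "i \<in> S" "j $ i = 0" using \<open>\<not> (\<forall>i\<in>S. j $ i \<noteq> 0)\<close> by blast
    then have "pm i (l $ i) (k $ i) = 0" by (simp add: pm_def)
    then have "(\<Prod>i\<in>S. pm i (l $ i) (k $ i)) = 0" using i(1) by (intro prod_zero) auto
    then show ?thesis by (simp add: G_def)
  qed
  have smG: "G S l summable_on UNIV" for S l
  proof (cases "\<forall>i\<in>S. j $ i \<noteq> 0")
    case True
    then have "G S l = (\<lambda>k. (\<Prod>i\<in>UNIV. mk (lev S $ i) (l $ i) (k $ i)) * fourier_coeff f k)"
      using G_lev by blast
    then show ?thesis using prod_mk_summable[OF sm] by simp
  next
    case False
    then have "G S l = (\<lambda>k. 0)" using G_0 by blast
    then show ?thesis by simp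
  qed
  have qp: "quasi_prod \<phi> \<phi>t (\<chi> i. int (j $ i) - (if i \<in> S then 1 else 0)) f x
     = (\<Sum>l\<in>B. infsum (G S l) UNIV * cis (real_vec l \<bullet> x))" for S
  proof (cases "\<forall>i\<in>S. j $ i \<noteq> 0")
    case True
    then have lev: "(\<chi> i. int (j $ i) - (if i \<in> S then 1 else 0)) = (\<chi> i. int (lev S $ i))"
      by (auto simp: vec_eq_iff lev_def of_nat_diff)
    have "quasi_prod \<phi> \<phi>t (\<chi> i. int (lev S $ i)) f x =
      (\<Sum>l\<in>{l. \<forall>i. l $ i \<in> D (lev S $ i)}. infsum (G S l) UNIV * cis (real_vec l \<bullet> x))"
      unfolding quasi_prod_eq G_lev[OF True, abs_def] ..
    \<comment> \<open>Lower levels have smaller boxes. Extending all sums by zero entries to the box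
      of level \<open>j\<close> permits summation over \<open>S\<close> for each
      \<open>l\<close>.\<close>
    also have "\<dots> = (\<Sum>l\<in>B. infsum (G S l) UNIV * cis (real_vec l \<bullet> x))"
    proof (rule sum.mono_neutral_left[OF B])
      have "D (lev S $ i) \<subseteq> D (j $ i)" for i by (rule D_mono) (simp add: lev_def)
      then show "{l. \<forall>i. l $ i \<in> D (lev S $ i)} \<subseteq> B" unfolding B_def by blast
      show "\<forall>l\<in>B - {l. \<forall>i. l $ i \<in> D (lev S $ i)}. infsum (G S l) UNIV * cis (real_vec l \<bullet> x) = 0"
      proof
        fix l assume "l \<in> B - {l. \<forall>i. l $ i \<in> D (lev S $ i)}"
        then obtain i where "l $ i \<notin> D (lev S $ i)" by blast
        then have "(\<Prod>i\<in>UNIV. mk (lev S $ i) (l $ i) (k $ i)) = 0" for k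
          by (intro prod_zero) (auto simp: mker_def)
        then have "G S l k = 0" for k by (simp only: G_lev[OF True] mult_zero_left)
        then have "G S l = (\<lambda>k. 0)" by blast
        then show "infsum (G S l) UNIV * cis (real_vec l \<bullet> x) = 0" by simp
      qed
    qed
    finally show ?thesis unfolding lev .
  next
    case False
    then obtain i where "i \<in> S" "j $ i = 0" by blast
    then have "\<exists>i. (\<chi> i. int (j $ i) - (if i \<in> S then 1 else 0)) $ i < 0" by (intro exI[of _ i]) simp
    then have "quasi_prod \<phi> \<phi>t (\<chi> i. int (j $ i) - (if i \<in> S then 1 else 0)) f x = 0"
      unfolding quasi_prod_def by (simp only: if_True)
    moreover have "G S l = (\<lambda>k. 0)" for l using G_0[OF False] by blast
    ultimately show ?thesis by simp
  qed
  have sumG: "(\<Sum>S\<in>Pow UNIV. (- 1) ^ card S * infsum (G S l) UNIV) = (\<Sum>\<^sub>\<infinity>k. tensor_dk j l k * fourier_coeff f k)" for l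
  proof -
    have "tensor_dk j l k = (\<Prod>i\<in>UNIV. mk (j $ i) (l $ i) (k $ i) - pm i (l $ i) (k $ i))" for k
      by (simp add: tensor_dk_def dker_def pm_def)
    then have vkG: "tensor_dk j l k * fourier_coeff f k = (\<Sum>S\<in>Pow UNIV. (- 1) ^ card S * G S l k)" for k
      by (simp add: prod_diff_conv_sum G_def sum_distrib_right mult.assoc)
    have "(\<Sum>\<^sub>\<infinity>k. \<Sum>S\<in>Pow UNIV. (- 1) ^ card S * G S l k) = (\<Sum>S\<in>Pow UNIV. \<Sum>\<^sub>\<infinity>k. (- 1) ^ card S * G S l k)"
      by (intro infsum_finite_sum summable_on_cmult_right smG) simp
    also have "\<dots> = (\<Sum>S\<in>Pow UNIV. (- 1) ^ card S * infsum (G S l) UNIV)"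
      by (simp only: infsum_cmult_right')
    finally show ?thesis by (simp add: vkG)
  qed
  have "eta \<phi> \<phi>t j f x = (\<Sum>S\<in>Pow UNIV. \<Sum>l\<in>B. (- 1) ^ card S * infsum (G S l) UNIV * cis (real_vec l \<bullet> x))"
    unfolding eta_def qp by (simp add: sum_distrib_left mult.assoc)
  also have "\<dots> = (\<Sum>l\<in>B. (\<Sum>S\<in>Pow UNIV. (- 1) ^ card S * infsum (G S l) UNIV) * cis (real_vec l \<bullet> x))"
    by (subst sum.swap) (simp add: sum_distrib_right)
  finally show ?thesis by (simp only: sumG B_def)
qed

lemma fourier_coeff_error:
  fixes f :: "real ^ 'd::finite \<Rightarrow> complex"
  assumes f: "f \<in> L1_torus" and T: "T < 1"
    and sm: "\<And>j l. (\<lambda>k. cmod (tensor_dk j l k * fourier_coeff f k)) summable_on UNIV"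
  shows "fourier_coeff (\<lambda>x. f x - sparse_grid_op \<phi> \<phi>t n T f x) l =
    fourier_coeff f l - (\<Sum>j\<in>Delta n T. \<Sum>\<^sub>\<infinity>k. tensor_dk j l k * fourier_coeff f k)"
proof -
  define \<Delta> where "\<Delta> = (Delta n T :: (nat ^ 'd) set)"
  have fin: "finite \<Delta>" unfolding \<Delta>_def by (rule finite_Delta[OF T])
  define e where "e j l = (\<Sum>\<^sub>\<infinity>k. tensor_dk j l k * fourier_coeff f k)" for j l
  \<comment> \<open>One finite set of frequencies for all levels of the grid turns the operator into
    a single trigonometric polynomial.\<close>
  define B where "B = (\<Union>j\<in>\<Delta>. {l :: int ^ 'd. \<forall>i. l $ i \<in> D (j $ i)})"
  have finB: "finite B" unfolding B_def using fin by (intro finite_UN_I finite_vec_box) auto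
  have e0: "e j l = 0" if "\<not> (\<forall>i. l $ i \<in> D (j $ i))" for j l
  proof -
    have "tensor_dk j l k = 0" for k using that tensor_dk_support by blast
    then show ?thesis by (simp add: e_def)
  qed
  have "eta \<phi> \<phi>t j f x = (\<Sum>l\<in>B. e j l * cis (real_vec l \<bullet> x))" if "j \<in> \<Delta>" for j x
    unfolding eta_eq[OF sm] e_def[symmetric]
    using finB that e0 by (intro sum.mono_neutral_left) (auto simp: B_def)
  then have "sparse_grid_op \<phi> \<phi>t n T f x = (\<Sum>j\<in>\<Delta>. \<Sum>l\<in>B. e j l * cis (real_vec l \<bullet> x))" for x
    by (simp add: sparse_grid_op_def \<Delta>_def)
  then have "sparse_grid_op \<phi> \<phi>t n T f x = (\<Sum>l\<in>B. (\<Sum>j\<in>\<Delta>. e j l) * cis (real_vec l \<bullet> x))" for x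
    by (simp add: sum_distrib_right sum.swap[of _ B \<Delta>])
  then have "fourier_coeff (\<lambda>x. f x - sparse_grid_op \<phi> \<phi>t n T f x) l
     = fourier_coeff f l - (if l \<in> B then \<Sum>j\<in>\<Delta>. e j l else 0)"
    using fourier_coeff_minus_trig[OF f finB] by simp
  also have "(if l \<in> B then \<Sum>j\<in>\<Delta>. e j l else 0) = (\<Sum>j\<in>\<Delta>. e j l)"
  proof (cases "l \<in> B")
    case False
    then have "e j l = 0" if "j \<in> \<Delta>" for j using e0 that unfolding B_def by blast
    then show ?thesis using False by simp
  qed simp
  finally show ?thesis by (simp add: \<Delta>_def e_def)
qed

end

section \<open>Translation between extended exponents and their reciprocals\<close>

lemma real_of_ereal_1_div:
  assumes "1 \<le> p"
  shows "0 \<le> real_of_ereal (1 / p)" "real_of_ereal (1 / p) \<le> 1"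
    and "real_of_ereal (1 / conj_exp p) = 1 - real_of_ereal (1 / p)" and "1 \<le> conj_exp p"
proof -
  consider "p = \<infinity>" | "p = 1" | r where "p = ereal r" "1 < r"
    using assms by (cases p) (auto simp: one_ereal_def order_le_less)
  then have "0 \<le> real_of_ereal (1 / p) \<and> real_of_ereal (1 / p) \<le> 1 \<and>
     real_of_ereal (1 / conj_exp p) = 1 - real_of_ereal (1 / p) \<and> 1 \<le> conj_exp p"
  proof cases
    case 1
    then show ?thesis by (simp add: conj_exp_def)
  next
    case 2
    then show ?thesis by (simp add: conj_exp_def)
  next
    case 3
    have "1 / p = ereal (1 / r)" using 3 by (simp add: one_ereal_def)
    moreover have c: "conj_exp p = ereal (r / (r - 1))" using 3 by (simp add: conj_exp_def one_ereal_def)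
    moreover have "1 / conj_exp p = ereal ((r - 1) / r)" using 3 unfolding c by (simp add: one_ereal_def)
    ultimately show ?thesis using 3 by (simp add: one_ereal_def field_simps)
  qed
  then show "0 \<le> real_of_ereal (1 / p)" "real_of_ereal (1 / p) \<le> 1"
    "real_of_ereal (1 / conj_exp p) = 1 - real_of_ereal (1 / p)" "1 \<le> conj_exp p" by auto
qed

lemma lp_le_powr_iff:
  assumes "0 < r" "0 \<le> M" "\<And>k. 0 \<le> x k"
  shows "lp_le (1 / r) x M \<longleftrightarrow> lp_le 1 (\<lambda>k. x k powr r) (M powr r)"
  using assms by (simp add: lp_le_def)

lemma lr_norm_le:
  assumes "1 \<le> p" "lp_le (real_of_ereal (1 / p)) x M"
  shows "lr_norm p x \<le> ennreal M"
proof (cases p)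
  case (real r)
  then have r: "1 \<le> r" using assms by simp
  note nn = lp_le_nonneg[OF assms(2)] lp_le_bound_nonneg[OF assms(2)]
  have "1 / p = ereal (1 / r)" using real r by (simp add: one_ereal_def)
  then have "lp_le 1 (\<lambda>k. x k powr r) (M powr r)"
    using assms(2) lp_le_powr_iff[of r M x] nn r by simp
  then have sm: "(\<lambda>k. x k powr r) summable_on UNIV" and le: "(\<Sum>\<^sub>\<infinity>k. x k powr r) \<le> M powr r"
    by (auto simp: lp_le_1_iff)
  have "(\<Sum>\<^sub>\<infinity>k. x k powr r) powr (1 / r) \<le> (M powr r) powr (1 / r)"
    using le r by (intro powr_mono2 infsum_nonneg) auto
  also have "\<dots> = M" using r nn by (simp add: powr_powr)
  finally show ?thesis using real sm by (simp add: lr_norm_def ennreal_leI)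
next
  case PInf
  then show ?thesis using assms by (auto simp: lr_norm_def lp_le_0_iff intro!: SUP_least ennreal_leI)
qed (use assms in auto)

lemma lp_le_lr_norm:
  assumes p: "1 \<le> p" and x: "\<And>k. 0 \<le> x k" and fin: "lr_norm p x < \<infinity>"
  shows "lp_le (real_of_ereal (1 / p)) x (enn2real (lr_norm p x))"
proof (cases p)
  case (real r)
  then have r: "1 \<le> r" using p by simp
  have e: "1 / p = ereal (1 / r)" using real r by (simp add: one_ereal_def)
  have sm: "(\<lambda>k. x k powr r) summable_on UNIV"
    using fin real by (auto simp: lr_norm_def split: if_splits)
  have S0: "0 \<le> (\<Sum>\<^sub>\<infinity>k. x k powr r)" by (intro infsum_nonneg) auto
  have n: "enn2real (lr_norm p x) = (\<Sum>\<^sub>\<infinity>k. x k powr r) powr (1 / r)"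
    using real sm by (simp add: lr_norm_def)
  have "lp_le 1 (\<lambda>k. x k powr r) (((\<Sum>\<^sub>\<infinity>k. x k powr r) powr (1 / r)) powr r)"
    using sm S0 r by (simp add: lp_le_1_iff powr_powr)
  then show ?thesis unfolding n e using lp_le_powr_iff[of r _ x] x r by simp
next
  case PInf
  have "x k \<le> enn2real (lr_norm p x)" for k
  proof -
    have "ennreal (x k) \<le> lr_norm p x" using PInf by (auto simp: lr_norm_def intro: SUP_upper)
    then have "enn2real (ennreal (x k)) \<le> enn2real (lr_norm p x)" using fin by (intro enn2real_mono) auto
    then show ?thesis using x by simp
  qed
  then show ?thesis using PInf x by (simp add: lp_le_0_iff)
qed (use p in auto)

text \<open>The reciprocal of the conjugate exponent of q is 1 - 1/q, the parameter required of the
  rows. For an infinite conjugate exponent the amalgam norm is a supremum over all frequencies,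
  which dominates that over a residue class.\<close>

lemma amalgam_rows:
  assumes q: "1 \<le> q" and fin: "(SUP j. amalgam_norm (conj_exp q) j (\<phi>t j)) < \<infinity>" and l: "l \<in> D j"
  shows "lp_le (1 - real_of_ereal (1 / q)) (\<lambda>\<mu>. cmod (dist_coeff (\<phi>t j) (l + 2 ^ j * \<mu>)))
    (enn2real (SUP j. amalgam_norm (conj_exp q) j (\<phi>t j)))"
proof -
  define x where "x \<mu> = cmod (dist_coeff (\<phi>t j) (l + 2 ^ j * \<mu>))" for \<mu>
  define A where "A = (SUP j. amalgam_norm (conj_exp q) j (\<phi>t j))"
  have "lr_norm (conj_exp q) x \<le> amalgam_norm (conj_exp q) j (\<phi>t j)"
  proof (cases "conj_exp q = \<infinity>")
    case True
    then show ?thesis by (auto simp: lr_norm_def amalgam_norm_def x_def intro!: SUP_least intro: SUP_upper)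
  next
    case False
    then show ?thesis using l unfolding amalgam_norm_def x_def by (auto intro: SUP_upper)
  qed
  also have "\<dots> \<le> A" unfolding A_def by (rule SUP_upper) simp
  finally have le: "lr_norm (conj_exp q) x \<le> A" .
  then have fin': "lr_norm (conj_exp q) x < \<infinity>" using fin unfolding A_def by (rule le_less_trans)
  have "lp_le (1 - real_of_ereal (1 / q)) x (enn2real (lr_norm (conj_exp q) x))"
    using lp_le_lr_norm[OF real_of_ereal_1_div(4)[OF q] _ fin'] real_of_ereal_1_div(3)[OF q]
    by (simp add: x_def)
  then show ?thesis
    unfolding x_def[symmetric] A_def[symmetric]
    using real_of_ereal_1_div(2)[OF q] fin le
    by (elim lp_le_mono) (auto simp: x_def A_def intro: enn2real_mono)
qed

lemma hybrid_wiener_norm_eq: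
  "hybrid_wiener_norm p \<alpha> \<beta> f = lr_norm p (\<lambda>k. hybrid_weight \<alpha> \<beta> k * cmod (fourier_coeff f k))"
  by (simp add: hybrid_wiener_norm_def hybrid_weight_def)

lemma Omega_rate_eq:
  "Omega_rate d p q \<alpha> \<beta> \<gamma> T n = sparse_rate (real d) (1 - real_of_ereal (1 / p)) (\<alpha> - sigma_pq p q) (\<gamma> - \<beta>) T n"
proof -
  have "\<alpha> + \<beta> - \<gamma> - sigma_pq p q = \<alpha> - sigma_pq p q - (\<gamma> - \<beta>)" by simp
  then show ?thesis unfolding Omega_rate_def sparse_rate_def Let_def by (simp only:)
qed

theorem theorem5p1:
  fixes p q :: ereal
    and \<alpha> \<beta> \<gamma> T N s :: real
    and C\<^sub>\<phi>\<^sub>t C\<^sub>\<phi> C\<^sub>s :: real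
    and \<phi> :: "nat \<Rightarrow> real \<Rightarrow> complex"
    and \<phi>t :: "nat \<Rightarrow> (real \<Rightarrow> complex) \<Rightarrow> complex"
  assumes "1 \<le> p" and "1 \<le> q"
    and "\<alpha> > sigma_pq p q" and "\<gamma> \<ge> 0"
    and "\<gamma> - \<beta> < \<alpha> - sigma_pq p q"
    and "T < 1"
    and "\<And>j. \<phi>t j \<in> periodic_distributions"
    and "\<And>j. \<phi> j \<in> trig_poly j"
    and "N \<ge> 0" and "s > max (\<alpha> + \<beta>) \<alpha>"
    and "\<And>j l. cmod (dist_coeff (\<phi>t j) l) \<le> C\<^sub>\<phi>\<^sub>t * (1 + \<bar>real_of_int l / 2 ^ j\<bar> powr N)"
    and "\<And>j l. cmod (fourier_coeff1 (\<phi> j) l) \<le> C\<^sub>\<phi>"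
    and "\<And>j l. l \<in> D j \<Longrightarrow>
           cmod (1 - fourier_coeff1 (\<phi> j) l * dist_coeff (\<phi>t j) l)
             \<le> C\<^sub>s * \<bar>real_of_int l / 2 ^ j\<bar> powr s"
    and "min (\<alpha> + \<beta>) \<alpha> > N + real_of_ereal (1 / conj_exp p) \<or>
         (N = 0 \<and> (SUP j. amalgam_norm (conj_exp q) j (\<phi>t j)) < \<infinity>)"
  shows "\<exists>C>0. \<forall>f \<in> (hybrid_wiener_space p \<alpha> \<beta> :: (real ^ 'd \<Rightarrow> complex) set). \<forall>n\<ge>1.
           wiener_norm q \<gamma> (\<lambda>x. f x - sparse_grid_op \<phi> \<phi>t n T f x)
             \<le> ennreal (C * Omega_rate CARD('d) p q \<alpha> \<beta> \<gamma> T n) * hybrid_wiener_norm p \<alpha> \<beta> f"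
proof -
  \<comment> \<open>The three given constants carry no sign condition; the sum of absolute values is
    a nonnegative common bound.\<close>
  define C0 where "C0 = \<bar>C\<^sub>\<phi>\<^sub>t\<bar> + \<bar>C\<^sub>\<phi>\<bar> + \<bar>C\<^sub>s\<bar>"
  define ip where "ip = real_of_ereal (1 / p)"
  define iq where "iq = real_of_ereal (1 / q)"
  have ip: "0 \<le> ip" "ip \<le> 1" and iq: "0 \<le> iq" "iq \<le> 1"
    using real_of_ereal_1_div[OF assms(1)] real_of_ereal_1_div[OF assms(2)] by (auto simp: ip_def iq_def)
  have \<sigma>: "sigma_pq p q = max 0 (iq - ip)" by (simp add: sigma_pq_def ip_def iq_def)
  interpret quasi_interpolation \<phi> \<phi>t C0 N s
  proof
    show "0 \<le> C0" by (simp add: C0_def)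
    show "0 \<le> N" by fact
    show "0 < s" using assms(3,10) \<sigma> by simp
    show "cmod (fourier_coeff1 (\<phi> j) l) \<le> C0" for j l
      using assms(12)[of j l] by (simp add: C0_def)
    show "cmod (dist_coeff (\<phi>t j) k) \<le> C0 * (1 + \<bar>real_of_int k / 2 ^ j\<bar> powr N)" for j k
    proof -
      have "C\<^sub>\<phi>\<^sub>t * (1 + \<bar>real_of_int k / 2 ^ j\<bar> powr N) \<le> C0 * (1 + \<bar>real_of_int k / 2 ^ j\<bar> powr N)"
        by (intro mult_right_mono add_nonneg_nonneg) (auto simp: C0_def)
      then show ?thesis using assms(11)[of j k] by (rule order_trans[rotated])
    qed
    show "cmod (1 - fourier_coeff1 (\<phi> j) l * dist_coeff (\<phi>t j) l) \<le> C0 * \<bar>real_of_int l / 2 ^ j\<bar> powr s"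
      if "l \<in> D j" for j l
    proof -
      have "C\<^sub>s * \<bar>real_of_int l / 2 ^ j\<bar> powr s \<le> C0 * \<bar>real_of_int l / 2 ^ j\<bar> powr s"
        by (intro mult_right_mono) (auto simp: C0_def)
      then show ?thesis using assms(13)[OF that] by (rule order_trans[rotated])
    qed
  qed
  have alt: "N + (1 - ip) < min \<alpha> (\<alpha> + \<beta>) \<or>
    (\<exists>K. \<forall>j. \<forall>l\<in>D j. lp_le (1 - iq) (\<lambda>\<mu>. cmod (dist_coeff (\<phi>t j) (l + 2 ^ j * \<mu>))) K)"
    using assms(14)
  proof
    assume "min (\<alpha> + \<beta>) \<alpha> > N + real_of_ereal (1 / conj_exp p)"
    then show ?thesis using real_of_ereal_1_div(3)[OF assms(1)] by (simp add: ip_def min.commute)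
  next
    assume "N = 0 \<and> (SUP j. amalgam_norm (conj_exp q) j (\<phi>t j)) < \<infinity>"
    then show ?thesis using amalgam_rows[OF assms(2)] unfolding iq_def by blast
  qed
  have s: "max \<alpha> (\<alpha> + \<beta>) < s" using assms(10) by simp
  obtain C where C: "C > 0" and err: "\<And>(c :: int ^ 'd \<Rightarrow> complex) H. lp_le ip (\<lambda>k. hybrid_weight \<alpha> \<beta> k * cmod (c k)) H \<Longrightarrow>
    (\<forall>j l. (\<lambda>k. cmod (tensor_dk j l k * c k)) summable_on UNIV) \<and>
    (\<forall>n\<ge>1. lp_le iq (\<lambda>l. (1 + norm (real_vec l)) powr \<gamma> *
        cmod (c l - (\<Sum>j\<in>Delta n T. \<Sum>\<^sub>\<infinity>k. tensor_dk j l k * c k)))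
      (C * sparse_rate (real CARD('d)) (1 - ip) (\<alpha> - sigma_pq p q) (\<gamma> - \<beta>) T n * H))"
    using approx_error[OF ip iq \<sigma> s assms(3) alt assms(4,5,6), where 'd = 'd] by blast
  show ?thesis
  proof (intro exI[of _ C] conjI ballI allI impI)
    show "0 < C" by fact
    fix f :: "real ^ 'd \<Rightarrow> complex" and n :: nat
    assume f: "f \<in> hybrid_wiener_space p \<alpha> \<beta>" and n: "1 \<le> n"
    have L1: "f \<in> L1_torus" and fin: "hybrid_wiener_norm p \<alpha> \<beta> f < \<infinity>"
      using f by (auto simp: hybrid_wiener_space_def)
    define H where "H = enn2real (hybrid_wiener_norm p \<alpha> \<beta> f)"
    have "lp_le ip (\<lambda>k. hybrid_weight \<alpha> \<beta> k * cmod (fourier_coeff f k)) H"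
      using fin unfolding H_def ip_def hybrid_wiener_norm_eq
      by (intro lp_le_lr_norm assms(1) mult_nonneg_nonneg less_imp_le[OF hybrid_weight_pos]) auto
    note E = err[OF this]
    have coeff: "fourier_coeff (\<lambda>x. f x - sparse_grid_op \<phi> \<phi>t n T f x) l =
      fourier_coeff f l - (\<Sum>j\<in>Delta n T. \<Sum>\<^sub>\<infinity>k. tensor_dk j l k * fourier_coeff f k)" for l
      using E by (intro fourier_coeff_error L1 assms(6)) blast
    have w0: "hybrid_weight 0 \<gamma> l = (1 + norm (real_vec l)) powr \<gamma>" for l :: "int ^ 'd"
    proof -
      \<comment> \<open>\<open>powr\<close> with exponent 0 gives 1 only for a nonzero base.\<close>
      have "1 + \<bar>real_of_int (l $ i)\<bar> \<noteq> 0" for i by linarith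
      then show ?thesis by (simp add: hybrid_weight_def)
    qed
    have "wiener_norm q \<gamma> (\<lambda>x. f x - sparse_grid_op \<phi> \<phi>t n T f x)
       \<le> ennreal (C * Omega_rate CARD('d) p q \<alpha> \<beta> \<gamma> T n * H)"
      unfolding wiener_norm_def hybrid_wiener_norm_eq coeff w0 Omega_rate_eq ip_def[symmetric]
      using E n by (intro lr_norm_le assms(2)) (simp add: iq_def)
    also have "\<dots> = ennreal (C * Omega_rate CARD('d) p q \<alpha> \<beta> \<gamma> T n) * ennreal H"
      using C by (intro ennreal_mult) (auto simp: H_def Omega_rate_def Let_def)
    also have "ennreal H = hybrid_wiener_norm p \<alpha> \<beta> f"
      using fin by (simp add: H_def)
    finally show "wiener_norm q \<gamma> (\<lambda>x. f x - sparse_grid_op \<phi> \<phi>t n T f x)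
      \<le> ennreal (C * Omega_rate CARD('d) p q \<alpha> \<beta> \<gamma> T n) * hybrid_wiener_norm p \<alpha> \<beta> f" .
  qed
qed

end
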